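(* Let $d\ge 1$ and for $1\le i\le d$ let $\psi_i:\mathbb{R}^+\to\mathbb{R}^+$ be a real, positive, non-increasing function; write $\Psi=(\psi_1,\dots,\psi_d)$. Let $W_d(\Psi)$ be the set of $\mathbf{x}=(x_1,\dots,x_d)\in[0,1]^d$ for which $\|qx_i\|\le\psi_i(q)$ for all $1\le i\le d$ holds for infinitely many $q\in\mathbb{N}$. Then $$\dim_{\rm H} W_d(\Psi)=\sup_{\mathbf{t}\in\mathcal{U}(\Psi)}\min\Big\{\min_{i\in\mathcal{L}(\mathbf{t})}\zeta_i(\mathbf{t}),\ \#\mathcal{L}(\mathbf{t})\Big\}.$$
   Context: $\|\cdot\|$ denotes distance to the nearest integer. $\mathcal{U}(\Psi)$ is the set of accumulation points $\mathbf{t}=(t_1,\dots,t_d)\in([0,+\infty)\cup\{+\infty\})^d$ (accumulation in the extended sense, coordinates equal to $+\infty$ allowed) of the sequence $\big(\frac{-\log\psi_1(n)}{\log n},\dots,\frac{-\log\psi_d(n)}{\log n}\big)_{n\ge1}$. For such $\mathbf{t}$, $\mathcal{L}(\mathbf{t}):=\{1\le i\le d: t_i<+\infty\}$, and for $i\in\mathcal{L}(\mathbf{t})$, $\zeta_i(\mathbf{t}):=\frac{d+1+\sum_{k:\,t_k<t_i}(t_i-t_k)}{1+t_i}$. (When $\mathcal{L}(\mathbf{t})=\emptyset$ the inner quantity is $0$.) *)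

theory Defs
  imports "HOL-Analysis.Analysis"
begin

(* The conventions are that the empty set contributes 0 and that diam(U)^0 = 1 for nonempty U
   (whereas 0 powr 0 = 0), so that the 0-dimensional Hausdorff measure is the counting measure. *)
definition diam_pow :: "real \<Rightarrow> 'a::metric_space set \<Rightarrow> ennreal" where
  "diam_pow s U =
     (if U = {} then 0 else if s = 0 then 1 else ennreal (diameter U powr s))"

(* Boundedness is required because diameter is only meaningful for bounded sets. *)
definition delta_covers :: "real \<Rightarrow> 'a::metric_space set \<Rightarrow> (nat \<Rightarrow> 'a set) set" where
  "delta_covers \<delta> A =
     {U. A \<subseteq> (\<Union>n. U n) \<and> (\<forall>n. bounded (U n) \<and> diameter (U n) \<le> \<delta>)}"

definition hausdorff_premeasure :: "real \<Rightarrow> real \<Rightarrow> 'a::metric_space set \<Rightarrow> ennreal" where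
  "hausdorff_premeasure s \<delta> A = (INF U \<in> delta_covers \<delta> A. \<Sum>n. diam_pow s (U n))"

definition hausdorff_measure :: "real \<Rightarrow> 'a::metric_space set \<Rightarrow> ennreal" where
  "hausdorff_measure s A = (SUP \<delta>\<in>{0<..}. hausdorff_premeasure s \<delta> A)"

definition hausdorff_dim :: "'a::metric_space set \<Rightarrow> ereal" where
  "hausdorff_dim A = (INF s\<in>{s. 0 \<le> s \<and> hausdorff_measure s A = 0}. ereal s)"

definition dist_nearest_int :: "real \<Rightarrow> real" where
  "dist_nearest_int x = infdist x \<int>"

definition approximable_set :: "('d::finite \<Rightarrow> real \<Rightarrow> real) \<Rightarrow> (real ^ 'd) set" where
  "approximable_set \<psi> =
     {x. (\<forall>i. x $ i \<in> {0..1}) \<and>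
         infinite {q::nat. q \<ge> 1 \<and> (\<forall>i. dist_nearest_int (real q * x $ i) \<le> \<psi> i (real q))}}"

(* The values at n = 0 and n = 1 are meaningless (division by zero) and do not affect
   accumulation points. *)
definition order_seq :: "('d::finite \<Rightarrow> real \<Rightarrow> real) \<Rightarrow> nat \<Rightarrow> ereal ^ 'd" where
  "order_seq \<psi> n = (\<chi> i. ereal (- ln (\<psi> i (real n)) / ln (real n)))"

(* Accumulation points of the sequence, i.e. subsequential limits in the product topology of the
   extended reals, rather than limit points of its range. *)
definition order_accumulation_points ::
    "('d::finite \<Rightarrow> real \<Rightarrow> real) \<Rightarrow> (ereal ^ 'd) set" where
  "order_accumulation_points \<psi> =
     {t. (\<forall>i. 0 \<le> t $ i) \<and> (\<exists>r. strict_mono r \<and> (order_seq \<psi> \<circ> r) \<longlonglongrightarrow> t)}"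

definition finite_coords :: "ereal ^ 'd \<Rightarrow> 'd::finite set" where
  "finite_coords t = {i. t $ i < \<infinity>}"

(* Only used for nonnegative t and i in finite_coords t; then all t $ k occurring in the sum
   are finite as well, so real_of_ereal is faithful. *)
definition zeta_coord :: "ereal ^ 'd \<Rightarrow> 'd::finite \<Rightarrow> real" where
  "zeta_coord t i =
     (real CARD('d) + 1 + (\<Sum>k | t $ k < t $ i. (real_of_ereal (t $ i) - real_of_ereal (t $ k))))
       / (1 + real_of_ereal (t $ i))"

definition dim_bound :: "ereal ^ 'd \<Rightarrow> real" where
  "dim_bound t =
     (if finite_coords t = {} then 0
      else min (Min (zeta_coord t ` finite_coords t)) (real (card (finite_coords t))))"

end

theory Submission
  imports Defs "HOL-Real_Asymp.Real_Asymp"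
begin

text \<open>
  Upper bound: for \<open>2\<^sup>j \<le> q < 2\<^sup>j\<^sup>+\<^sup>1\<close> the boxes around the points \<open>p/q\<close> have, by monotonicity, sides at most
  \<open>2 \<psi> i (2\<^sup>j) / 2\<^sup>j\<close>. Cutting them into cubes whose side belongs to a coordinate \<open>k\<close> of finite order costs
  \<open>2\<close> to the power \<open>j (1 + t k) (\<zeta> k - s)\<close>; if \<open>s\<close> exceeds the number of finite orders, the coordinate of
  smallest infinite order is used instead. Compactness of the extended reals makes the exponent
  uniformly negative.

  Lower bound: along a subsequence \<open>N\<close> realising \<open>t\<close>, all rational points with denominator in \<open>(N/2, N]\<close>
  are used, so that monotonicity again reduces everything to the single box shape \<open>\<rho> i = min 1 (\<psi> i N) / N\<close>.
  For denominators \<open>q, q'\<close> with gcd \<open>g\<close>, the pairs of fractions at distance \<open>\<le> R\<close> number \<open>O(N\<^sup>2 R + g)\<close>;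
  since the average of \<open>g\<close> is only logarithmic, pair correlations are of Poisson type on average, and
  discarding few points leaves points none of which has too many neighbours at any scale. No
  transference principle is needed. The resulting density estimate is
  \<open>N\<^sup>\<epsilon> (N\<^sup>-\<^sup>d\<^sup>-\<^sup>1 \<Prod>\<^sub>i min 1 (r / \<rho> i) + r\<^sup>d)\<close> for \<open>r \<le> 1/N\<close>, and comparing it with \<open>r\<^sup>s\<close> at the breakpoints \<open>r = \<rho> i\<close>
  yields exactly the numbers \<open>\<zeta> i\<close>. Iterating gives a Cantor set of dimension at least \<open>s\<close>.
\<close>

section \<open>Covers and vanishing Hausdorff measure\<close>

text \<open>Fractions are indexed by pairs \<open>(q, p)\<close>, coincidences included. There are
  about \<open>N^(d+1)\<close> of them, so independent placement would give each one about
  \<open>1 + N^(d+1) * (\<Prod>i. R i)\<close> neighbours in a box with sides \<open>R i\<close>,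
  and the gcd term loses only a logarithm against this. A ball of radius \<open>r\<close> sees the
  share \<open>min 1 (r / \<rho> i)\<close> of a box in coordinate \<open>i\<close>; since
  \<open>min 1 (r / \<rho> i) * max r (\<rho> i) = r\<close>, share times neighbour count gives the
  two terms of the density estimate. At \<open>r = \<rho> i\<close>, which is about
  \<open>N powr - (1 + t i)\<close>, the first term is \<open>N\<close> to the power
  \<open>- (d + 1 + \<Sum>k. max 0 (t i - t k))\<close>, to be compared with
  \<open>- s * (1 + t i)\<close>: hence the quotient \<open>\<zeta> i\<close>. As \<open>r\<close>
  tends to 0 with \<open>N\<close> fixed, only the finite orders guarantee a decaying factor, hence
  the bound by their number. Every loss is a constant or a power \<open>N powr \<epsilon>\<close>,
  paid for by the gap between \<open>s\<close> and the bound, because \<open>N\<close> is chosen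
  after the parent cube. Constants do not multiply along the levels, because the mass estimate at
  the scale where a step ends has constant 1.\<close>

lemma hausdorff_measure_eq_0I:
  assumes "\<And>\<delta> e. 0 < \<delta> \<Longrightarrow> 0 < e \<Longrightarrow> \<exists>U\<in>delta_covers \<delta> A. (\<Sum>n. diam_pow s (U n)) \<le> ennreal e"
  shows "hausdorff_measure s A = 0"
proof -
  have "hausdorff_premeasure s \<delta> A = 0" if "0 < \<delta>" for \<delta>
  proof -
    have "hausdorff_premeasure s \<delta> A \<le> 0 + ennreal e" if "0 < e" for e
    proof -
      obtain U where "U \<in> delta_covers \<delta> A" "(\<Sum>n. diam_pow s (U n)) \<le> ennreal e"
        using assms[OF \<open>0 < \<delta>\<close> \<open>0 < e\<close>] by blast
      then show ?thesis
        unfolding hausdorff_premeasure_def add_0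
        by (rule order_trans[OF INF_lower[where f="\<lambda>U. \<Sum>n. diam_pow s (U n)"]])
    qed
    then have "hausdorff_premeasure s \<delta> A \<le> 0"
      by (rule ennreal_le_epsilon)
    then show ?thesis by simp
  qed
  then show ?thesis
    unfolding hausdorff_measure_def by (intro antisym SUP_least) auto
qed

text \<open>Explicit covers with a real cost bound can be glued and compared without handling
  infima.\<close>

definition has_cover :: "real \<Rightarrow> 'a::metric_space set \<Rightarrow> real \<Rightarrow> real \<Rightarrow> bool" where
  "has_cover s A \<delta> c \<longleftrightarrow> (\<exists>U\<in>delta_covers \<delta> A. (\<Sum>n. diam_pow s (U n)) \<le> ennreal c)"

lemma has_cover_finite:
  fixes F :: "'i \<Rightarrow> 'a::metric_space set"
  assumes fin: "finite I" and s: "0 < s" and \<delta>: "0 \<le> \<delta>"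
    and A: "A \<subseteq> (\<Union>i\<in>I. F i)"
    and F: "\<And>i. i \<in> I \<Longrightarrow> bounded (F i) \<and> diameter (F i) \<le> \<delta>"
  shows "has_cover s A \<delta> (real (card I) * \<delta> powr s)"
proof -
  obtain h where h: "bij_betw h {0..<card I} I"
    using ex_bij_betw_nat_finite[OF fin] by blast
  define U where "U n = (if n < card I then F (h n) else {})" for n
  have hI: "h n \<in> I" if "n < card I" for n
    using h that by (auto simp: bij_betw_def)
  have "A \<subseteq> (\<Union>n. U n)"
  proof
    fix x assume "x \<in> A"
    then obtain i where i: "i \<in> I" "x \<in> F i" using A by blast
    then obtain n where "n < card I" "h n = i"
      using h by (metis atLeastLessThan_iff bij_betw_imp_surj_on imageE)
    then show "x \<in> (\<Union>n. U n)" using i by (auto simp: U_def intro!: exI[of _ n])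
  qed
  then have U: "U \<in> delta_covers \<delta> A"
    unfolding delta_covers_def using F hI \<delta> by (auto simp: U_def)
  have le: "diam_pow s (U n) \<le> (if n < card I then ennreal (\<delta> powr s) else 0)" for n
    using s F[OF hI, of n] by (auto simp: diam_pow_def U_def intro!: ennreal_leI powr_mono2 diameter_ge_0)
  have "(\<Sum>n. diam_pow s (U n)) \<le> (\<Sum>n. if n < card I then ennreal (\<delta> powr s) else 0)"
    by (intro suminf_le le) auto
  also have "\<dots> = (\<Sum>n<card I. ennreal (\<delta> powr s))"
    by (subst suminf_finite[of "{..<card I}"]) auto
  also have "\<dots> = ennreal (real (card I) * \<delta> powr s)"
    by (simp add: ennreal_mult ennreal_of_nat_eq_real_of_nat)
  finally show ?thesis unfolding has_cover_def using U by blast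
qed

lemma has_cover_UN:
  fixes A :: "nat \<Rightarrow> 'a::metric_space set"
  assumes "\<And>j. has_cover s (A j) \<delta> (c j)" and c: "\<And>j. 0 \<le> c j" "summable c"
  shows "has_cover s (\<Union>j. A j) \<delta> (\<Sum>j. c j)"
proof -
  obtain U where U: "\<And>j. U j \<in> delta_covers \<delta> (A j)"
      "\<And>j. (\<Sum>n. diam_pow s (U j n)) \<le> ennreal (c j)"
    using assms(1) unfolding has_cover_def by metis
  define V where "V n = U (fst (prod_decode n)) (snd (prod_decode n))" for n
  have "(\<Union>j. A j) \<subseteq> (\<Union>n. V n)"
  proof
    fix x assume "x \<in> (\<Union>j. A j)"
    then obtain j k where "x \<in> U j k" using U(1) unfolding delta_covers_def by blast
    then have "x \<in> V (prod_encode (j, k))" by (simp add: V_def)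
    then show "x \<in> (\<Union>n. V n)" by blast
  qed
  then have V: "V \<in> delta_covers \<delta> (\<Union>j. A j)"
    using U(1) unfolding delta_covers_def by (auto simp: V_def)
  have "(\<Sum>n. diam_pow s (V n)) = (\<Sum>j. \<Sum>k. diam_pow s (U j k))"
    using suminf_ennreal_2dimen[of "\<lambda>j. \<Sum>k. diam_pow s (U j k)" "\<lambda>(j, k). diam_pow s (U j k)"]
    by (simp add: V_def o_def case_prod_beta)
  also have "\<dots> \<le> (\<Sum>j. ennreal (c j))"
    by (intro suminf_le U(2)) auto
  also have "\<dots> = ennreal (\<Sum>j. c j)"
    using c by (intro suminf_ennreal2) auto
  finally show ?thesis unfolding has_cover_def using V by blast
qed

lemma has_cover_mono:
  assumes "has_cover s A \<delta> c" "B \<subseteq> A" "\<delta> \<le> \<delta>'" "c \<le> c'"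
  shows "has_cover s B \<delta>' c'"
proof -
  obtain U where U: "U \<in> delta_covers \<delta> A" "(\<Sum>n. diam_pow s (U n)) \<le> ennreal c"
    using assms(1) unfolding has_cover_def by blast
  have "U \<in> delta_covers \<delta>' B"
    using U(1) assms(2,3) unfolding delta_covers_def by (blast intro: order_trans)
  moreover have "(\<Sum>n. diam_pow s (U n)) \<le> ennreal c'"
    using U(2) assms(4) ennreal_leI order_trans by blast
  ultimately show ?thesis unfolding has_cover_def by blast
qed

text \<open>This is the convergence half of the Borel-Cantelli principle: a point of
  \<open>B\<close> lies in \<open>A j\<close> for arbitrarily large \<open>j\<close>, so every tail
  of the family covers \<open>B\<close>, and the tails of a summable cost are arbitrarily small.
  That \<open>D\<close> tends to zero makes late tails admissible for any prescribed
  \<open>\<delta>\<close>.\<close>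

lemma hausdorff_measure_limsup_eq_0:
  fixes A :: "nat \<Rightarrow> 'a::metric_space set"
  assumes cover: "\<And>j. j \<ge> J \<Longrightarrow> has_cover s (A j) (D j) (c j)"
    and D: "D \<longlonglongrightarrow> 0" and c: "\<And>j. 0 \<le> c j" "summable c"
    and B: "\<And>x. x \<in> B \<Longrightarrow> \<exists>\<^sub>\<infinity>j. x \<in> A j"
  shows "hausdorff_measure s B = 0"
proof (rule hausdorff_measure_eq_0I)
  fix \<delta> e :: real assume "0 < \<delta>" "0 < e"
  have "\<forall>\<^sub>F j in sequentially. D j < \<delta>"
    using D \<open>0 < \<delta>\<close> by (rule order_tendstoD)
  moreover have "(\<lambda>i. \<Sum>j. c (j + i)) \<longlonglongrightarrow> 0"
    using c(2) by (rule suminf_exist_split2)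
  then have "\<forall>\<^sub>F i in sequentially. (\<Sum>j. c (j + i)) < e"
    using \<open>0 < e\<close> by (rule order_tendstoD)
  ultimately have "\<forall>\<^sub>F i in sequentially. J \<le> i \<and> (\<Sum>j. c (j + i)) < e \<and> (\<forall>j\<ge>i. D j < \<delta>)"
    by (intro eventually_conj eventually_ge_at_top eventually_all_ge_at_top)
  then have "\<exists>i. J \<le> i \<and> (\<Sum>j. c (j + i)) < e \<and> (\<forall>j\<ge>i. D j < \<delta>)"
    using eventually_happens trivial_limit_sequentially by blast
  then obtain i where i: "J \<le> i" "(\<Sum>j. c (j + i)) < e" "\<And>j. j \<ge> i \<Longrightarrow> D j < \<delta>"
    by blast
  have "has_cover s (\<Union>j. A (j + i)) \<delta> (\<Sum>j. c (j + i))"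
  proof (rule has_cover_UN)
    fix j show "has_cover s (A (j + i)) \<delta> (c (j + i))"
      using cover[of "j + i"] i(1) i(3)[of "j + i"] by (auto elim: has_cover_mono)
  qed (use c in \<open>auto simp: summable_iff_shift\<close>)
  moreover have "B \<subseteq> (\<Union>j. A (j + i))"
  proof
    fix x assume "x \<in> B"
    then obtain j where "j \<ge> i" "x \<in> A j" using B unfolding INFM_nat_le by blast
    then show "x \<in> (\<Union>j. A (j + i))" by (auto intro!: exI[of _ "j - i"])
  qed
  ultimately have "has_cover s B \<delta> e"
    using i(2) by (auto elim: has_cover_mono)
  then show "\<exists>U\<in>delta_covers \<delta> B. (\<Sum>n. diam_pow s (U n)) \<le> ennreal e"
    unfolding has_cover_def .
qed

section \<open>Covering axis-parallel boxes by cubes\<close>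

definition corner_cube :: "real^'d \<Rightarrow> real \<Rightarrow> (real^'d) set" where
  "corner_cube x l = {y. \<forall>i. x$i \<le> y$i \<and> y$i \<le> x$i + l}"

lemma corner_cube_eq_cbox: "corner_cube x l = cbox x (\<chi> i. x$i + l)"
  by (auto simp: corner_cube_def mem_box_cart)

lemma compact_corner_cube: "compact (corner_cube x l)"
  by (simp add: corner_cube_eq_cbox compact_cbox)

lemma diameter_corner_cube:
  fixes x :: "real^'d::finite"
  assumes "0 \<le> l"
  shows "diameter (corner_cube x l) \<le> real CARD('d) * l"
proof (rule diameter_le)
  show "corner_cube x l \<noteq> {} \<or> 0 \<le> real CARD('d) * l" using assms by simp
  fix y z assume "y \<in> corner_cube x l" "z \<in> corner_cube x l"
  then have "\<bar>(y - z) $ i\<bar> \<le> l" for i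
    unfolding corner_cube_def by (simp add: abs_le_iff) (smt (verit))
  then have "(\<Sum>i\<in>UNIV. \<bar>(y - z) $ i\<bar>) \<le> (\<Sum>i\<in>(UNIV::'d set). l)"
    by (intro sum_mono)
  then show "norm (y - z) \<le> real CARD('d) * l"
    using norm_le_l1_cart[of "y - z"] by simp
qed

text \<open>The \<open>+ 1\<close> in each factor is the price of a side shorter than
  \<open>h\<close>, so up to constants only the longer sides contribute. One mesh for all boxes lets
  a single coordinate dictate the size of the cubes.\<close>

lemma has_cover_boxes:
  fixes A :: "(real^'d::finite) set" and b :: "'d \<Rightarrow> real"
  assumes fin: "finite P" and h: "0 < h" and b: "\<And>i. 0 \<le> b i" and s: "0 < s"
    and A: "A \<subseteq> (\<Union>c\<in>P. {y. \<forall>i. c$i \<le> y$i \<and> y$i \<le> c$i + b i})"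
  shows "has_cover s A (real CARD('d) * h)
    (real (card P) * (\<Prod>i\<in>UNIV. b i / h + 1) * (real CARD('d) * h) powr s)"
proof -
  define I where "I = P \<times> (\<Pi>\<^sub>E i\<in>(UNIV::'d set). {0..nat \<lfloor>b i / h\<rfloor>})"
  define F where "F = (\<lambda>(c::real^'d, n::'d \<Rightarrow> nat). corner_cube (\<chi> i. c$i + h * real (n i)) h)"
  have "finite I" unfolding I_def using fin by (intro finite_cartesian_product finite_PiE) auto
  have cov: "A \<subseteq> (\<Union>i\<in>I. F i)"
  proof
    fix y assume "y \<in> A"
    then obtain c where c: "c \<in> P" "\<And>i. c$i \<le> y$i" "\<And>i. y$i \<le> c$i + b i" using A by blast
    define n where "n i = nat \<lfloor>(y$i - c$i) / h\<rfloor>" for i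
    have n: "real (n i) \<le> (y$i - c$i) / h" "(y$i - c$i) / h < real (n i) + 1" for i
      unfolding n_def using c(2)[of i] h by (simp_all add: le_nat_floor)
    have "n i \<le> nat \<lfloor>b i / h\<rfloor>" for i
      unfolding n_def using c(3)[of i] h
      by (intro nat_mono floor_mono divide_right_mono) auto
    then have "(c, n) \<in> I" unfolding I_def using c(1) by (auto simp: PiE_def)
    moreover have "y \<in> F (c, n)"
      unfolding F_def corner_cube_def using n h by (simp add: field_simps) (smt (verit))
    ultimately show "y \<in> (\<Union>i\<in>I. F i)" by blast
  qed
  have F: "bounded (F i) \<and> diameter (F i) \<le> real CARD('d) * h" for i
    using h by (auto simp: F_def case_prod_beta compact_imp_bounded compact_corner_cube diameter_corner_cube)
  have "real (card I) = real (card P) * (\<Prod>i\<in>UNIV. real (nat \<lfloor>b i / h\<rfloor>) + 1)"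
    unfolding I_def by (simp add: card_PiE card_cartesian_product add_ac)
  also have "\<dots> \<le> real (card P) * (\<Prod>i\<in>UNIV. b i / h + 1)"
    using b h by (intro mult_left_mono prod_mono) auto
  finally have "real (card I) \<le> real (card P) * (\<Prod>i\<in>UNIV. b i / h + 1)" .
  then have "real (card I) * (real CARD('d) * h) powr s
      \<le> real (card P) * (\<Prod>i\<in>UNIV. b i / h + 1) * (real CARD('d) * h) powr s"
    by (intro mult_right_mono) auto
  then show ?thesis
    using has_cover_finite[OF \<open>finite I\<close> s _ cov F] h by (auto elim: has_cover_mono)
qed

section \<open>Mass distribution on nested cubes\<close>

text \<open>Balls of the maximum norm contain the Euclidean balls of the same radius, and counting
  in them factorises over the coordinates.\<close>

definition sup_ball :: "real^'d \<Rightarrow> real \<Rightarrow> (real^'d) set" where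
  "sup_ball z r = {y. \<forall>i. \<bar>y$i - z$i\<bar> \<le> r}"

text \<open>Lists keep multiplicities: the same cube may arise from fractions with different
  denominators and must then carry the mass of all of them.\<close>

definition meet_count :: "real \<Rightarrow> (real^'d) list \<Rightarrow> (real^'d) set \<Rightarrow> nat" where
  "meet_count l xs B = length (filter (\<lambda>x. corner_cube x l \<inter> B \<noteq> {}) xs)"

lemma meet_count_le_length: "meet_count l xs B \<le> length xs"
  by (simp add: meet_count_def)

lemma meet_count_mono: "B \<subseteq> B' \<Longrightarrow> meet_count l xs B \<le> meet_count l xs B'"
  unfolding meet_count_def by (induction xs) auto

lemma length_filter_le_sum:
  assumes "finite I" "\<And>x. x \<in> set xs \<Longrightarrow> P x \<Longrightarrow> \<exists>i\<in>I. Q i x"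
  shows "length (filter P xs) \<le> (\<Sum>i\<in>I. length (filter (Q i) xs))"
  using assms(2)
proof (induction xs)
  case (Cons x xs)
  have IH: "length (filter P xs) \<le> (\<Sum>i\<in>I. length (filter (Q i) xs))"
    using Cons by simp
  have "(\<Sum>i\<in>I. length (filter (Q i) (x # xs)))
      = (\<Sum>i\<in>I. if Q i x then 1 else 0) + (\<Sum>i\<in>I. length (filter (Q i) xs))"
    unfolding sum.distrib[symmetric] by (intro sum.cong) auto
  moreover have "1 \<le> (\<Sum>i\<in>I. if Q i x then 1 else (0::nat))" if "P x"
  proof -
    obtain i where "i \<in> I" "Q i x" using Cons.prems[of x] \<open>P x\<close> by auto
    then show ?thesis using member_le_sum[of i I "\<lambda>i. if Q i x then 1 else (0::nat)"] assms(1) by simp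
  qed
  ultimately show ?case using IH by auto
qed simp

text \<open>A child that meets \<open>B\<close> forces its parent to meet \<open>B\<close>, so only
  the parents counted on the right contribute, each at most \<open>c\<close>.\<close>

lemma meet_count_refine:
  fixes f :: "real^'d \<Rightarrow> (real^'d) list"
  assumes sub: "\<And>x y. x \<in> set xs \<Longrightarrow> y \<in> set (f x) \<Longrightarrow> corner_cube y l' \<subseteq> corner_cube x l"
    and n: "\<And>x. x \<in> set xs \<Longrightarrow> real (meet_count l' (f x) B) \<le> c"
    and c: "0 \<le> c"
  shows "real (meet_count l' (concat (map f xs)) B) \<le> c * real (meet_count l xs B)"
  using sub n
proof (induction xs)
  case (Cons x xs)
  have IH: "real (meet_count l' (concat (map f xs)) B) \<le> c * real (meet_count l xs B)"
    by (rule Cons.IH) (use Cons.prems in auto)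
  have split: "meet_count l' (concat (map f (x # xs))) B
      = meet_count l' (f x) B + meet_count l' (concat (map f xs)) B"
    by (simp add: meet_count_def)
  show ?case
  proof (cases "corner_cube x l \<inter> B = {}")
    case True
    then have "corner_cube y l' \<inter> B = {}" if "y \<in> set (f x)" for y
      using Cons.prems(1)[of x y] that by auto
    then have "meet_count l' (f x) B = 0" by (auto simp: meet_count_def filter_empty_conv)
    with True split IH show ?thesis by (simp add: meet_count_def)
  next
    case False
    then have "meet_count l (x # xs) B = Suc (meet_count l xs B)" by (simp add: meet_count_def)
    then show ?thesis using split IH Cons.prems(2)[of x] by (simp add: algebra_simps)
  qed
qed (simp add: meet_count_def)

definition cube_union :: "real \<Rightarrow> (real^'d) list \<Rightarrow> (real^'d) set" where
  "cube_union l xs = (\<Union>x\<in>set xs. corner_cube x l)"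

lemma compact_cube_union: "compact (cube_union l xs)"
  unfolding cube_union_def by (intro compact_UN compact_corner_cube) auto

text \<open>A mass distribution principle that avoids constructing a limit measure: the mass of a set at
  level \<open>k\<close> is the proportion of the level-\<open>k\<close> cubes it meets, and compactness reduces every cover
  to a finite one, which is tested against a single level.\<close>
lemma hausdorff_measure_nested_cubes:
  fixes xs :: "nat \<Rightarrow> (real^'d::finite) list"
  assumes s: "0 < s" and C: "0 < C"
    and xs: "\<And>k. xs k \<noteq> []" and l: "\<And>k. 0 < l k" "l \<longlonglongrightarrow> 0"
    and dec: "\<And>k. cube_union (l (Suc k)) (xs (Suc k)) \<subseteq> cube_union (l k) (xs k)"
    and mass: "\<And>k z r. l k \<le> r \<Longrightarrow>
      real (meet_count (l k) (xs k) (sup_ball z r)) \<le> C * real (length (xs k)) * r powr s"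
    and K: "(\<Inter>k. cube_union (l k) (xs k)) \<subseteq> K"
  shows "hausdorff_measure s K \<noteq> 0"
proof
  assume "hausdorff_measure s K = 0"
  then have "hausdorff_premeasure s 1 K = 0"
    unfolding hausdorff_measure_def by (metis SUP_upper greaterThan_iff le_zero_eq zero_less_one)
  \<comment> \<open>The budget: the cover uses less than \<open>1 / (2 * C)\<close>, and the
    thickening below adds at most the sum of \<open>(1/2)^n / (4 * C)\<close>, which is
    \<open>1 / (2 * C)\<close> again. The total stays below \<open>1 / C\<close>.\<close>
  then have "hausdorff_premeasure s 1 K < ennreal (1 / (2 * C))"
    using C by simp
  then obtain U where U: "U \<in> delta_covers 1 K" "(\<Sum>n. diam_pow s (U n)) < ennreal (1 / (2 * C))"
    unfolding hausdorff_premeasure_def INF_less_iff by blast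
  have bd: "bounded (U n)" and cov: "K \<subseteq> (\<Union>n. U n)" for n
    using U(1) unfolding delta_covers_def by auto
  define D where "D n = diameter (U n)" for n
  have D0: "0 \<le> D n" for n unfolding D_def using bd by (rule diameter_ge_0)
  \<comment> \<open>The sets are thickened to open ones so that compactness applies. Continuity of
    \<open>powr s\<close> from the right makes this cheap, also at diameter 0 because
    \<open>s\<close> is positive.\<close>
  have "\<exists>e>0. (D n + e) powr s \<le> D n powr s + (1/2)^n / (4 * C)" for n
  proof -
    have "((\<lambda>e. (D n + e) powr s) \<longlongrightarrow> (D n + 0) powr s) (at_right 0)"
      using s D0[of n]
      by (intro tendsto_powr2 tendsto_intros) (auto simp: eventually_at_right_less intro!: eventually_at_rightI[of 0 1])
    moreover have "(D n + 0) powr s < D n powr s + (1/2)^n / (4 * C)" using C by simp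
    ultimately have "\<forall>\<^sub>F e in at_right 0. (D n + e) powr s < D n powr s + (1/2)^n / (4 * C)"
      by (rule order_tendstoD)
    then have "\<forall>\<^sub>F e in at_right (0::real). 0 < e \<and> (D n + e) powr s < D n powr s + (1/2)^n / (4 * C)"
      using eventually_at_right_less by (rule eventually_conj[rotated])
    then have "\<exists>e. 0 < e \<and> (D n + e) powr s < D n powr s + (1/2)^n / (4 * C)"
      using eventually_happens trivial_limit_at_right_real by blast
    then show ?thesis using less_imp_le by blast
  qed
  then obtain e where e: "\<And>n. 0 < e n" "\<And>n. (D n + e n) powr s \<le> D n powr s + (1/2)^n / (4 * C)"
    by metis
  define V where "V n = (\<Union>y\<in>U n. ball y (e n))" for n
  define R where "R n = D n + e n" for n
  have R0: "0 < R n" for n unfolding R_def using D0[of n] e(1)[of n] by linarith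
  have "\<exists>z. V n \<subseteq> sup_ball z (R n) \<and> (U n \<noteq> {} \<or> V n = {})" for n
  proof (cases "U n = {}")
    case False
    then obtain u where u: "u \<in> U n" by blast
    have "V n \<subseteq> sup_ball u (R n)"
    proof
      fix v assume "v \<in> V n"
      then obtain y where y: "y \<in> U n" "dist y v < e n" unfolding V_def by auto
      have "dist v u \<le> R n"
        using diameter_bounded_bound[OF bd y(1) u] y(2) dist_triangle[of v u y]
        unfolding R_def D_def by (simp add: dist_commute)
      then show "v \<in> sup_ball u (R n)"
        unfolding sup_ball_def using component_le_norm_cart[of "v - u"]
        by (auto simp: dist_norm intro: order_trans)
    qed
    then show ?thesis using False by blast
  qed (simp add: V_def)
  then obtain z where z: "\<And>n. V n \<subseteq> sup_ball (z n) (R n)" "\<And>n. U n \<noteq> {} \<or> V n = {}" by metis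
  have "open (V n)" for n unfolding V_def by auto
  have dec': "cube_union (l m) (xs m) \<subseteq> cube_union (l k) (xs k)" if "k \<le> m" for k m
    using that dec by (rule lift_Suc_antimono_le[rotated])
  have "\<exists>k. cube_union (l k) (xs k) \<subseteq> (\<Union>n<k. V n)"
  proof (rule ccontr)
    assume no: "\<nexists>k. cube_union (l k) (xs k) \<subseteq> (\<Union>n<k. V n)"
    \<comment> \<open>If no finite part of the open cover contained a level, the compact sets
      \<open>E k\<close> would be nested and nonempty, and a common point would lie in
      \<open>K\<close> but in no \<open>V n\<close>.\<close>
    define E where "E k = cube_union (l k) (xs k) - (\<Union>n<k. V n)" for k
    have "\<Inter> (range E) \<noteq> {}"
    proof (rule compact_nest)
      fix k
      show "compact (E k)" unfolding E_def
        using \<open>\<And>n. open (V n)\<close> by (intro compact_diff compact_cube_union open_UN) auto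
      show "E k \<noteq> {}" using no unfolding E_def by blast
    next
      fix m n :: nat assume "m \<le> n"
      then show "E n \<subseteq> E m" unfolding E_def using dec'[of m n] by auto
    qed
    then obtain x where x: "\<And>k. x \<in> E k" by auto
    then have "x \<in> K" using K unfolding E_def by auto
    then obtain n where "x \<in> U n" using cov by blast
    then have "x \<in> V n" unfolding V_def using e(1)[of n] by (intro UN_I[of x]) auto
    then show False using x[of "Suc n"] unfolding E_def by auto
  qed
  then obtain k0 where k0: "cube_union (l k0) (xs k0) \<subseteq> (\<Union>n<k0. V n)" by blast
  \<comment> \<open>The level is taken so deep that its cubes are smaller than all of the finitely
    many radii; this is the range of \<open>mass\<close>.\<close>
  have "\<forall>\<^sub>F k in sequentially. \<forall>n\<in>{..<k0}. l k < R n"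
    using R0 l(2) by (intro eventually_ball_finite ballI order_tendstoD[of l 0]) auto
  then have "\<forall>\<^sub>F k in sequentially. (\<forall>n<k0. l k < R n) \<and> k0 \<le> k"
    using eventually_ge_at_top[of k0] by eventually_elim auto
  then have "\<exists>k. (\<forall>n<k0. l k < R n) \<and> k0 \<le> k"
    using eventually_happens trivial_limit_sequentially by blast
  then obtain k where k: "\<And>n. n < k0 \<Longrightarrow> l k < R n" "k0 \<le> k" by blast
  define N where "N = {n. n < k0 \<and> U n \<noteq> {}}"
  have finN: "finite N" unfolding N_def by simp
  have "length (xs k) = meet_count (l k) (xs k) UNIV"
  proof -
    have "corner_cube x (l k) \<noteq> {}" for x :: "real^'d"
      using l(1)[of k] by (auto simp: corner_cube_def intro!: exI[of _ x])
    then show ?thesis by (simp add: meet_count_def)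
  qed
  also have "\<dots> \<le> (\<Sum>n\<in>N. meet_count (l k) (xs k) (V n))"
    unfolding meet_count_def
  proof (rule length_filter_le_sum[OF finN])
    fix x assume x: "x \<in> set (xs k)" 
    have "x \<in> corner_cube x (l k)" using l(1)[of k] by (auto simp: corner_cube_def)
    then have "x \<in> cube_union (l k0) (xs k0)"
      using dec'[OF k(2)] x unfolding cube_union_def by blast
    then obtain n where n: "n < k0" "x \<in> V n" using k0 by auto
    then have "n \<in> N" using z(2)[of n] unfolding N_def by auto
    then show "\<exists>n\<in>N. corner_cube x (l k) \<inter> V n \<noteq> {}"
      using n \<open>x \<in> corner_cube x (l k)\<close> by auto
  qed
  finally have "real (length (xs k)) \<le> (\<Sum>n\<in>N. real (meet_count (l k) (xs k) (V n)))"
    by (metis of_nat_le_iff of_nat_sum)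
  also have "\<dots> \<le> (\<Sum>n\<in>N. C * real (length (xs k)) * R n powr s)"
  proof (intro sum_mono)
    fix n assume "n \<in> N"
    then have "l k \<le> R n" using k(1)[of n] unfolding N_def by simp
    have "real (meet_count (l k) (xs k) (V n)) \<le> real (meet_count (l k) (xs k) (sup_ball (z n) (R n)))"
      using meet_count_mono[OF z(1)] by simp
    also have "\<dots> \<le> C * real (length (xs k)) * R n powr s" using mass[OF \<open>l k \<le> R n\<close>] .
    finally show "real (meet_count (l k) (xs k) (V n)) \<le> C * real (length (xs k)) * R n powr s" .
  qed
  also have "\<dots> = real (length (xs k)) * (C * (\<Sum>n\<in>N. R n powr s))"
    by (simp add: sum_distrib_left mult_ac)
  finally have "1 \<le> C * (\<Sum>n\<in>N. R n powr s)"
    using xs[of k] by simp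
  moreover have "(\<Sum>n\<in>N. R n powr s) < 1 / (2 * C) + 1 / (2 * C)"
  proof -
    have "(\<Sum>n\<in>N. R n powr s) \<le> (\<Sum>n\<in>N. D n powr s + (1/2)^n / (4 * C))"
      unfolding R_def by (intro sum_mono e(2))
    also have "\<dots> = (\<Sum>n\<in>N. D n powr s) + (\<Sum>n\<in>N. (1/2)^n) / (4 * C)"
      by (simp add: sum.distrib sum_divide_distrib)
    also have "(\<Sum>n\<in>N. (1/2)^n) \<le> (\<Sum>n. (1/2::real)^n)"
      by (intro sum_le_suminf finN) auto
    then have "(\<Sum>n\<in>N. (1/2::real)^n) / (4 * C) \<le> 2 / (4 * C)"
      using C by (intro divide_right_mono) (auto simp: suminf_geometric)
    also have "(\<Sum>n\<in>N. D n powr s) < 1 / (2 * C)"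
    proof -
      have "ennreal (\<Sum>n\<in>N. D n powr s) = (\<Sum>n\<in>N. ennreal (D n powr s))"
        by (simp add: sum_ennreal)
      also have "\<dots> = (\<Sum>n\<in>N. diam_pow s (U n))"
        using s by (intro sum.cong) (auto simp: diam_pow_def N_def D_def)
      also have "\<dots> \<le> (\<Sum>n. diam_pow s (U n))"
        by (intro sum_le_suminf finN) auto
      also have "\<dots> < ennreal (1 / (2 * C))" by fact
      finally show ?thesis by (subst (asm) ennreal_less_iff) (auto intro: sum_nonneg)
    qed
    finally show ?thesis using C by (simp add: field_simps)
  qed
  ultimately show False using C by (simp add: field_simps)
qed

lemma sup_ball_mono: "r \<le> r' \<Longrightarrow> sup_ball z r \<subseteq> sup_ball z r'"
  unfolding sup_ball_def by (auto intro: order_trans)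

text \<open>There are two mass estimates because constants must not multiply along the levels:
  between the scales \<open>l'\<close> and \<open>l\<close> a factor \<open>C\<close> is harmless,
  but at \<open>l'\<close>, where the next step starts, the bound has constant 1. The number
  \<open>m\<close> is common to all parents, so that equal weights on one level are split equally on
  the next. Since \<open>A\<close> is arbitrary, the points of the limit set are good for
  arbitrarily large \<open>q\<close>.\<close>

lemma hausdorff_measure_cantor_scheme:
  fixes good :: "nat \<Rightarrow> real^'d::finite \<Rightarrow> bool"
  assumes s: "0 < s" and C: "1 \<le> C"
    and step: "\<And>A l. 0 < l \<Longrightarrow> l \<le> 1 \<Longrightarrow> \<exists>l' m. 0 < l' \<and> l' \<le> l / 2 \<and> 0 < m \<and>
      (\<forall>x. corner_cube x l \<subseteq> corner_cube 0 1 \<longrightarrow> (\<exists>ys. length ys = m \<and>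
        (\<forall>y\<in>set ys. corner_cube y l' \<subseteq> corner_cube x l \<and> (\<forall>v\<in>corner_cube y l'. \<exists>q\<ge>A. good q v)) \<and>
        (\<forall>z r. l' \<le> r \<longrightarrow> r \<le> l \<longrightarrow>
          real (meet_count l' ys (sup_ball z r)) \<le> C * real m * (r / l) powr s) \<and>
        (\<forall>z. real (meet_count l' ys (sup_ball z l')) \<le> real m * (l' / l) powr s)))"
  shows "hausdorff_measure s {v \<in> corner_cube 0 1. infinite {q. good q v}} \<noteq> 0"
proof -
  \<comment> \<open>The clause for \<open>k = 0\<close> anchors the construction at the unit cube,
    where the mass bound is trivial for every radius that is at least 1.\<close>
  define P where "P k p = (case p of (l, xs) \<Rightarrow> 0 < l \<and> l \<le> (1/2)^k \<and> (k = 0 \<longrightarrow> l = 1) \<and> xs \<noteq> [] \<and>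
      (\<forall>x\<in>set xs. corner_cube x l \<subseteq> corner_cube 0 1) \<and>
      (\<forall>z. real (meet_count l xs (sup_ball z l)) \<le> real (length xs) * l powr s))"
    for k :: nat and p :: "real \<times> (real^'d) list"
  \<comment> \<open>The third clause says that the share of cubes meeting \<open>B\<close> does not
    grow under refinement; it carries estimates at coarse radii down to deeper levels.\<close>
  define Q where "Q k p p' = (case p of (l, xs) \<Rightarrow> case p' of (l', xs') \<Rightarrow>
      cube_union l' xs' \<subseteq> cube_union l xs \<and> (\<forall>y\<in>cube_union l' xs'. \<exists>q\<ge>k. good q y) \<and>
      (\<forall>B. real (meet_count l' xs' B) * real (length xs) \<le> real (meet_count l xs B) * real (length xs')) \<and>
      (\<forall>z r. l' \<le> r \<longrightarrow> r \<le> l \<longrightarrow>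
         real (meet_count l' xs' (sup_ball z r)) \<le> C * real (length xs') * r powr s))"
    for k :: nat and p p' :: "real \<times> (real^'d) list"
  have "\<exists>f. \<forall>n. P n (f n) \<and> Q n (f n) (f (Suc n))"
  proof (rule dependent_nat_choice)
    have "meet_count 1 [0 :: real^'d] B \<le> 1" for B by (simp add: meet_count_def)
    then have "P 0 (1, [0])" unfolding P_def by simp
    then show "\<exists>x. P 0 x" by blast
  next
    fix p :: "real \<times> (real^'d) list" and k
    assume Pp: "P k p"
    obtain l xs where p: "p = (l, xs)" by force
    have l: "0 < l" "l \<le> (1/2)^k" and xs: "xs \<noteq> []" "\<And>x. x \<in> set xs \<Longrightarrow> corner_cube x l \<subseteq> corner_cube 0 1"
      and mass: "\<And>z. real (meet_count l xs (sup_ball z l)) \<le> real (length xs) * l powr s"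
      using Pp unfolding P_def p by auto
    have l1: "l \<le> 1" using l(2) power_le_one[of "1/2::real" k] by linarith
    obtain l' m where l': "0 < l'" "l' \<le> l / 2" and m: "0 < m" and
      ex: "\<And>x. corner_cube x l \<subseteq> corner_cube 0 1 \<Longrightarrow> \<exists>ys. length ys = m \<and>
        (\<forall>y\<in>set ys. corner_cube y l' \<subseteq> corner_cube x l \<and> (\<forall>v\<in>corner_cube y l'. \<exists>q\<ge>k. good q v)) \<and>
        (\<forall>z r. l' \<le> r \<longrightarrow> r \<le> l \<longrightarrow>
          real (meet_count l' ys (sup_ball z r)) \<le> C * real m * (r / l) powr s) \<and>
        (\<forall>z. real (meet_count l' ys (sup_ball z l')) \<le> real m * (l' / l) powr s)"
      using step[OF l(1) l1, of k] by blast
    define F where "F x ys \<longleftrightarrow> length ys = m \<and>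
        (\<forall>y\<in>set ys. corner_cube y l' \<subseteq> corner_cube x l \<and> (\<forall>v\<in>corner_cube y l'. \<exists>q\<ge>k. good q v)) \<and>
        (\<forall>z r. l' \<le> r \<longrightarrow> r \<le> l \<longrightarrow>
          real (meet_count l' ys (sup_ball z r)) \<le> C * real m * (r / l) powr s) \<and>
        (\<forall>z. real (meet_count l' ys (sup_ball z l')) \<le> real m * (l' / l) powr s)" for x ys
    define f where "f x = (SOME ys. F x ys)" for x
    have f: "F x (f x)" if "x \<in> set xs" for x
    proof -
      have "\<exists>ys. F x ys" unfolding F_def by (rule ex[OF xs(2)[OF that]])
      then show ?thesis unfolding f_def by (rule someI_ex)
    qed
    define xs' where "xs' = concat (map f xs)"
    have sub: "corner_cube y l' \<subseteq> corner_cube x l" if "x \<in> set xs" "y \<in> set (f x)" for x y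
      using f[OF that(1)] that(2) unfolding F_def by blast
    have "map length (map f xs) = map (\<lambda>_. m) xs"
      using f unfolding F_def by simp
    then have len: "length xs' = length xs * m"
      unfolding xs'_def length_concat by (simp add: sum_list_triv map_replicate_const sum_list_replicate)
    have sub': "cube_union l' xs' \<subseteq> cube_union l xs"
      unfolding cube_union_def xs'_def using sub by fastforce
    have good': "\<forall>y\<in>cube_union l' xs'. \<exists>q\<ge>k. good q y"
      unfolding cube_union_def xs'_def using f unfolding F_def by auto
    have any: "real (meet_count l' xs' B) * real (length xs) \<le> real (meet_count l xs B) * real (length xs')" for B
    proof -
      have "real (meet_count l' xs' B) \<le> real m * real (meet_count l xs B)"
        unfolding xs'_def
      proof (rule meet_count_refine)
        fix x assume "x \<in> set xs"
        then show "real (meet_count l' (f x) B) \<le> real m"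
          using f[of x] meet_count_le_length[of l' "f x" B] by (simp add: F_def)
      qed (use sub in auto)
      then have "real (meet_count l' xs' B) * real (length xs) \<le> real m * real (meet_count l xs B) * real (length xs)"
        by (rule mult_right_mono) simp
      then show ?thesis using len by (simp add: mult_ac)
    qed
    \<comment> \<open>Parents met by the ball of radius \<open>r\<close> are met by the ball of
      radius \<open>l\<close>, where the sharp bound holds; its factor \<open>l powr s\<close>
      cancels the \<open>l\<close> in the relative bound for the children.\<close>
    have combine: "real (meet_count l' xs' (sup_ball z r)) \<le> c * real (length xs') * r powr s"
      if r: "0 < r" "r \<le> l" and c: "0 \<le> c" and
        each: "\<And>x. x \<in> set xs \<Longrightarrow> real (meet_count l' (f x) (sup_ball z r)) \<le> c * real m * (r / l) powr s"
      for z r c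
    proof -
      have "real (meet_count l' xs' (sup_ball z r)) \<le> (c * real m * (r / l) powr s) * real (meet_count l xs (sup_ball z r))"
        unfolding xs'_def using c sub each by (intro meet_count_refine) auto
      also have "\<dots> \<le> (c * real m * (r / l) powr s) * real (meet_count l xs (sup_ball z l))"
        using c r meet_count_mono[OF sup_ball_mono[of r l z]] by (intro mult_left_mono) auto
      also have "\<dots> \<le> (c * real m * (r / l) powr s) * (real (length xs) * l powr s)"
        using c by (intro mult_left_mono mass) auto
      also have "\<dots> = c * real (length xs') * r powr s"
        using l r len by (simp add: powr_divide)
      finally show ?thesis .
    qed
    have b1: "real (meet_count l' xs' (sup_ball z r)) \<le> C * real (length xs') * r powr s"
      if "l' \<le> r" "r \<le> l" for z r
      using that l' C f unfolding F_def by (intro combine) auto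
    have b2: "real (meet_count l' xs' (sup_ball z l')) \<le> 1 * real (length xs') * l' powr s" for z
      using l l' f unfolding F_def by (intro combine) auto
    have "corner_cube y l' \<subseteq> corner_cube 0 1" if y: "y \<in> set xs'" for y
    proof -
      obtain x where "x \<in> set xs" "y \<in> set (f x)" using y unfolding xs'_def by auto
      then show ?thesis using sub xs(2) by blast
    qed
    moreover have "xs' \<noteq> []" using len xs(1) m by auto
    ultimately have "P (Suc k) (l', xs')"
      unfolding P_def using l l' b2 by simp
    moreover have "Q k p (l', xs')"
      unfolding Q_def p using sub' good' any b1 by auto
    ultimately show "\<exists>y. P (Suc k) y \<and> Q k p y" by blast
  qed
  then obtain f where Pf: "\<And>n. P n (f n)" and Qf: "\<And>n. Q n (f n) (f (Suc n))" by blast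
  define l where "l n = fst (f n)" for n
  define xs where "xs n = snd (f n)" for n
  have l: "0 < l n" "l n \<le> (1/2)^n" and xs: "xs n \<noteq> []" for n
    using Pf[of n] by (auto simp: P_def l_def xs_def case_prod_beta)
  have unit: "cube_union (l n) (xs n) \<subseteq> corner_cube 0 1" for n
    using Pf[of n] by (auto simp: P_def l_def xs_def case_prod_beta cube_union_def)
  have dec: "cube_union (l (Suc n)) (xs (Suc n)) \<subseteq> cube_union (l n) (xs n)"
    and good: "\<And>y. y \<in> cube_union (l (Suc n)) (xs (Suc n)) \<Longrightarrow> \<exists>q\<ge>n. good q y"
    and any: "\<And>B. real (meet_count (l (Suc n)) (xs (Suc n)) B) * real (length (xs n))
        \<le> real (meet_count (l n) (xs n) B) * real (length (xs (Suc n)))"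
    and step': "\<And>z r. l (Suc n) \<le> r \<Longrightarrow> r \<le> l n \<Longrightarrow>
        real (meet_count (l (Suc n)) (xs (Suc n)) (sup_ball z r)) \<le> C * real (length (xs (Suc n))) * r powr s"
    for n
    using Qf[of n] by (auto simp: Q_def l_def xs_def case_prod_beta)
  have "l \<longlonglongrightarrow> 0"
  proof (rule tendsto_sandwich[of "\<lambda>_. 0" l])
    show "(\<lambda>n. (1/2::real)^n) \<longlonglongrightarrow> 0" by (intro LIMSEQ_power_zero) simp
  qed (use l in \<open>auto simp: less_imp_le\<close>)
  show ?thesis
  proof (rule hausdorff_measure_nested_cubes[where C = "C * 1" and xs = xs and l = l])
    fix k z r assume r: "l k \<le> r"
    then have r0: "0 < r" using l(1)[of k] by linarith
    \<comment> \<open>A radius above the side of the previous level is passed up by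
      \<open>any\<close>; otherwise \<open>step'\<close> applies directly. So the constant
      \<open>C\<close> enters only once.\<close>
    show "real (meet_count (l k) (xs k) (sup_ball z r)) \<le> (C * 1) * real (length (xs k)) * r powr s"
      using r
    proof (induction k)
      case 0
      have "l 0 = 1" using Pf[of 0] by (auto simp: P_def l_def case_prod_beta)
      then have "1 \<le> r powr s" using 0 s by (simp add: ge_one_powr_ge_zero)
      then have "1 \<le> C * r powr s" using C mult_mono[of 1 C 1 "r powr s"] by simp
      then have "real (length (xs 0)) \<le> real (length (xs 0)) * (C * r powr s)"
        using mult_left_mono[of 1 "C * r powr s" "real (length (xs 0))"] by simp
      moreover have "real (meet_count (l 0) (xs 0) (sup_ball z r)) \<le> real (length (xs 0))"
        using meet_count_le_length by simp
      ultimately show ?case by (simp add: mult_ac)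
    next
      case (Suc k)
      show ?case
      proof (cases "r \<le> l k")
        case True then show ?thesis using step' Suc by simp
      next
        case False
        have "real (meet_count (l (Suc k)) (xs (Suc k)) (sup_ball z r)) * real (length (xs k))
            \<le> real (meet_count (l k) (xs k) (sup_ball z r)) * real (length (xs (Suc k)))"
          by (rule any)
        also have "\<dots> \<le> ((C * 1) * real (length (xs k)) * r powr s) * real (length (xs (Suc k)))"
          using Suc.IH False by (intro mult_right_mono) auto
        finally show ?thesis using xs[of k] by (simp add: mult_ac)
      qed
    qed
  next
    show "(\<Inter>k. cube_union (l k) (xs k)) \<subseteq> {v \<in> corner_cube 0 1. infinite {q. good q v}}"
    proof
      fix v assume v: "v \<in> (\<Inter>k. cube_union (l k) (xs k))"
      have "\<exists>q\<ge>n. q \<in> {q. good q v}" for n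
        using good[of v n] v by auto
      then have "infinite {q. good q v}" unfolding infinite_nat_iff_unbounded_le by blast
      then show "v \<in> {v \<in> corner_cube 0 1. infinite {q. good q v}}"
        using v unit[of 0] by auto
    qed
  qed (use s C l xs dec \<open>l \<longlonglongrightarrow> 0\<close> in auto)
qed

section \<open>Pair correlations of rational points\<close>

text \<open>Write \<open>q = g * u\<close> and \<open>q' = g * v\<close> with \<open>u\<close>,
  \<open>v\<close> coprime. The integer \<open>a * v - b * u\<close> fixes \<open>a\<close> modulo
  \<open>u\<close>, and \<open>a div u\<close> then fixes \<open>a\<close> and hence
  \<open>b\<close>. The first takes at most \<open>2 * M / g + 1\<close> values, since the cross
  difference is \<open>g\<close> times it, the second at most \<open>g + 1 \<le> 2 * g\<close>; the
  product is the bound.\<close>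

lemma card_close_fractions_le:
  fixes q q' :: nat and M :: real
  assumes q: "0 < q" "0 < q'" and M: "0 \<le> M"
  shows "real (card {(a::int, b::int). 0 \<le> a \<and> a \<le> int q \<and> 0 \<le> b \<and> b \<le> int q' \<and>
      \<bar>real_of_int (a * int q' - b * int q)\<bar> \<le> M}) \<le> 4 * M + 2 * real (gcd q q')"
    (is "real (card ?S) \<le> _")
proof -
  define g where "g = gcd q q'"
  have g0: "0 < g" using q unfolding g_def by simp
  obtain u v where uv: "q = g * u" "q' = g * v" "coprime u v"
    unfolding g_def by (metis gcd_coprime_exists mult.commute g0 g_def neq0_conv)
  have u0: "0 < u" using q uv by simp
  define k where "k = \<lfloor>M / real g\<rfloor>"
  have k0: "0 \<le> k" unfolding k_def using M by simp
  define T where "T = {-k..k} \<times> {0..int g}"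
  define \<phi> where "\<phi> = (\<lambda>(a::int, b::int). (a * int v - b * int u, a div int u))"
  have "inj_on \<phi> ?S"
  proof (rule inj_onI, clarify)
    fix a b a' b' :: int
    assume "\<phi> (a, b) = \<phi> (a', b')"
    then have e: "a * int v - b * int u = a' * int v - b' * int u" "a div int u = a' div int u"
      unfolding \<phi>_def by auto
    have "(a - a') * int v = (b - b') * int u" using e(1) by (simp add: algebra_simps)
    then have "int u dvd (a - a') * int v" by simp
    then have "int u dvd a - a'"
      using uv(3) by (simp add: coprime_dvd_mult_left_iff)
    then have "a mod int u = a' mod int u" by (simp add: mod_eq_dvd_iff)
    then have "a = a'" using e(2) by (metis div_mult_mod_eq)
    then show "a = a' \<and> b = b'" using e(1) u0 by simp
  qed
  moreover have "\<phi> ` ?S \<subseteq> T"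
  proof (rule image_subsetI)
    fix w assume "w \<in> ?S"
    then obtain a b where w: "w = (a, b)" and
      *: "0 \<le> a" "a \<le> int q" "0 \<le> b" "b \<le> int q'" "\<bar>real_of_int (a * int q' - b * int q)\<bar> \<le> M"
      by blast
    have "a * int q' - b * int q = int g * (a * int v - b * int u)"
      unfolding uv by (simp add: algebra_simps)
    then have "real g * \<bar>real_of_int (a * int v - b * int u)\<bar> \<le> M"
      using *(5) by (simp add: abs_mult)
    then have "\<bar>real_of_int (a * int v - b * int u)\<bar> \<le> M / real g"
      using g0 by (simp add: field_simps)
    then have "\<bar>a * int v - b * int u\<bar> \<le> k"
      unfolding k_def by (simp add: le_floor_iff)
    moreover have "a div int u \<le> int g"
      using *(2) u0 zdiv_mono1[of a "int q" "int u"] unfolding uv by simp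
    moreover have "0 \<le> a div int u" using * u0 by (simp add: pos_imp_zdiv_nonneg_iff)
    ultimately show "\<phi> w \<in> T" unfolding T_def w \<phi>_def by auto
  qed
  ultimately have "card ?S \<le> card T" by (rule card_inj_on_le) (simp add: T_def)
  also have "card T = nat (2 * k + 1) * (g + 1)"
    unfolding T_def by (simp add: card_cartesian_product nat_add_distrib)
  finally have "real (card ?S) \<le> real (nat (2 * k + 1) * (g + 1))"
    by (rule of_nat_mono)
  also have "\<dots> = real (nat (2 * k + 1)) * (real g + 1)" by (simp add: algebra_simps)
  also have "\<dots> \<le> (2 * (M / real g) + 1) * (2 * real g)"
  proof (intro mult_mono)
    have "real_of_int k \<le> M / real g" unfolding k_def by simp
    moreover have "real (nat (2 * k + 1)) = 2 * real_of_int k + 1" using k0 by simp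
    ultimately show "real (nat (2 * k + 1)) \<le> 2 * (M / real g) + 1" by linarith
  qed (use g0 M in auto)
  also have "\<dots> = 4 * M + 2 * real g" using g0 by (simp add: field_simps)
  finally show ?thesis unfolding g_def .
qed

text \<open>Either every \<open>a i\<close> is at least \<open>g\<close>, or one factor equals
  \<open>g\<close> and all others are at most \<open>B\<close>. In this form the gcd enters only to
  the first power, which keeps its average logarithmic.\<close>

lemma prod_max_le:
  fixes a :: "'i \<Rightarrow> real"
  assumes "finite I" and a: "\<And>i. i \<in> I \<Longrightarrow> 0 \<le> a i \<and> a i \<le> B" and g: "0 \<le> g" "g \<le> B"
  shows "(\<Prod>i\<in>I. max (a i) g) \<le> (\<Prod>i\<in>I. a i) + g * B ^ (card I - 1)"
proof (cases "\<forall>i\<in>I. g \<le> a i")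
  case True
  then have "(\<Prod>i\<in>I. max (a i) g) = (\<Prod>i\<in>I. a i)" by (intro prod.cong) auto
  then show ?thesis using g by simp
next
  case False
  then obtain j where j: "j \<in> I" "a j < g" by auto
  have "(\<Prod>i\<in>I. max (a i) g) = max (a j) g * (\<Prod>i\<in>I - {j}. max (a i) g)"
    using assms(1) j by (simp add: prod.remove)
  also have "\<dots> \<le> g * (\<Prod>i\<in>I - {j}. B)"
    using j a g by (intro mult_mono prod_mono prod_nonneg) (auto intro: max.coboundedI2)
  also have "(\<Prod>i\<in>I - {j}. B) = B ^ (card I - 1)"
    using j assms(1) by simp
  finally show ?thesis using prod_nonneg[of I a] a by fastforce
qed

text \<open>The gcd is one term of the sum of all common divisors, and \<open>g\<close> divides both
  arguments for at most \<open>(N / g)^2\<close> pairs. The weighted counts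
  \<open>g * (N / g)^2\<close> sum to a harmonic number.\<close>

lemma sum_gcd_le:
  "(\<Sum>q\<in>{1..N}. \<Sum>q'\<in>{1..N}. real (gcd q q')) \<le> real N ^ 2 * harm N"
proof -
  have "real (gcd q q') \<le> (\<Sum>g\<in>{1..N}. real g * of_bool (g dvd q) * of_bool (g dvd q'))"
    if "q \<in> {1..N}" "q' \<in> {1..N}" for q q'
  proof -
    have "gcd q q' \<le> q" using that by (intro gcd_le1_nat) auto
    then have "gcd q q' \<le> N" using that(1) by (metis atLeastAtMost_iff le_trans)
    then have "gcd q q' \<in> {1..N}" using that by (auto simp: Suc_le_eq)
    then show ?thesis
      using member_le_sum[of "gcd q q'" "{1..N}" "\<lambda>g. real g * of_bool (g dvd q) * of_bool (g dvd q')"]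
      by simp
  qed
  then have "(\<Sum>q\<in>{1..N}. \<Sum>q'\<in>{1..N}. real (gcd q q'))
      \<le> (\<Sum>q\<in>{1..N}. \<Sum>q'\<in>{1..N}. \<Sum>g\<in>{1..N}. real g * of_bool (g dvd q) * of_bool (g dvd q'))"
    by (intro sum_mono) auto
  also have "\<dots> = (\<Sum>q\<in>{1..N}. \<Sum>g\<in>{1..N}. \<Sum>q'\<in>{1..N}. real g * of_bool (g dvd q) * of_bool (g dvd q'))"
    by (intro sum.cong refl sum.swap)
  also have "\<dots> = (\<Sum>g\<in>{1..N}. \<Sum>q\<in>{1..N}. \<Sum>q'\<in>{1..N}. real g * of_bool (g dvd q) * of_bool (g dvd q'))"
    by (rule sum.swap)
  also have "\<dots> = (\<Sum>g\<in>{1..N}. real g * (\<Sum>q\<in>{1..N}. of_bool (g dvd q)) * (\<Sum>q'\<in>{1..N}. of_bool (g dvd q')))"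
    unfolding mult.assoc sum_product by (simp only: sum_distrib_left)
  also have "\<dots> \<le> (\<Sum>g\<in>{1..N}. real N ^ 2 * (1 / real g))"
  proof (rule sum_mono)
    fix g assume g: "g \<in> {1..N}"
    have "({1..N} \<inter> {q. g dvd q}) \<subseteq> (\<lambda>k. g * k) ` {1..N div g}"
    proof clarify
      fix q assume "q \<in> {1..N}" "g dvd q"
      then obtain k where "q = g * k" "1 \<le> g * k" "g * k \<le> N" by (auto elim: dvdE)
      then show "q \<in> (\<lambda>k. g * k) ` {1..N div g}"
        using g by (auto simp: less_eq_div_iff_mult_less_eq mult.commute intro!: imageI)
    qed
    then have "card ({1..N} \<inter> {q. g dvd q}) \<le> card ((\<lambda>k. g * k) ` {1..N div g})" by (intro card_mono) auto
    also have "\<dots> \<le> N div g" using card_image_le[of "{1..N div g}" "\<lambda>k. g * k"] by simp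
    finally have "real (card ({1..N} \<inter> {q. g dvd q})) \<le> real (N div g)" by simp
    also have "\<dots> \<le> real N / real g" by (rule of_nat_div_le_of_nat)
    finally have c: "(\<Sum>q\<in>{1..N}. of_bool (g dvd q)) \<le> real N / real g"
      by (simp add: sum_of_bool_eq)
    have "real g * (\<Sum>q\<in>{1..N}. of_bool (g dvd q)) * (\<Sum>q'\<in>{1..N}. of_bool (g dvd q'))
        \<le> real g * (real N / real g) * (real N / real g)"
      by (intro mult_mono c) (auto intro!: sum_nonneg)
    also have "\<dots> = real N ^ 2 * (1 / real g)" using g by (simp add: power2_eq_square)
    finally show "real g * (\<Sum>q\<in>{1..N}. of_bool (g dvd q)) * (\<Sum>q'\<in>{1..N}. of_bool (g dvd q'))
        \<le> real N ^ 2 * (1 / real g)" .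
  qed
  also have "\<dots> = real N ^ 2 * harm N"
    by (simp add: harm_def sum_distrib_left field_simps)
  finally show ?thesis .
qed

section \<open>Neighbours of rational points in several coordinates\<close>

definition frac_pt :: "nat \<times> ('d \<Rightarrow> int) \<Rightarrow> 'd \<Rightarrow> real" where
  "frac_pt z i = real_of_int (snd z i) / real (fst z)"

text \<open>The pairs are unreduced: a point counts once for every denominator that represents it.
  Denominators above \<open>N / 2\<close> still have about \<open>N\<close> numerators per unit
  length and grow with \<open>N\<close>.\<close>

definition frac_idx :: "nat \<Rightarrow> (nat \<times> ('d \<Rightarrow> int)) set" where
  "frac_idx N = {(q, p). N < 2 * q \<and> q \<le> N \<and> (\<forall>i. 0 \<le> p i \<and> p i \<le> int q)}"

text \<open>The factor 4 fits two points that both lie within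
  \<open>r + \<rho> i \<le> 2 * max r (\<rho> i)\<close> of a common centre, so that counts in
  arbitrary balls reduce to counts around fractions.\<close>

definition frac_nbr :: "nat \<Rightarrow> ('d \<Rightarrow> real) \<Rightarrow> nat \<times> ('d \<Rightarrow> int) \<Rightarrow> (nat \<times> ('d \<Rightarrow> int)) set" where
  "frac_nbr N R z = {z' \<in> frac_idx N. \<forall>i. \<bar>frac_pt z i - frac_pt z' i\<bar> \<le> 4 * R i}"

lemma finite_frac_idx: "finite (frac_idx N :: (nat \<times> ('d::finite \<Rightarrow> int)) set)"
proof (rule finite_subset)
  show "frac_idx N \<subseteq> {0..N} \<times> (\<Pi>\<^sub>E i\<in>(UNIV :: 'd set). {0..int N})"
    by (force simp: frac_idx_def PiE_def)
qed (intro finite_cartesian_product finite_PiE; simp)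

text \<open>For fixed denominators the count factorises over the coordinates, and
  \<open>R i \<le> 1 / N\<close> puts each factor in the range of \<open>prod_max_le\<close> with
  \<open>B = N\<close>. The last factor of the bound is the self-correlation plus the expected
  number of neighbours. The constant 18 is 16 + 2, from \<open>card_close_fractions_le\<close> with
  \<open>M = 4 * R i * N^2\<close>.\<close>

lemma sum_card_frac_nbr_le:
  fixes R :: "'d::finite \<Rightarrow> real"
  assumes N: "1 \<le> N" and R: "\<And>i. 0 \<le> R i" "\<And>i. R i \<le> 1 / real N"
  shows "(\<Sum>z\<in>frac_idx N. real (card (frac_nbr N R z)))
    \<le> 18 ^ CARD('d) * harm N * real N ^ (CARD('d) + 1) * (1 + real N ^ (CARD('d) + 1) * (\<Prod>i\<in>UNIV. R i))"
proof -
  let ?d = "CARD('d)"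
  define S where "S q q' i = {(a::int, b::int). 0 \<le> a \<and> a \<le> int q \<and> 0 \<le> b \<and> b \<le> int q' \<and>
      \<bar>real_of_int (a * int q' - b * int q)\<bar> \<le> 4 * R i * real N ^ 2}" for q q' i
  define W where "W = (SIGMA z:(frac_idx N :: (nat \<times> ('d \<Rightarrow> int)) set). frac_nbr N R z)"
  define V where "V = (SIGMA qq:{1..N} \<times> {1..N}. (\<Pi>\<^sub>E i\<in>(UNIV::'d set). S (fst qq) (snd qq) i))"
  have finS: "finite (S q q' i)" for q q' i
    by (rule finite_subset[of _ "{0..int q} \<times> {0..int q'}"]) (auto simp: S_def)
  have finV: "finite V" unfolding V_def
    by (intro finite_SigmaI finite_PiE finS) auto
  define \<phi> where "\<phi> = (\<lambda>((q, p), (q', p')). ((q, q'), (\<lambda>i. (p i, p' i)))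
    :: (nat \<times> nat) \<times> ('d \<Rightarrow> int \<times> int))"
  have "inj_on \<phi> W"
    unfolding \<phi>_def by (rule inj_onI) (auto simp: fun_eq_iff)
  moreover have "\<phi> ` W \<subseteq> V"
  proof (rule image_subsetI)
    fix w assume wW: "w \<in> W"
    obtain q p q' p' where w: "w = ((q, p), (q', p'))" by (metis surj_pair)
    from wW have *: "N < 2 * q" "q \<le> N" "\<And>i. 0 \<le> p i \<and> p i \<le> int q"
        "N < 2 * q'" "q' \<le> N" "\<And>i. 0 \<le> p' i \<and> p' i \<le> int q'"
        "\<And>i. \<bar>real_of_int (p i) / real q - real_of_int (p' i) / real q'\<bar> \<le> 4 * R i"
      unfolding w by (auto simp: W_def frac_nbr_def frac_idx_def frac_pt_def)
    have q0: "0 < q" "0 < q'" using * by auto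
    have "\<bar>real_of_int (p i * int q' - p' i * int q)\<bar> \<le> 4 * R i * real N ^ 2" for i
    proof -
      have "real_of_int (p i * int q' - p' i * int q)
          = (real_of_int (p i) / real q - real_of_int (p' i) / real q') * (real q * real q')"
        using q0 by (simp add: field_simps)
      then have "\<bar>real_of_int (p i * int q' - p' i * int q)\<bar>
          = \<bar>real_of_int (p i) / real q - real_of_int (p' i) / real q'\<bar> * (real q * real q')"
        by (simp add: abs_mult)
      also have "\<dots> \<le> (4 * R i) * (real N * real N)"
        using * R(1)[of i] by (intro mult_mono) auto
      finally show ?thesis by (simp add: power2_eq_square)
    qed
    then show "\<phi> w \<in> V"
      unfolding w using * q0 by (auto simp: \<phi>_def V_def S_def)
  qed
  ultimately have "card W \<le> card V" using finV by (rule card_inj_on_le)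
  moreover have "(\<Sum>z\<in>frac_idx N. real (card (frac_nbr N R z))) = real (card W)"
    unfolding W_def using finite_frac_idx
    by (subst card_SigmaI) (auto simp: frac_nbr_def)
  moreover have "real (card V) = (\<Sum>q\<in>{1..N}. \<Sum>q'\<in>{1..N}. \<Prod>i\<in>UNIV. real (card (S q q' i)))"
    unfolding V_def using finS
    by (subst card_SigmaI) (auto simp: card_PiE sum.cartesian_product case_prod_beta intro!: finite_PiE)
  moreover have "(\<Prod>i\<in>UNIV. real (card (S q q' i)))
      \<le> 18 ^ ?d * ((\<Prod>i\<in>UNIV. R i * real N ^ 2) + real (gcd q q') * real N ^ (?d - 1))"
    if qq: "q \<in> {1..N}" "q' \<in> {1..N}" for q q'
  proof -
    have gN: "gcd q q' \<le> N" using qq by (metis atLeastAtMost_iff gcd_le1_nat le_trans not_one_le_zero)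
    have "(\<Prod>i\<in>UNIV. real (card (S q q' i))) \<le> (\<Prod>i\<in>(UNIV::'d set). 18 * max (R i * real N ^ 2) (real (gcd q q')))"
    proof (intro prod_mono conjI)
      fix i
      have "real (card (S q q' i)) \<le> 4 * (4 * R i * real N ^ 2) + 2 * real (gcd q q')"
        unfolding S_def using qq R(1)[of i] by (intro card_close_fractions_le) auto
      also have "\<dots> \<le> 18 * max (R i * real N ^ 2) (real (gcd q q'))" by simp
      finally show "real (card (S q q' i)) \<le> 18 * max (R i * real N ^ 2) (real (gcd q q'))" .
    qed simp
    also have "\<dots> = 18 ^ ?d * (\<Prod>i\<in>(UNIV::'d set). max (R i * real N ^ 2) (real (gcd q q')))"
      by (simp add: prod.distrib)
    also have "\<dots> \<le> 18 ^ ?d * ((\<Prod>i\<in>UNIV. R i * real N ^ 2) + real (gcd q q') * real N ^ (card (UNIV::'d set) - 1))"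
    proof (intro mult_left_mono prod_max_le)
      fix i
      have "R i * real N ^ 2 \<le> 1 / real N * real N ^ 2"
        using R by (intro mult_right_mono) auto
      then show "0 \<le> R i * real N ^ 2 \<and> R i * real N ^ 2 \<le> real N"
        using R(1)[of i] N by (simp add: power2_eq_square)
    qed (use gN in auto)
    finally show ?thesis by simp
  qed
  ultimately have "(\<Sum>z\<in>frac_idx N. real (card (frac_nbr N R z)))
      \<le> (\<Sum>q\<in>{1..N}. \<Sum>q'\<in>{1..N}. 18 ^ ?d * ((\<Prod>i\<in>UNIV. R i * real N ^ 2) + real (gcd q q') * real N ^ (?d - 1)))"
    by (smt (verit) of_nat_le_iff sum_mono)
  also have "\<dots> = 18 ^ ?d * (real N ^ 2 * (\<Prod>i\<in>UNIV. R i * real N ^ 2)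
      + (\<Sum>q\<in>{1..N}. \<Sum>q'\<in>{1..N}. real (gcd q q')) * real N ^ (?d - 1))"
    by (simp add: sum_distrib_left sum_distrib_right sum.distrib algebra_simps power2_eq_square)
  also have "\<dots> \<le> 18 ^ ?d * (real N ^ 2 * (\<Prod>i\<in>UNIV. R i * real N ^ 2) + (real N ^ 2 * harm N) * real N ^ (?d - 1))"
    by (intro mult_left_mono add_left_mono mult_right_mono sum_gcd_le) auto
  also have "(\<Prod>i\<in>UNIV. R i * real N ^ 2) = (\<Prod>i\<in>UNIV. R i) * real N ^ (2 * ?d)"
    by (simp add: prod.distrib power_mult)
  also have "(real N ^ 2 * harm N) * real N ^ (?d - 1) = harm N * real N ^ (?d + 1)"
    by (cases ?d) (simp_all add: power2_eq_square)
  also have "real N ^ 2 * ((\<Prod>i\<in>UNIV. R i) * real N ^ (2 * ?d)) = real N ^ (?d + 1) * (real N ^ (?d + 1) * (\<Prod>i\<in>UNIV. R i))"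
    by (simp add: power_add power_mult power2_eq_square mult_2 mult_ac)
  \<comment> \<open>The harmonic number is charged to the main term as well, so that it becomes a
    common factor and cancels well against the threshold \<open>\<theta>\<close> used later.\<close>
  also have "\<dots> \<le> harm N * (real N ^ (?d + 1) * (real N ^ (?d + 1) * (\<Prod>i\<in>UNIV. R i)))"
  proof -
    have "1 \<le> (harm N :: real)"
      using N harm_mono[of 1 N, where ?'a = real] by (simp add: harm_expand)
    moreover have "0 \<le> real N ^ (?d + 1) * (real N ^ (?d + 1) * (\<Prod>i\<in>UNIV. R i))"
      using R by (intro mult_nonneg_nonneg prod_nonneg) auto
    ultimately show ?thesis using mult_right_mono by fastforce
  qed
  finally show ?thesis by (simp add: algebra_simps)
qed

text \<open>Markov's inequality; it will bound the number of fractions with too many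
  neighbours.\<close>

lemma card_large_le:
  fixes f :: "'a \<Rightarrow> real"
  assumes "finite A" "\<And>x. x \<in> A \<Longrightarrow> 0 \<le> f x" "0 < \<theta>"
  shows "real (card {x \<in> A. \<theta> < f x}) * \<theta> \<le> (\<Sum>x\<in>A. f x)"
proof -
  have "real (card {x \<in> A. \<theta> < f x}) * \<theta> = (\<Sum>x\<in>{x \<in> A. \<theta> < f x}. \<theta>)" by simp
  also have "\<dots> \<le> (\<Sum>x\<in>{x \<in> A. \<theta> < f x}. f x)" by (intro sum_mono) auto
  also have "\<dots> \<le> (\<Sum>x\<in>A. f x)" using assms by (intro sum_mono2) auto
  finally show ?thesis .
qed

lemma frac_nbr_mono:
  assumes "\<And>i. R i \<le> R' i"
  shows "frac_nbr N R z \<subseteq> frac_nbr N R' z"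
proof
  fix z' assume "z' \<in> frac_nbr N R z"
  then have *: "z' \<in> frac_idx N" "\<And>i. \<bar>frac_pt z i - frac_pt z' i\<bar> \<le> 4 * R i"
    by (auto simp: frac_nbr_def)
  have "\<bar>frac_pt z i - frac_pt z' i\<bar> \<le> 4 * R' i" for i
    using *(2)[of i] assms[of i] by linarith
  then show "z' \<in> frac_nbr N R' z" using *(1) by (simp add: frac_nbr_def)
qed

text \<open>Scales below \<open>1/N\<^sup>2\<close> need no separate treatment: if some \<open>\<rho> i\<close> is smaller than that, the bound at
  scale \<open>1/N\<^sup>2\<close> is already a constant multiple of \<open>K\<close>; otherwise the neighbourhoods no longer
  depend on \<open>r\<close>. Hence logarithmically many dyadic scales suffice, however small \<open>\<rho>\<close> is.\<close>
lemma well_spaced_fractions: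
  fixes \<rho> :: "'d::finite \<Rightarrow> real"
  assumes N: "1 \<le> N" and \<rho>: "\<And>i. 0 < \<rho> i" "\<And>i. \<rho> i \<le> 1 / real N" and K: "0 < K"
  shows "\<exists>B \<subseteq> frac_idx N.
    real (card B) * K \<le> (log 2 (real N) + 2) * 18 ^ CARD('d) * harm N * real N ^ (CARD('d) + 1) \<and>
    (\<forall>z\<in>frac_idx N - B. \<forall>r. 0 < r \<longrightarrow> r \<le> 1 / real N \<longrightarrow>
      real (card (frac_nbr N (\<lambda>i. max r (\<rho> i)) z))
        \<le> 2 ^ CARD('d) * 2 * K * (1 + real N ^ (CARD('d) + 1) * (\<Prod>i\<in>UNIV. max r (\<rho> i))))"
proof -
  let ?d = "CARD('d)"
  \<comment> \<open>With \<open>2 ^ J \<ge> N\<close> the finest scale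
    \<open>1 / (2 ^ J * N)\<close> is at most \<open>1 / N^2\<close>, while the number of scales
    remains logarithmic. The exceptional sets of all scales are discarded together.\<close>
  define J where "J = nat \<lceil>log 2 (real N)\<rceil>"
  have J: "real N \<le> 2 ^ J" "real J + 1 \<le> log 2 (real N) + 2"
  proof -
    have "real N = 2 powr log 2 (real N)" using N by simp
    also have "\<dots> \<le> 2 powr real J" unfolding J_def by (intro powr_mono) linarith+
    finally show "real N \<le> 2 ^ J" by (simp add: powr_realpow)
    have "0 \<le> log 2 (real N)" using N by simp
    then show "real J + 1 \<le> log 2 (real N) + 2" unfolding J_def by linarith
  qed
  define R where "R j i = max (1 / (2 ^ j * real N)) (\<rho> i)" for j :: nat and i
  define \<theta> where "\<theta> j = K * (1 + real N ^ (?d + 1) * (\<Prod>i\<in>UNIV. R j i))" for j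
  have R0: "0 < R j i" for j i unfolding R_def using \<rho>(1)[of i] by simp
  have RN: "R j i \<le> 1 / real N" for j i
    unfolding R_def using \<rho>(2)[of i] N by (auto simp: field_simps)
  have prodR: "0 \<le> (\<Prod>i\<in>UNIV. R j i)" for j using R0 by (intro prod_nonneg) (auto intro: less_imp_le)
  have one: "1 \<le> 1 + real N ^ (?d + 1) * (\<Prod>i\<in>UNIV. R j i)" for j using prodR by simp
  then have \<theta>0: "0 < \<theta> j" for j
    unfolding \<theta>_def using K by (smt (verit) mult_pos_pos)
  define B where "B j = {z \<in> frac_idx N. \<theta> j < real (card (frac_nbr N (R j) z))}" for j
  have cardB: "real (card (B j)) * K \<le> 18 ^ ?d * harm N * real N ^ (?d + 1)" for j
  proof -
    have "real (card (B j)) * \<theta> j \<le> (\<Sum>z\<in>frac_idx N. real (card (frac_nbr N (R j) z)))"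
      unfolding B_def by (intro card_large_le finite_frac_idx \<theta>0) auto
    also have "\<dots> \<le> 18 ^ ?d * harm N * real N ^ (?d + 1) * (1 + real N ^ (?d + 1) * (\<Prod>i\<in>UNIV. R j i))"
      using R0 RN by (intro sum_card_frac_nbr_le N) (auto intro: less_imp_le)
    finally have "(real (card (B j)) * K) * (1 + real N ^ (?d + 1) * (\<Prod>i\<in>UNIV. R j i))
        \<le> (18 ^ ?d * harm N * real N ^ (?d + 1)) * (1 + real N ^ (?d + 1) * (\<Prod>i\<in>UNIV. R j i))"
      unfolding \<theta>_def by (simp add: mult_ac)
    then show ?thesis using one[of j] by (simp only: mult_le_cancel_right_pos less_le_trans[OF zero_less_one])
  qed
  have "real (card (\<Union>j\<in>{..J}. B j)) \<le> (\<Sum>j\<in>{..J}. real (card (B j)))"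
    using card_UN_le[of "{..J}" B] by (metis finite_atMost of_nat_le_iff of_nat_sum)
  then have "real (card (\<Union>j\<in>{..J}. B j)) * K \<le> (\<Sum>j\<in>{..J}. real (card (B j))) * K"
    using K by (intro mult_right_mono) auto
  also have "\<dots> \<le> (\<Sum>j\<in>{..J}. 18 ^ ?d * harm N * real N ^ (?d + 1))"
    unfolding sum_distrib_right by (intro sum_mono cardB)
  also have "\<dots> = (real J + 1) * (18 ^ ?d * harm N * real N ^ (?d + 1))" by (simp add: add_ac)
  also have "\<dots> \<le> (log 2 (real N) + 2) * (18 ^ ?d * harm N * real N ^ (?d + 1))"
    using J(2) harm_nonneg[of N, where 'a=real] by (intro mult_right_mono) auto
  finally have c: "real (card (\<Union>j\<in>{..J}. B j)) * K \<le> (log 2 (real N) + 2) * 18 ^ ?d * harm N * real N ^ (?d + 1)"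
    by (simp add: mult_ac)
  have main: "real (card (frac_nbr N (\<lambda>i. max r (\<rho> i)) z))
        \<le> 2 ^ ?d * 2 * K * (1 + real N ^ (?d + 1) * (\<Prod>i\<in>UNIV. max r (\<rho> i)))"
    if z: "z \<in> frac_idx N - (\<Union>j\<in>{..J}. B j)" and r: "0 < r" "r \<le> 1 / real N" for z r
  proof -
    define X where "X = real N ^ (?d + 1) * (\<Prod>i\<in>UNIV. max r (\<rho> i))"
    have X0: "0 \<le> X" unfolding X_def using r by (intro mult_nonneg_nonneg prod_nonneg) auto
    have at: "real (card (frac_nbr N (\<lambda>i. max r (\<rho> i)) z)) \<le> \<theta> j" if "j \<le> J" "r \<le> 1 / (2 ^ j * real N)" for j
    proof -
      have le: "max r (\<rho> i) \<le> R j i" for i unfolding R_def using that(2) by auto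
      have "frac_nbr N (\<lambda>i. max r (\<rho> i)) z \<subseteq> frac_nbr N (R j) z"
        using le by (rule frac_nbr_mono)
      then have "card (frac_nbr N (\<lambda>i. max r (\<rho> i)) z) \<le> card (frac_nbr N (R j) z)"
        by (intro card_mono) (auto simp: frac_nbr_def finite_frac_idx)
      moreover have "real (card (frac_nbr N (R j) z)) \<le> \<theta> j" using z that(1) unfolding B_def by force
      ultimately show ?thesis by linarith
    qed
    have two: "(1::real) \<le> 2 ^ ?d" by (rule one_le_power) simp
    have "real (card (frac_nbr N (\<lambda>i. max r (\<rho> i)) z)) \<le> 2 ^ ?d * 2 * K * (1 + X)"
    proof (cases "r \<le> 1 / (2 ^ J * real N)")
      case True
      have le: "real (card (frac_nbr N (\<lambda>i. max r (\<rho> i)) z)) \<le> \<theta> J" using at True by simp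
      show ?thesis
      proof (cases "\<exists>i. \<rho> i \<le> 1 / (2 ^ J * real N)")
        case True
        then obtain i0 where i0: "\<rho> i0 \<le> 1 / (2 ^ J * real N)" by blast
        \<comment> \<open>One side is at most \<open>1 / N^2\<close> and the others are at most
          \<open>1 / N\<close>, which offsets the factor \<open>N^(d+1)\<close> exactly.\<close>
        have "(\<Prod>i\<in>UNIV. R J i) = R J i0 * (\<Prod>i\<in>UNIV - {i0}. R J i)"
          by (simp add: prod.remove)
        also have "\<dots> \<le> (1 / real N ^ 2) * (\<Prod>i\<in>UNIV - {i0}. 1 / real N)"
        proof (intro mult_mono prod_mono conjI)
          have "R J i0 = 1 / (2 ^ J * real N)" unfolding R_def using i0 by simp
          also have "\<dots> \<le> 1 / (real N * real N)"
            using J(1) N by (intro divide_left_mono mult_right_mono) auto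
          finally show "R J i0 \<le> 1 / real N ^ 2" by (simp add: power2_eq_square)
        qed (use R0 RN in \<open>auto intro: less_imp_le prod_nonneg\<close>)
        also have "\<dots> = 1 / real N ^ (?d + 1)"
          by (cases ?d) (simp_all add: power2_eq_square power_divide)
        finally have "real N ^ (?d + 1) * (\<Prod>i\<in>UNIV. R J i) \<le> 1"
          using N by (simp add: field_simps)
        then have "\<theta> J \<le> K * 2" unfolding \<theta>_def using K by (intro mult_left_mono) auto
        also have "\<dots> \<le> (2 ^ ?d * (1 + X)) * (K * 2)"
          using mult_mono[OF two, of 1 "1 + X"] X0 K mult_right_mono[of 1 "2 ^ ?d * (1 + X)" "K * 2"] by simp
        finally show ?thesis using le by (simp add: mult_ac)
      next
        case False
        then have "R J i = max r (\<rho> i)" for i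
          unfolding R_def using True by (smt (verit))
        then have "\<theta> J = K * (1 + X)" unfolding \<theta>_def X_def by simp
        also have "\<dots> \<le> (2 ^ ?d * 2) * (K * (1 + X))"
        proof -
          have "1 * (K * (1 + X)) \<le> (2 ^ ?d * 2) * (K * (1 + X))"
            using two X0 K by (intro mult_right_mono mult_nonneg_nonneg) linarith+
          then show ?thesis by simp
        qed
        finally show ?thesis using le by (simp add: mult_ac)
      qed
    next
      case False
      \<comment> \<open>The last dyadic scale that is still at least \<open>r\<close> is at most
        \<open>2 * r\<close>; doubling every side costs the factor \<open>2 ^ d\<close>.\<close>
      define P where "P j \<longleftrightarrow> \<not> r \<le> 1 / (2 ^ j * real N)" for j :: nat
      have "P J" "\<not> P 0" using False r unfolding P_def by auto
      then obtain j where j: "j < J" "\<not> P j" "P (Suc j)"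
        using ex_least_nat_less[of P J] by blast
      have jr: "r \<le> 1 / (2 ^ j * real N)" "1 / (2 ^ j * real N) \<le> 2 * r"
        using j(2,3) N unfolding P_def by (auto simp: field_simps)
      have "(\<Prod>i\<in>UNIV. R j i) \<le> (\<Prod>i\<in>UNIV. 2 * max r (\<rho> i))"
      proof (intro prod_mono conjI)
        fix i show "R j i \<le> 2 * max r (\<rho> i)" unfolding R_def using jr(2) \<rho>(1)[of i] by auto
      qed (use R0 in \<open>auto intro: less_imp_le\<close>)
      also have "\<dots> = 2 ^ ?d * (\<Prod>i\<in>UNIV. max r (\<rho> i))" by (simp add: prod.distrib)
      finally have "real N ^ (?d + 1) * (\<Prod>i\<in>UNIV. R j i)
          \<le> real N ^ (?d + 1) * (2 ^ ?d * (\<Prod>i\<in>UNIV. max r (\<rho> i)))"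
        by (rule mult_left_mono) simp
      also have "\<dots> = 2 ^ ?d * X" unfolding X_def by (simp only: mult_ac)
      finally have "1 + real N ^ (?d + 1) * (\<Prod>i\<in>UNIV. R j i) \<le> 2 ^ ?d * (1 + X)"
        using two unfolding distrib_left by linarith
      then have "\<theta> j \<le> K * (2 ^ ?d * (1 + X))"
        unfolding \<theta>_def using K by (intro mult_left_mono) auto
      also have "\<dots> \<le> 2 * (K * (2 ^ ?d * (1 + X)))" using K X0 by simp
      finally show ?thesis using at[of j] j(1) jr(1) by (simp add: mult_ac)
    qed
    then show ?thesis unfolding X_def .
  qed
  show ?thesis
  proof (intro exI conjI)
    show "(\<Union>j\<in>{..J}. B j) \<subseteq> frac_idx N" unfolding B_def by auto
  qed (use c main in auto)
qed

section \<open>One step of the Cantor construction\<close>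

lemma meet_count_enumerate:
  fixes f :: "'i \<Rightarrow> real^'d"
  assumes "finite I"
  shows "\<exists>ys. length ys = card I \<and> set ys = f ` I \<and>
    (\<forall>B. meet_count l ys B = card {w \<in> I. corner_cube (f w) l \<inter> B \<noteq> {}})"
proof -
  obtain ws where ws: "set ws = I" "distinct ws"
    using finite_distinct_list[OF assms] by blast
  have "meet_count l (map f ws) B = card {w \<in> I. corner_cube (f w) l \<inter> B \<noteq> {}}" for B
  proof -
    have "meet_count l (map f ws) B = length (filter (\<lambda>w. corner_cube (f w) l \<inter> B \<noteq> {}) ws)"
      by (simp add: meet_count_def filter_map o_def)
    also have "\<dots> = card (set (filter (\<lambda>w. corner_cube (f w) l \<inter> B \<noteq> {}) ws))"
      using ws(2) by (metis distinct_card distinct_filter)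
    finally show ?thesis using ws(1) by simp
  qed
  moreover have "length (map f ws) = card I" using ws by (simp add: distinct_card[symmetric])
  ultimately show ?thesis using ws(1) by (intro exI[of _ "map f ws"]) auto
qed

lemma card_nat_between_le:
  fixes u v :: real
  assumes "u \<le> v"
  shows "real (card {a::nat. u \<le> real a \<and> real a \<le> v}) \<le> v - u + 1"
    and "finite {a::nat. u \<le> real a \<and> real a \<le> v}"
proof -
  have sub: "int ` {a::nat. u \<le> real a \<and> real a \<le> v} \<subseteq> {\<lceil>u\<rceil>..\<lfloor>v\<rfloor>}"
    by (auto simp: ceiling_le_iff le_floor_iff)
  then have "finite (int ` {a::nat. u \<le> real a \<and> real a \<le> v})" by (rule finite_subset) simp
  then show "finite {a::nat. u \<le> real a \<and> real a \<le> v}" by (rule finite_imageD) simp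
  from sub have "card (int ` {a::nat. u \<le> real a \<and> real a \<le> v}) \<le> card {\<lceil>u\<rceil>..\<lfloor>v\<rfloor>}"
    by (intro card_mono) auto
  then have "card {a::nat. u \<le> real a \<and> real a \<le> v} \<le> nat (\<lfloor>v\<rfloor> - \<lceil>u\<rceil> + 1)"
    by (simp add: card_image)
  moreover have "real (nat (\<lfloor>v\<rfloor> - \<lceil>u\<rceil> + 1)) \<le> v - u + 1"
    using assms by linarith
  ultimately show "real (card {a::nat. u \<le> real a \<and> real a \<le> v}) \<le> v - u + 1" by linarith
qed

lemma card_int_between_le:
  fixes u v :: real
  assumes "u \<le> v"
  shows "real (card {a::int. u \<le> real_of_int a \<and> real_of_int a \<le> v}) \<le> v - u + 1"
    and "v - u - 1 \<le> real (card {a::int. u \<le> real_of_int a \<and> real_of_int a \<le> v})"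
    and "finite {a::int. u \<le> real_of_int a \<and> real_of_int a \<le> v}"
proof -
  have "{a::int. u \<le> real_of_int a \<and> real_of_int a \<le> v} = {\<lceil>u\<rceil>..\<lfloor>v\<rfloor>}"
    by (auto simp: ceiling_le_iff le_floor_iff)
  then show "real (card {a::int. u \<le> real_of_int a \<and> real_of_int a \<le> v}) \<le> v - u + 1"
    "v - u - 1 \<le> real (card {a::int. u \<le> real_of_int a \<and> real_of_int a \<le> v})"
    "finite {a::int. u \<le> real_of_int a \<and> real_of_int a \<le> v}"
    using assms by (simp_all) linarith+
qed

section \<open>Filling boxes with cubes\<close>

definition box_children :: "('d::finite \<Rightarrow> real) \<Rightarrow> real \<Rightarrow> ('d \<Rightarrow> nat) set" where
  "box_children \<rho> l' = (\<Pi>\<^sub>E i\<in>UNIV. {..<nat \<lfloor>\<rho> i / l'\<rfloor>})"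

lemma finite_box_children: "finite (box_children \<rho> l')"
  unfolding box_children_def by (intro finite_PiE) auto

lemma box_children_lessD: "a \<in> box_children \<rho> l' \<Longrightarrow> 0 < l' \<Longrightarrow> real (a i) * l' + l' \<le> \<rho> i"
proof -
  assume a: "a \<in> box_children \<rho> l'" and l': "0 < l'"
  then have "a i < nat \<lfloor>\<rho> i / l'\<rfloor>" unfolding box_children_def by auto
  then have "real (a i) + 1 \<le> \<rho> i / l'" by linarith
  then show ?thesis using l' by (simp add: field_simps)
qed

lemma card_box_children:
  fixes \<rho> :: "'d::finite \<Rightarrow> real"
  assumes "0 < l'" "\<And>i. l' \<le> \<rho> i"
  shows "(\<Prod>i\<in>UNIV. \<rho> i / (2 * l')) \<le> real (card (box_children \<rho> l'))"
proof -
  have "real (card (box_children \<rho> l')) = (\<Prod>i\<in>UNIV. real (nat \<lfloor>\<rho> i / l'\<rfloor>))"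
    unfolding box_children_def by (simp add: card_PiE)
  moreover have "(\<Prod>i\<in>UNIV. \<rho> i / (2 * l')) \<le> (\<Prod>i\<in>UNIV. real (nat \<lfloor>\<rho> i / l'\<rfloor>))"
  proof (intro prod_mono conjI)
    fix i
    have "y / 2 \<le> real (nat \<lfloor>y\<rfloor>)" if "1 \<le> y" for y :: real
    proof -
      have "1 \<le> \<lfloor>y\<rfloor>" using that by simp
      then show ?thesis by linarith
    qed
    from this[of "\<rho> i / l'"] have "\<rho> i / l' / 2 \<le> real (nat \<lfloor>\<rho> i / l'\<rfloor>)"
      using assms by simp
    then show "\<rho> i / (2 * l') \<le> real (nat \<lfloor>\<rho> i / l'\<rfloor>)" by (simp add: field_simps)
    show "0 \<le> \<rho> i / (2 * l')" using assms(1) assms(2)[of i] by simp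
  qed
  ultimately show ?thesis by simp
qed

text \<open>Here \<open>u\<close> is the centre of the ball relative to the lower corner of the box.
  In each coordinate at most \<open>2 * r / l' + 2 \<le> 4 * r / l'\<close> grid positions are met,
  and never more than \<open>\<rho> i / l'\<close>. The remaining factor 2 in 8 pays for the floor
  in the number of cubes per side.\<close>

lemma card_box_children_meeting:
  fixes \<rho> :: "'d::finite \<Rightarrow> real"
  assumes l': "0 < l'" "\<And>i. l' \<le> \<rho> i" and r: "l' \<le> r"
  shows "real (card {a \<in> box_children \<rho> l'. \<forall>i. u i - r - l' \<le> real (a i) * l' \<and> real (a i) * l' \<le> u i + r})
    \<le> 8 ^ CARD('d) * (\<Prod>i\<in>UNIV. min 1 (r / \<rho> i)) * real (card (box_children \<rho> l'))"
proof -
  define T where "T i = {a \<in> {..<nat \<lfloor>\<rho> i / l'\<rfloor>}. u i - r - l' \<le> real a * l' \<and> real a * l' \<le> u i + r}" for i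
  have \<rho>0: "0 < \<rho> i" for i using l'(1) l'(2)[of i] by simp
  have "{a \<in> box_children \<rho> l'. \<forall>i. u i - r - l' \<le> real (a i) * l' \<and> real (a i) * l' \<le> u i + r}
      \<subseteq> (\<Pi>\<^sub>E i\<in>UNIV. T i)"
    unfolding box_children_def T_def by (auto simp: PiE_iff)
  then have "card {a \<in> box_children \<rho> l'. \<forall>i. u i - r - l' \<le> real (a i) * l' \<and> real (a i) * l' \<le> u i + r}
      \<le> card (\<Pi>\<^sub>E i\<in>UNIV. T i)"
    by (intro card_mono finite_PiE) (auto simp: T_def)
  then have "real (card {a \<in> box_children \<rho> l'. \<forall>i. u i - r - l' \<le> real (a i) * l' \<and> real (a i) * l' \<le> u i + r})
      \<le> (\<Prod>i\<in>UNIV. real (card (T i)))"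
    by (simp add: card_PiE flip: of_nat_prod)
  also have "\<dots> \<le> (\<Prod>i\<in>UNIV. 8 * min 1 (r / \<rho> i) * (\<rho> i / (2 * l')))"
  proof (intro prod_mono conjI)
    fix i
    have "T i \<subseteq> {..<nat \<lfloor>\<rho> i / l'\<rfloor>}" unfolding T_def by auto
    then have "card (T i) \<le> card {..<nat \<lfloor>\<rho> i / l'\<rfloor>}" by (rule card_mono[rotated]) simp
    then have "card (T i) \<le> nat \<lfloor>\<rho> i / l'\<rfloor>" by simp
    moreover have "0 < \<rho> i / l'" using \<rho>0 l' by simp
    ultimately have 1: "real (card (T i)) \<le> \<rho> i / l'" by linarith
    have sub: "T i \<subseteq> {a. (u i - r - l') / l' \<le> real a \<and> real a \<le> (u i + r) / l'}"
      unfolding T_def using l'(1) by (auto simp: field_simps)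
    have "(u i - r - l') / l' \<le> (u i + r) / l'" using l' r by (intro divide_right_mono) auto
    note between = card_nat_between_le[OF this]
    from between(2) sub have "card (T i) \<le> card {a::nat. (u i - r - l') / l' \<le> real a \<and> real a \<le> (u i + r) / l'}"
      by (rule card_mono)
    with between(1) have "real (card (T i)) \<le> (u i + r) / l' - (u i - r - l') / l' + 1" by linarith
    also have "\<dots> = 2 * r / l' + 2" using l'(1) by (simp add: field_simps)
    also have "\<dots> \<le> 4 * r / l'" using l'(1) r by (simp add: field_simps)
    finally have 2: "real (card (T i)) \<le> 4 * r / l'" .
    show "real (card (T i)) \<le> 8 * min 1 (r / \<rho> i) * (\<rho> i / (2 * l'))"
    proof (cases "1 \<le> r / \<rho> i")
      case True
      have "0 \<le> \<rho> i / l'" using \<rho>0[of i] l'(1) by simp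
      then have "real (card (T i)) \<le> 4 * (\<rho> i / l')" using 1 by linarith
      then show ?thesis using True by (simp add: min_def)
    next
      case False
      then show ?thesis using 2 \<rho>0[of i] by (simp add: min_def)
    qed
  qed simp
  also have "\<dots> = 8 ^ CARD('d) * (\<Prod>i\<in>UNIV. min 1 (r / \<rho> i)) * (\<Prod>i\<in>UNIV. \<rho> i / (2 * l'))"
    by (simp only: prod.distrib prod_constant)
  also have "\<dots> \<le> 8 ^ CARD('d) * (\<Prod>i\<in>UNIV. min 1 (r / \<rho> i)) * real (card (box_children \<rho> l'))"
  proof (intro mult_left_mono card_box_children l' mult_nonneg_nonneg prod_nonneg)
    fix i
    have "0 \<le> r / \<rho> i" using \<rho>0[of i] l'(1) r by simp
    then show "0 \<le> min 1 (r / \<rho> i)" by simp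
  qed simp
  finally show ?thesis .
qed

text \<open>A child can meet the ball only if the fraction at the corner of its box is within
  \<open>r + \<rho> i\<close> of the centre. The count is therefore at most the number of such
  fractions times the share of one box that the ball can see.\<close>

lemma child_cubes:
  fixes \<rho> :: "'d::finite \<Rightarrow> real" and Z :: "(nat \<times> ('d \<Rightarrow> int)) set"
  assumes Z: "finite Z" and l': "0 < l'" "\<And>i. l' \<le> \<rho> i"
  shows "\<exists>ys :: (real^'d) list. length ys = card Z * card (box_children \<rho> l') \<and>
    (\<forall>y\<in>set ys. \<exists>z\<in>Z. \<forall>v\<in>corner_cube y l'. \<forall>i. frac_pt z i \<le> v$i \<and> v$i \<le> frac_pt z i + \<rho> i) \<and>
    (\<forall>x r. l' \<le> r \<longrightarrow> real (meet_count l' ys (sup_ball x r)) \<le>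
      8 ^ CARD('d) * (\<Prod>i\<in>UNIV. min 1 (r / \<rho> i)) * real (card (box_children \<rho> l')) *
      real (card {z \<in> Z. \<forall>i. \<bar>frac_pt z i - x$i\<bar> \<le> r + \<rho> i}))"
proof -
  define I where "I = Z \<times> box_children \<rho> l'"
  define f where "f = (\<lambda>(z, a). (\<chi> i. frac_pt z i + real (a i) * l') :: real^'d)"
  have "finite I" unfolding I_def using Z finite_box_children by blast
  then obtain ys where ys: "length ys = card I" "set ys = f ` I"
      "\<And>B. meet_count l' ys B = card {w \<in> I. corner_cube (f w) l' \<inter> B \<noteq> {}}"
    using meet_count_enumerate[of I f l'] by blast
  have in_box: "frac_pt z i \<le> v$i \<and> v$i \<le> frac_pt z i + \<rho> i"
    if "(z, a) \<in> I" "v \<in> corner_cube (f (z, a)) l'" for z a v i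
  proof -
    have "real (a i) * l' + l' \<le> \<rho> i" using that(1) l'(1) box_children_lessD unfolding I_def by blast
    moreover have "frac_pt z i + real (a i) * l' \<le> v$i \<and> v$i \<le> frac_pt z i + real (a i) * l' + l'"
      using that(2) unfolding corner_cube_def f_def by simp
    moreover have "0 \<le> real (a i) * l'" using l'(1) by simp
    ultimately show ?thesis by linarith
  qed
  have "real (meet_count l' ys (sup_ball x r)) \<le>
      8 ^ CARD('d) * (\<Prod>i\<in>UNIV. min 1 (r / \<rho> i)) * real (card (box_children \<rho> l')) *
      real (card {z \<in> Z. \<forall>i. \<bar>frac_pt z i - x$i\<bar> \<le> r + \<rho> i})" if r: "l' \<le> r" for x r
  proof -
    define H where "H = {z \<in> Z. \<forall>i. \<bar>frac_pt z i - x$i\<bar> \<le> r + \<rho> i}"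
    define A where "A z = {a \<in> box_children \<rho> l'. \<forall>i. (x$i - frac_pt z i) - r - l' \<le> real (a i) * l' \<and>
        real (a i) * l' \<le> (x$i - frac_pt z i) + r}" for z
    have finH: "finite H" unfolding H_def using Z by simp
    have finA: "finite (A z)" for z unfolding A_def by (rule finite_subset[OF _ finite_box_children]) auto
    have "{w \<in> I. corner_cube (f w) l' \<inter> sup_ball x r \<noteq> {}} \<subseteq> (SIGMA z:H. A z)"
    proof
      fix w assume w: "w \<in> {w \<in> I. corner_cube (f w) l' \<inter> sup_ball x r \<noteq> {}}"
      obtain z a where za: "w = (z, a)" by (metis surj_pair)
      from w obtain v where v: "v \<in> corner_cube (f (z, a)) l'" "v \<in> sup_ball x r" and I: "(z, a) \<in> I"
        unfolding za by blast
      have vx: "\<bar>v$i - x$i\<bar> \<le> r" for i using v(2) unfolding sup_ball_def by simp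
      have "\<bar>frac_pt z i - x$i\<bar> \<le> r + \<rho> i" for i
        using in_box[OF I v(1), of i] vx[of i] by linarith
      moreover have "(x$i - frac_pt z i) - r - l' \<le> real (a i) * l' \<and>
          real (a i) * l' \<le> (x$i - frac_pt z i) + r" for i
      proof -
        have "frac_pt z i + real (a i) * l' \<le> v$i \<and> v$i \<le> frac_pt z i + real (a i) * l' + l'"
          using v(1) unfolding corner_cube_def f_def by simp
        then show ?thesis using vx[of i] by linarith
      qed
      ultimately show "w \<in> (SIGMA z:H. A z)"
        using I unfolding za H_def A_def I_def by auto
    qed
    then have "card {w \<in> I. corner_cube (f w) l' \<inter> sup_ball x r \<noteq> {}} \<le> card (SIGMA z:H. A z)"
      using finH finA by (intro card_mono finite_SigmaI)
    also have "\<dots> = (\<Sum>z\<in>H. card (A z))" using finH finA by (intro card_SigmaI) auto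
    finally have "real (meet_count l' ys (sup_ball x r)) \<le> (\<Sum>z\<in>H. real (card (A z)))"
      unfolding ys(3) of_nat_sum[symmetric] by (rule of_nat_mono)
    also have "\<dots> \<le> (\<Sum>z\<in>H. 8 ^ CARD('d) * (\<Prod>i\<in>UNIV. min 1 (r / \<rho> i)) * real (card (box_children \<rho> l')))"
      unfolding A_def using l' r by (intro sum_mono card_box_children_meeting) auto
    finally show ?thesis by (simp add: H_def mult_ac)
  qed
  moreover have "\<exists>z\<in>Z. \<forall>v\<in>corner_cube y l'. \<forall>i. frac_pt z i \<le> v$i \<and> v$i \<le> frac_pt z i + \<rho> i"
    if ys': "y \<in> set ys" for y
  proof -
    obtain w where "w \<in> I" "y = f w" using ys' ys(2) by blast
    then obtain z a where za: "(z, a) \<in> I" and y: "y = f (z, a)" by (metis surj_pair)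
    show ?thesis
    proof (intro bexI ballI allI)
      fix v i assume "v \<in> corner_cube y l'"
      then show "frac_pt z i \<le> v$i \<and> v$i \<le> frac_pt z i + \<rho> i"
        using in_box[OF za] unfolding y by blast
    next
      show "z \<in> Z" using za unfolding I_def by simp
    qed
  qed
  moreover have "length ys = card Z * card (box_children \<rho> l')"
    using ys(1) by (simp add: I_def card_cartesian_product)
  ultimately show ?thesis by blast
qed

section \<open>Counting fractions in balls and cubes\<close>

lemma card_frac_idx_near_le:
  fixes x :: "real^'d::finite"
  assumes N: "1 \<le> N" and r: "1 / real N \<le> r"
  shows "real (card {z \<in> frac_idx N. \<forall>i. \<bar>frac_pt z i - x$i\<bar> \<le> 2 * r}) \<le> real N * (5 * r * real N) ^ CARD('d)"
proof -
  define T where "T q i = {a::int. real q * (x$i - 2 * r) \<le> real_of_int a \<and> real_of_int a \<le> real q * (x$i + 2 * r)}"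
    for q :: nat and i
  have r0: "0 < r" using N r by (smt (verit) divide_pos_pos of_nat_0_less_iff less_le_trans zero_less_one)
  have le: "real q * (x$i - 2 * r) \<le> real q * (x$i + 2 * r)" for q :: nat and i
    using r0 by (intro mult_left_mono) auto
  have finT: "finite (T q i)" for q i unfolding T_def using card_int_between_le(3)[OF le] .
  have "{z \<in> frac_idx N. \<forall>i. \<bar>frac_pt z i - x$i\<bar> \<le> 2 * r} \<subseteq> (SIGMA q:{1..N}. \<Pi>\<^sub>E i\<in>UNIV. T q i)"
  proof
    fix z assume z: "z \<in> {z \<in> frac_idx N. \<forall>i. \<bar>frac_pt z i - x$i\<bar> \<le> 2 * r}"
    obtain q p where qp: "z = (q, p)" by (metis surj_pair)
    have q: "N < 2 * q" "q \<le> N" and near: "\<bar>real_of_int (p i) / real q - x$i\<bar> \<le> 2 * r" for i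
      using z unfolding qp frac_idx_def frac_pt_def by auto
    have q0: "0 < q" using q by simp
    have "p i \<in> T q i" for i
    proof -
      have "x$i - 2 * r \<le> real_of_int (p i) / real q" "real_of_int (p i) / real q \<le> x$i + 2 * r"
        using near[of i] by linarith+
      then show ?thesis unfolding T_def using q0 by (simp add: field_simps)
    qed
    then show "z \<in> (SIGMA q:{1..N}. \<Pi>\<^sub>E i\<in>UNIV. T q i)" unfolding qp using q q0 by auto
  qed
  then have "card {z \<in> frac_idx N. \<forall>i. \<bar>frac_pt z i - x$i\<bar> \<le> 2 * r} \<le> card (SIGMA q:{1..N}. \<Pi>\<^sub>E i\<in>UNIV. T q i)"
    using finT by (intro card_mono finite_SigmaI finite_PiE) auto
  also have "\<dots> = (\<Sum>q\<in>{1..N}. card (\<Pi>\<^sub>E i\<in>UNIV. T q i))"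
    using finT by (intro card_SigmaI) (auto intro!: finite_PiE)
  finally have "real (card {z \<in> frac_idx N. \<forall>i. \<bar>frac_pt z i - x$i\<bar> \<le> 2 * r})
      \<le> (\<Sum>q\<in>{1..N}. real (card (\<Pi>\<^sub>E i\<in>UNIV. T q i)))"
    unfolding of_nat_sum[symmetric] by (rule of_nat_mono)
  also have "\<dots> \<le> (\<Sum>q\<in>{1..N}. (5 * r * real N) ^ CARD('d))"
  proof (rule sum_mono)
    fix q assume q: "q \<in> {1..N}"
    have "real (card (\<Pi>\<^sub>E i\<in>UNIV. T q i)) = (\<Prod>i\<in>UNIV. real (card (T q i)))"
      by (simp add: card_PiE)
    also have "\<dots> \<le> (\<Prod>i\<in>(UNIV::'d set). 5 * r * real N)"
    proof (intro prod_mono conjI)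
      fix i
      have "real (card (T q i)) \<le> real q * (x$i + 2 * r) - real q * (x$i - 2 * r) + 1"
        unfolding T_def by (rule card_int_between_le(1)[OF le])
      also have "\<dots> = 4 * r * real q + 1" by (simp add: algebra_simps)
      also have "\<dots> \<le> 4 * r * real N + r * real N"
        using q r r0 N by (intro add_mono mult_left_mono) (auto simp: field_simps)
      finally show "real (card (T q i)) \<le> 5 * r * real N" by simp
    qed simp
    finally show "real (card (\<Pi>\<^sub>E i\<in>UNIV. T q i)) \<le> (5 * r * real N) ^ CARD('d)" by simp
  qed
  also have "\<dots> = real N * (5 * r * real N) ^ CARD('d)" by simp
  finally show ?thesis .
qed

text \<open>Each of the at least \<open>N / 2\<close> denominators leaves at least
  \<open>q * l - q / N - 1 \<ge> N * l / 2 - 2\<close> numerators per coordinate, and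
  \<open>8 \<le> N * l\<close> makes this at least \<open>N * l / 4\<close>. The margin
  \<open>1 / N\<close> reserves room for a whole box, whose sides will be at most
  \<open>1 / N\<close>.\<close>

lemma card_frac_idx_cube_ge:
  fixes x :: "real^'d::finite"
  assumes l: "0 < l" "8 \<le> real N * l" and x: "corner_cube x l \<subseteq> corner_cube 0 1"
  shows "real N / 2 * (real N * l / 4) ^ CARD('d)
    \<le> real (card {z \<in> frac_idx N. \<forall>i. x$i \<le> frac_pt z i \<and> frac_pt z i \<le> x$i + l - 1 / real N})"
proof -
  define T where "T q i = {a::int. real q * x$i \<le> real_of_int a \<and> real_of_int a \<le> real q * (x$i + l - 1 / real N)}"
    for q :: nat and i
  have N0: "0 < N" using l by (intro Suc_leI gr0I) (auto split: if_splits)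
  have lN: "1 / real N \<le> l" using l N0 by (simp add: field_simps)
  have le: "real q * x$i \<le> real q * (x$i + l - 1 / real N)" for q :: nat and i
    using lN by (intro mult_left_mono) auto
  have finT: "finite (T q i)" for q i unfolding T_def using card_int_between_le(3)[OF le] .
  have x01: "0 \<le> x$i \<and> x$i + l \<le> 1" for i
  proof -
    have "x \<in> corner_cube x l" "(\<chi> i. x$i + l) \<in> corner_cube x l" using l(1) by (auto simp: corner_cube_def)
    then have "x \<in> corner_cube 0 1" "(\<chi> i. x$i + l) \<in> corner_cube 0 1" using x by blast+
    then show ?thesis unfolding corner_cube_def by simp
  qed
  have "(SIGMA q:{N div 2<..N}. \<Pi>\<^sub>E i\<in>UNIV. T q i)
      \<subseteq> {z \<in> frac_idx N. \<forall>i. x$i \<le> frac_pt z i \<and> frac_pt z i \<le> x$i + l - 1 / real N}"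
  proof
    fix z assume z: "z \<in> (SIGMA q:{N div 2<..N}. \<Pi>\<^sub>E i\<in>UNIV. T q i)"
    obtain q p where qp: "z = (q, p)" by (metis surj_pair)
    have q: "N < 2 * q" "q \<le> N" and p: "p i \<in> T q i" for i
      using z unfolding qp by auto
    have q0: "0 < q" using q by simp
    have b: "x$i \<le> frac_pt z i \<and> frac_pt z i \<le> x$i + l - 1 / real N" for i
      using p[of i] q0 unfolding T_def frac_pt_def qp by (simp add: field_simps)
    have "0 \<le> p i \<and> p i \<le> int q" for i
    proof -
      have "0 \<le> frac_pt z i" "frac_pt z i \<le> 1"
        using b[of i] x01[of i] N0 by (auto intro: order_trans) (smt (verit) divide_nonneg_nonneg of_nat_0_le_iff)
      then have "0 \<le> real_of_int (p i)" "real_of_int (p i) \<le> real q"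
        using q0 unfolding frac_pt_def qp by (auto simp: field_simps)
      then show ?thesis by linarith
    qed
    then show "z \<in> {z \<in> frac_idx N. \<forall>i. x$i \<le> frac_pt z i \<and> frac_pt z i \<le> x$i + l - 1 / real N}"
      using b q unfolding qp frac_idx_def by auto
  qed
  then have sub: "card (SIGMA q:{N div 2<..N}. \<Pi>\<^sub>E i\<in>UNIV. T q i)
      \<le> card {z \<in> frac_idx N. \<forall>i. x$i \<le> frac_pt z i \<and> frac_pt z i \<le> x$i + l - 1 / real N}"
    by (rule card_mono[rotated]) (rule finite_subset[OF _ finite_frac_idx], auto)
  have "real N / 2 * (real N * l / 4) ^ CARD('d) \<le> real (card {N div 2<..N}) * (real N * l / 4) ^ CARD('d)"
    using l by (intro mult_right_mono) auto
  also have "\<dots> = (\<Sum>q\<in>{N div 2<..N}. (real N * l / 4) ^ CARD('d))" by simp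
  also have "\<dots> \<le> (\<Sum>q\<in>{N div 2<..N}. real (card (\<Pi>\<^sub>E i\<in>UNIV. T q i)))"
  proof (rule sum_mono)
    fix q assume q: "q \<in> {N div 2<..N}"
    then have q2: "real N \<le> 2 * real q" "real q \<le> real N" by auto
    have "(\<Prod>i\<in>(UNIV::'d set). real N * l / 4) \<le> (\<Prod>i\<in>UNIV. real (card (T q i)))"
    proof (intro prod_mono conjI)
      fix i
      have "real q * (x$i + l - 1 / real N) - real q * x$i - 1 \<le> real (card (T q i))"
        unfolding T_def by (rule card_int_between_le(2)[OF le])
      moreover have "real q * (x$i + l - 1 / real N) - real q * x$i - 1 = real q * l - real q / real N - 1"
        by (simp add: algebra_simps)
      moreover have "real q / real N \<le> 1" using q2 N0 by simp
      moreover have "real N * l \<le> 2 * real q * l" using q2 l by (intro mult_right_mono) auto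
      ultimately show "real N * l / 4 \<le> real (card (T q i))" using l(2) by linarith
    qed (use l in auto)
    then show "(real N * l / 4) ^ CARD('d) \<le> real (card (\<Pi>\<^sub>E i\<in>UNIV. T q i))"
      by (simp add: card_PiE)
  qed
  also have "\<dots> = real (card (SIGMA q:{N div 2<..N}. \<Pi>\<^sub>E i\<in>UNIV. T q i))"
    using finT by (subst card_SigmaI) (auto intro!: finite_PiE)
  finally show ?thesis using sub by linarith
qed

text \<open>Balls of radius at most \<open>1 / N\<close> are treated by pair correlations, through
  \<open>fine\<close>; larger ones by the plain count of fractions, which gives
  \<open>(r / l)^d\<close> and suffices because \<open>s \<le> d\<close>. The assumption
  \<open>bad\<close> makes the discarded fractions at most half of those guaranteed in every cube of
  side \<open>l\<close>. In \<open>D\<close>, the factor \<open>8^d\<close> comes from cutting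
  boxes, \<open>4^(d+1) / l^d\<close> from the number of fractions kept, and \<open>2^d * 2\<close>
  from \<open>well_spaced_fractions\<close>.\<close>

lemma cantor_step:
  fixes \<rho> :: "'d::finite \<Rightarrow> real"
  defines "D \<equiv> \<lambda>l::real. 8 ^ CARD('d) * 4 ^ (CARD('d) + 1) * 2 ^ CARD('d) * 2 / l ^ CARD('d)"
  assumes N: "1 \<le> N" and \<rho>: "\<And>i. 0 < \<rho> i" "\<And>i. \<rho> i \<le> 1 / real N"
    and l: "0 < l" "l \<le> 1" "8 \<le> real N * l" and K: "0 < K" and s: "0 < s" "s \<le> real CARD('d)"
    and bad: "(log 2 (real N) + 2) * 18 ^ CARD('d) * harm N * real N ^ (CARD('d) + 1)
      \<le> real N / 4 * (real N * l / 4) ^ CARD('d) * K"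
    and fine: "\<And>r. 0 < r \<Longrightarrow> r \<le> 1 / real N \<Longrightarrow>
      D l * K * ((\<Prod>i\<in>UNIV. min 1 (r / \<rho> i)) / real N ^ (CARD('d) + 1) + r ^ CARD('d)) \<le> r powr s"
  shows "\<exists>l' m. 0 < l' \<and> l' \<le> 1 / real N \<and> 0 < m \<and>
      (\<forall>x :: real^'d. corner_cube x l \<subseteq> corner_cube 0 1 \<longrightarrow> (\<exists>ys. length ys = m \<and>
        (\<forall>y\<in>set ys. corner_cube y l' \<subseteq> corner_cube x l \<and> (\<forall>v\<in>corner_cube y l'.
           \<exists>q p. N < 2 * q \<and> q \<le> N \<and> (\<forall>i. \<bar>real q * v$i - real_of_int (p i)\<bar> \<le> real q * \<rho> i))) \<and>
        (\<forall>z r. l' \<le> r \<longrightarrow> r \<le> l \<longrightarrow> real (meet_count l' ys (sup_ball z r))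
           \<le> (8 ^ CARD('d) * 4 * 20 ^ CARD('d)) * real m * (r / l) powr s) \<and>
        (\<forall>z. real (meet_count l' ys (sup_ball z l')) \<le> real m * (l' / l) powr s)))"
proof -
  let ?d = "CARD('d)"
  \<comment> \<open>The thinnest side of the boxes is the largest cube size that fits into
    them.\<close>
  define l' where "l' = Min (range \<rho>)"
  have l': "0 < l'" "l' \<le> \<rho> i" for i
    unfolding l'_def using \<rho>(1) by (auto intro: Min_le)
  have l'N: "l' \<le> 1 / real N" using l'(2) \<rho>(2) order_trans by blast
  define c where "c = real N / 4 * (real N * l / 4) ^ ?d"
  have c0: "0 < c" unfolding c_def using N l by simp
  \<comment> \<open>Of the guaranteed \<open>2 * c\<close> fractions at least \<open>c\<close>
    survive, and exactly \<open>m1\<close> of them are kept, which makes the number of children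
    independent of the parent cube.\<close>
  define m1 where "m1 = nat \<lceil>c\<rceil>"
  have m1: "c \<le> real m1" "0 < m1" unfolding m1_def using c0 by linarith+
  define bc where "bc = card (box_children \<rho> l')"
  have "(0::real) < (\<Prod>i\<in>UNIV. \<rho> i / (2 * l'))" using \<rho>(1) l'(1) by (intro prod_pos) simp
  then have "0 < real bc" unfolding bc_def
    using card_box_children[of l' \<rho>, OF l'] by (rule less_le_trans)
  then have bc0: "0 < bc" by simp
  obtain B where B: "B \<subseteq> frac_idx N"
    "real (card B) * K \<le> (log 2 (real N) + 2) * 18 ^ ?d * harm N * real N ^ (?d + 1)"
    "\<And>z r. z \<in> frac_idx N - B \<Longrightarrow> 0 < r \<Longrightarrow> r \<le> 1 / real N \<Longrightarrow>
      real (card (frac_nbr N (\<lambda>i. max r (\<rho> i)) z))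
        \<le> 2 ^ ?d * 2 * K * (1 + real N ^ (?d + 1) * (\<Prod>i\<in>UNIV. max r (\<rho> i)))"
    using well_spaced_fractions[of N \<rho> K, OF N \<rho> K] by blast
  have "real (card B) * K \<le> c * K" using B(2) bad unfolding c_def by linarith
  then have cardB: "real (card B) \<le> c" using K by simp
  have finB: "finite B" using B(1) finite_frac_idx finite_subset by blast
  have child: "\<exists>ys. length ys = m1 * bc \<and>
        (\<forall>y\<in>set ys. corner_cube y l' \<subseteq> corner_cube x l \<and> (\<forall>v\<in>corner_cube y l'.
           \<exists>q p. N < 2 * q \<and> q \<le> N \<and> (\<forall>i. \<bar>real q * v$i - real_of_int (p i)\<bar> \<le> real q * \<rho> i))) \<and>
        (\<forall>z r. l' \<le> r \<longrightarrow> r \<le> l \<longrightarrow> real (meet_count l' ys (sup_ball z r))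
           \<le> (8 ^ ?d * 4 * 20 ^ ?d) * real (m1 * bc) * (r / l) powr s) \<and>
        (\<forall>z. real (meet_count l' ys (sup_ball z l')) \<le> real (m1 * bc) * (l' / l) powr s)"
    if x: "corner_cube x l \<subseteq> corner_cube 0 1" for x :: "real^'d"
  proof -
    define F where "F = {z \<in> frac_idx N. \<forall>i. x$i \<le> frac_pt z i \<and> frac_pt z i \<le> x$i + l - 1 / real N}"
    have finF: "finite F" unfolding F_def by (rule finite_subset[OF _ finite_frac_idx]) auto
    have "2 * c \<le> real (card F)"
      using card_frac_idx_cube_ge[OF l(1,3) x] unfolding F_def c_def by simp
    moreover have "real (card F) \<le> real (card (F - B)) + real (card B)"
      using card_Un_le[of "F - B" B] card_mono[of "F - B \<union> B" F] finF finB by simp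
    ultimately have "c \<le> real (card (F - B))" using cardB by linarith
    then have "m1 \<le> card (F - B)" unfolding m1_def by (simp add: nat_le_iff ceiling_le_iff)
    then obtain Z where Z: "Z \<subseteq> F - B" "card Z = m1" "finite Z"
      using obtain_subset_with_card_n by metis
    obtain ys :: "(real^'d) list" where ys: "length ys = card Z * card (box_children \<rho> l')"
      "\<And>y. y \<in> set ys \<Longrightarrow> \<exists>z\<in>Z. \<forall>v\<in>corner_cube y l'. \<forall>i. frac_pt z i \<le> v$i \<and> v$i \<le> frac_pt z i + \<rho> i"
      "\<And>x r. l' \<le> r \<Longrightarrow> real (meet_count l' ys (sup_ball x r)) \<le>
        8 ^ ?d * (\<Prod>i\<in>UNIV. min 1 (r / \<rho> i)) * real (card (box_children \<rho> l')) *
        real (card {z \<in> Z. \<forall>i. \<bar>frac_pt z i - x$i\<bar> \<le> r + \<rho> i})"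
      using child_cubes[OF Z(3), of l' \<rho>] l' by blast
    have good: "corner_cube y l' \<subseteq> corner_cube x l \<and> (\<forall>v\<in>corner_cube y l'.
           \<exists>q p. N < 2 * q \<and> q \<le> N \<and> (\<forall>i. \<bar>real q * v$i - real_of_int (p i)\<bar> \<le> real q * \<rho> i))"
      if y: "y \<in> set ys" for y
    proof -
      obtain z where z: "z \<in> Z" "\<And>v i. v \<in> corner_cube y l' \<Longrightarrow> frac_pt z i \<le> v$i \<and> v$i \<le> frac_pt z i + \<rho> i"
        using ys(2)[OF y] by blast
      obtain q p where qp: "z = (q, p)" by (metis surj_pair)
      have zF: "z \<in> frac_idx N" "\<And>i. x$i \<le> frac_pt z i \<and> frac_pt z i \<le> x$i + l - 1 / real N"
        using z(1) Z(1) unfolding F_def by auto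
      have q: "N < 2 * q" "q \<le> N" using zF(1) unfolding qp frac_idx_def by auto
      have "corner_cube y l' \<subseteq> corner_cube x l"
      proof
        fix v assume v: "v \<in> corner_cube y l'"
        have "x$i \<le> v$i \<and> v$i \<le> x$i + l" for i
          using z(2)[OF v, of i] zF(2)[of i] \<rho>(2)[of i] by linarith
        then show "v \<in> corner_cube x l" unfolding corner_cube_def by simp
      qed
      moreover have "\<bar>real q * v$i - real_of_int (p i)\<bar> \<le> real q * \<rho> i" if v: "v \<in> corner_cube y l'" for v i
      proof -
        have q0: "0 < real q" using q by simp
        have "real_of_int (p i) / real q \<le> v$i" "v$i - \<rho> i \<le> real_of_int (p i) / real q"
          using z(2)[OF v, of i] unfolding qp frac_pt_def by auto
        then have "real_of_int (p i) \<le> v$i * real q" "(v$i - \<rho> i) * real q \<le> real_of_int (p i)"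
          using q0 by (simp_all only: pos_divide_le_eq pos_le_divide_eq)
        moreover have "0 \<le> real q * \<rho> i" using q0 \<rho>(1)[of i] by simp
        ultimately show ?thesis by (simp add: abs_le_iff algebra_simps)
      qed
      ultimately show ?thesis using q by blast
    qed
    define P where "P r = (\<Prod>i\<in>UNIV. min 1 (r / \<rho> i))" for r
    have P01: "0 \<le> P r" "P r \<le> 1" if "0 < r" for r
    proof -
      have "0 \<le> min 1 (r / \<rho> i) \<and> min 1 (r / \<rho> i) \<le> 1" for i
        using that \<rho>(1)[of i] by simp
      then show "0 \<le> P r" "P r \<le> 1" unfolding P_def by (auto intro!: prod_nonneg prod_le_1)
    qed
    have mult: "real (meet_count l' ys (sup_ball z r)) \<le> real (m1 * bc) * E"
      if r: "l' \<le> r" and h: "real (card {w \<in> Z. \<forall>i. \<bar>frac_pt w i - z$i\<bar> \<le> r + \<rho> i}) \<le> H"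
        and H: "8 ^ ?d * P r * H \<le> c * E" and E: "0 \<le> E" for z r H E
    proof -
      have r0: "0 < r" using r l'(1) by linarith
      have "real (meet_count l' ys (sup_ball z r)) \<le> 8 ^ ?d * P r * real bc *
          real (card {w \<in> Z. \<forall>i. \<bar>frac_pt w i - z$i\<bar> \<le> r + \<rho> i})"
        unfolding P_def bc_def by (rule ys(3)[OF r])
      also have "\<dots> \<le> 8 ^ ?d * P r * real bc * H"
        using h P01[OF r0] by (intro mult_left_mono) auto
      also have "\<dots> = (8 ^ ?d * P r * H) * real bc" by simp
      also have "\<dots> \<le> (c * E) * real bc" using H by (rule mult_right_mono) simp
      also have "\<dots> \<le> (real m1 * E) * real bc"
        using m1(1) E by (intro mult_right_mono) auto
      finally show ?thesis by (simp add: mult_ac)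
    qed
    have small: "real (meet_count l' ys (sup_ball z r)) \<le> real (m1 * bc) * (r / l) powr s"
      if r: "l' \<le> r" "r \<le> 1 / real N" for z r
    proof -
      have r0: "0 < r" using r l'(1) by linarith
      define X where "X = (\<Prod>i\<in>UNIV. max r (\<rho> i))"
      define H where "H = 2 ^ ?d * 2 * K * (1 + real N ^ (?d + 1) * X)"
      have X0: "0 \<le> X" unfolding X_def using r0 by (intro prod_nonneg) auto
      \<comment> \<open>In each coordinate the visible share of a box and the side governing the
        neighbour count multiply to \<open>r\<close>. This turns the product of the two bounds into
        the two summands of \<open>fine\<close>.\<close>
      have PX: "P r * X = r ^ ?d"
      proof -
        have "min 1 (r / \<rho> i) * max r (\<rho> i) = r" for i
          using \<rho>(1)[of i] r0 by (cases "r \<le> \<rho> i") (simp_all add: min_def max_def)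
        then show ?thesis unfolding P_def X_def prod.distrib[symmetric] by simp
      qed
      have "real (card {w \<in> Z. \<forall>i. \<bar>frac_pt w i - z$i\<bar> \<le> r + \<rho> i}) \<le> H"
      proof (cases "{w \<in> Z. \<forall>i. \<bar>frac_pt w i - z$i\<bar> \<le> r + \<rho> i} = {}")
        case True
        have "0 \<le> H" unfolding H_def using K X0 by simp
        then show ?thesis unfolding True by simp
      next
        \<comment> \<open>The fractions near the centre all lie in the neighbourhood of any one of
          them, and that neighbourhood is controlled because none of them was discarded.\<close>
        case False
        then obtain w where w: "w \<in> Z" "\<And>i. \<bar>frac_pt w i - z$i\<bar> \<le> r + \<rho> i" by blast
        have "{w \<in> Z. \<forall>i. \<bar>frac_pt w i - z$i\<bar> \<le> r + \<rho> i} \<subseteq> frac_nbr N (\<lambda>i. max r (\<rho> i)) w"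
        proof
          fix w' assume w': "w' \<in> {w \<in> Z. \<forall>i. \<bar>frac_pt w i - z$i\<bar> \<le> r + \<rho> i}"
          have "\<bar>frac_pt w i - frac_pt w' i\<bar> \<le> 4 * max r (\<rho> i)" for i
          proof -
            have "\<bar>frac_pt w' i - z$i\<bar> \<le> r + \<rho> i" using w' by blast
            then show ?thesis using w(2)[of i] by (auto simp: max_def)
          qed
          moreover have "w' \<in> frac_idx N" using w' Z(1) unfolding F_def by blast
          ultimately show "w' \<in> frac_nbr N (\<lambda>i. max r (\<rho> i)) w" unfolding frac_nbr_def by simp
        qed
        then have "card {w \<in> Z. \<forall>i. \<bar>frac_pt w i - z$i\<bar> \<le> r + \<rho> i} \<le> card (frac_nbr N (\<lambda>i. max r (\<rho> i)) w)"
          by (rule card_mono[rotated]) (rule finite_subset[OF _ finite_frac_idx], auto simp: frac_nbr_def)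
        moreover have "w \<in> frac_idx N - B" using w(1) Z(1) unfolding F_def by blast
        then have "real (card (frac_nbr N (\<lambda>i. max r (\<rho> i)) w)) \<le> H"
          unfolding H_def X_def using B(3) r0 r(2) by blast
        ultimately show ?thesis by linarith
      qed
      moreover have "8 ^ ?d * P r * H \<le> c * (r / l) powr s"
      proof -
        have cN: "c = real N ^ (?d + 1) * l ^ ?d / 4 ^ (?d + 1)"
          unfolding c_def by (simp add: power_divide power_mult_distrib)
        have N0: "real N ^ (?d + 1) \<noteq> 0" "l ^ ?d \<noteq> 0" using N l by auto
        have "8 ^ ?d * P r * H = 8 ^ ?d * 2 ^ ?d * 2 * K * (P r + real N ^ (?d + 1) * r ^ ?d)"
          unfolding H_def PX[symmetric] by (simp add: algebra_simps)
        also have "\<dots> = c * (D l * K * (P r / real N ^ (?d + 1) + r ^ ?d))"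
          unfolding D_def cN using N0 by (simp add: field_simps)
        also have "\<dots> \<le> c * r powr s"
          using fine[OF r0 r(2)] c0 unfolding P_def by (intro mult_left_mono) auto
        also have "r powr s \<le> (r / l) powr s"
          using r0 l s by (intro powr_mono2) (auto simp: field_simps)
        finally show ?thesis using c0 by simp
      qed
      ultimately show ?thesis by (intro mult[OF r(1)]) auto
    qed
    \<comment> \<open>Here the visible share \<open>P r\<close> is simply bounded by 1. The factor
      \<open>20 ^ d\<close> combines \<open>5 ^ d\<close> from counting fractions with
      \<open>4 ^ d\<close> from \<open>c\<close>.\<close>
    have large: "real (meet_count l' ys (sup_ball z r)) \<le> real (m1 * bc) * (8 ^ ?d * 4 * 20 ^ ?d * (r / l) powr s)"
      if r: "1 / real N \<le> r" "r \<le> l" for z r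
    proof (rule mult)
      show "l' \<le> r" using r l'N by linarith
      have r0: "0 < r" using \<open>l' \<le> r\<close> l'(1) by linarith
      have "{w \<in> Z. \<forall>i. \<bar>frac_pt w i - z$i\<bar> \<le> r + \<rho> i} \<subseteq> {w \<in> frac_idx N. \<forall>i. \<bar>frac_pt w i - z$i\<bar> \<le> 2 * r}"
      proof
        fix w assume w: "w \<in> {w \<in> Z. \<forall>i. \<bar>frac_pt w i - z$i\<bar> \<le> r + \<rho> i}"
        have "\<bar>frac_pt w i - z$i\<bar> \<le> 2 * r" for i
        proof -
          have "\<bar>frac_pt w i - z$i\<bar> \<le> r + \<rho> i" using w by blast
          then show ?thesis using \<rho>(2)[of i] r(1) by linarith
        qed
        then show "w \<in> {w \<in> frac_idx N. \<forall>i. \<bar>frac_pt w i - z$i\<bar> \<le> 2 * r}"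
          using w Z(1) unfolding F_def by blast
      qed
      then have "card {w \<in> Z. \<forall>i. \<bar>frac_pt w i - z$i\<bar> \<le> r + \<rho> i}
          \<le> card {w \<in> frac_idx N. \<forall>i. \<bar>frac_pt w i - z$i\<bar> \<le> 2 * r}"
        by (rule card_mono[rotated]) (rule finite_subset[OF _ finite_frac_idx], auto)
      then show "real (card {w \<in> Z. \<forall>i. \<bar>frac_pt w i - z$i\<bar> \<le> r + \<rho> i}) \<le> real N * (5 * r * real N) ^ ?d"
        using card_frac_idx_near_le[OF N r(1), of z] by linarith
      have "8 ^ ?d * P r * (real N * (5 * r * real N) ^ ?d) \<le> 8 ^ ?d * 1 * (real N * (5 * r * real N) ^ ?d)"
        using P01[OF r0] r0 by (intro mult_right_mono mult_left_mono) auto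
      also have "\<dots> = c * (8 ^ ?d * 4 * 20 ^ ?d * (r / l) ^ ?d)"
      proof -
        have "(20::real) ^ ?d = 5 ^ ?d * 4 ^ ?d" by (simp flip: power_mult_distrib)
        then show ?thesis unfolding c_def using l by (simp add: power_mult_distrib power_divide)
      qed
      also have "\<dots> \<le> c * (8 ^ ?d * 4 * 20 ^ ?d * (r / l) powr s)"
      proof -
        have "(r / l) ^ ?d = (r / l) powr real ?d" using r0 l by (simp add: powr_realpow)
        also have "\<dots> \<le> (r / l) powr s"
          using r0 l r s by (intro powr_mono') auto
        finally show ?thesis using c0 by (intro mult_left_mono) auto
      qed
      finally show "8 ^ ?d * P r * (real N * (5 * r * real N) ^ ?d) \<le> c * (8 ^ ?d * 4 * 20 ^ ?d * (r / l) powr s)" .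
    qed simp
    have C1: "1 \<le> (8::real) ^ ?d * 4 * 20 ^ ?d"
    proof -
      have "1 * 4 * 1 \<le> (8::real) ^ ?d * 4 * 20 ^ ?d"
        by (intro mult_mono one_le_power) auto
      then show ?thesis by linarith
    qed
    have "real (meet_count l' ys (sup_ball z r)) \<le> (8 ^ ?d * 4 * 20 ^ ?d) * real (m1 * bc) * (r / l) powr s"
      if r: "l' \<le> r" "r \<le> l" for z r
    proof (cases "r \<le> 1 / real N")
      case True
      have "1 * (real (m1 * bc) * (r / l) powr s) \<le> (8 ^ ?d * 4 * 20 ^ ?d) * (real (m1 * bc) * (r / l) powr s)"
        by (intro mult_right_mono C1) auto
      then show ?thesis using small[OF r(1) True, of z] by (simp add: mult_ac)
    next
      case False
      then show ?thesis using large[of r z] r by (simp add: mult_ac)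
    qed
    moreover have "length ys = m1 * bc" using ys(1) Z(2) bc_def by simp
    ultimately show ?thesis using good small[OF order_refl l'N] by blast
  qed
  show ?thesis
    using l'(1) l'N m1(2) bc0 child by (intro exI[of _ l'] exI[of _ "m1 * bc"] conjI allI impI) auto
qed

section \<open>Lower bound\<close>

text \<open>The right-hand side is convex and piecewise linear in \<open>v\<close>, hence it is enough to compare the two
  sides at the breakpoints \<open>t j\<close>.\<close>
lemma linear_le_sum_max_breakpoints:
  fixes t :: "'i \<Rightarrow> real"
  assumes L: "finite L" and \<sigma>: "0 < \<sigma>" "\<sigma> < real (card L)"
    and break: "\<And>j. j \<in> L \<Longrightarrow> \<sigma> * (1 + t j) \<le> c + (\<Sum>k\<in>{k \<in> L. t k < t j}. t j - t k)"
  shows "\<sigma> * (1 + v) \<le> c + (\<Sum>i\<in>L. max 0 (v - t i))"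
proof -
  define A where "A = {i \<in> L. t i \<le> v}"
  have finA: "finite A" unfolding A_def using L by simp
  have sumA: "(\<Sum>i\<in>L. max 0 (v - t i)) = (\<Sum>i\<in>A. v - t i)"
    using L unfolding A_def sum.inter_filter[OF L] by (intro sum.cong) auto
  show ?thesis
  \<comment> \<open>The slope of the right-hand side at \<open>v\<close> is \<open>card A\<close>.
    If it is at least \<open>\<sigma>\<close>, the gap between the two sides shrinks on the way back
    to the last breakpoint; otherwise it shrinks on the way to the next one, which exists because
    \<open>\<sigma> < card L\<close>.\<close>
  proof (cases "\<sigma> \<le> real (card A)")
    case True
    then have "A \<noteq> {}" using \<sigma>(1) by auto
    then have "Max (t ` A) \<in> t ` A" using finA by (intro Max_in) auto
    then obtain j where j: "j \<in> A" "t j = Max (t ` A)" by auto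
    have le: "t i \<le> t j" if "i \<in> A" for i using that finA unfolding j(2) by simp
    have jL: "j \<in> L" "t j \<le> v" using j(1) unfolding A_def by auto
    have "(\<Sum>k\<in>{k \<in> L. t k < t j}. t j - t k) = (\<Sum>k\<in>A. t j - t k)"
      using L jL le by (intro sum.mono_neutral_left) (force simp: A_def)+
    moreover have "(\<Sum>i\<in>A. v - t i) = (\<Sum>k\<in>A. t j - t k) + real (card A) * (v - t j)"
      by (simp add: sum_subtractf algebra_simps)
    moreover have "\<sigma> * (v - t j) \<le> real (card A) * (v - t j)"
      using True jL by (intro mult_right_mono) auto
    ultimately show ?thesis using break[OF jL(1)] unfolding sumA by (simp add: algebra_simps)
  next
    case False
    then have "A \<noteq> L" using \<sigma>(2) by auto
    then have ne: "L - A \<noteq> {}" unfolding A_def by auto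
    have "Min (t ` (L - A)) \<in> t ` (L - A)" using L ne by (intro Min_in) auto
    then obtain j where j: "j \<in> L - A" "t j = Min (t ` (L - A))" by auto
    have le: "t j \<le> t i" if "i \<in> L - A" for i using that L unfolding j(2) by simp
    have jL: "j \<in> L" "v < t j" using j(1) unfolding A_def by auto
    have "{k \<in> L. t k < t j} = A"
    proof
      show "{k \<in> L. t k < t j} \<subseteq> A" using le by force
      show "A \<subseteq> {k \<in> L. t k < t j}" unfolding A_def using jL by auto
    qed
    then have "\<sigma> * (1 + t j) \<le> c + (\<Sum>k\<in>A. t j - t k)" using break[OF jL(1)] by simp
    moreover have "(\<Sum>k\<in>A. t j - t k) = (\<Sum>i\<in>A. v - t i) + real (card A) * (t j - v)"
      by (simp add: sum_subtractf algebra_simps)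
    moreover have "real (card A) * (t j - v) \<le> \<sigma> * (t j - v)"
      using False jL by (intro mult_right_mono) auto
    ultimately show ?thesis unfolding sumA by (simp add: algebra_simps)
  qed
qed

section \<open>Logarithmic losses and the density estimate\<close>

lemma harm_le_ln:
  assumes "1 \<le> N"
  shows "harm N \<le> 1 + ln (real N)"
proof -
  have "harm (Suc (N - 1)) - ln (real (Suc (N - 1))) \<le> harm (Suc 0) - ln (real (Suc 0))"
    using decseqD[OF decseq_harm_diff_ln, of 0 "N - 1"] by simp
  then show ?thesis using assms by (simp add: harm_expand)
qed

lemma eventually_log_powers_le:
  fixes \<epsilon> c :: real
  assumes "0 < \<epsilon>" "0 < c"
  shows "\<forall>\<^sub>F n :: nat in sequentially. (log 2 (real n) + 2) * (1 + ln (real n)) \<le> c * real n powr \<epsilon>"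
proof -
  have "((\<lambda>n::nat. (log 2 (real n) + 2) * (1 + ln (real n)) / real n powr \<epsilon>) \<longlongrightarrow> 0) sequentially"
    using assms(1) by real_asymp
  then have "\<forall>\<^sub>F n :: nat in sequentially. (log 2 (real n) + 2) * (1 + ln (real n)) / real n powr \<epsilon> < c"
    using assms(2) by (rule order_tendstoD)
  then show ?thesis using eventually_gt_at_top[of 0]
    by eventually_elim (simp add: field_simps)
qed

text \<open>With \<open>r = N powr - (1 + v)\<close> the comparison becomes one of exponents of
  \<open>N\<close>, settled by \<open>break\<close> at all scales at once. It is won with the
  surplus \<open>N powr (- 2 * \<epsilon>)\<close>: one half pays for the factor
  \<open>N powr \<epsilon>\<close> on the left, the other for \<open>2 * D\<close>. For
  \<open>r ^ d\<close> the surplus comes from \<open>d - s\<close> and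
  \<open>r \<le> 1 / N\<close>.\<close>

lemma fine_scale_estimate:
  fixes \<rho> \<tau> :: "'d::finite \<Rightarrow> real"
  assumes N: "2 \<le> N" and r: "0 < r" "r \<le> 1 / real N" and \<rho>0: "\<And>i. 0 < \<rho> i"
    and \<rho>: "\<And>i. i \<in> L \<Longrightarrow> real N powr - (1 + \<tau> i + \<delta>) \<le> \<rho> i"
    and break: "\<And>v. \<sigma> * (1 + v) \<le> real CARD('d) + 1 + (\<Sum>i\<in>L. max 0 (v - \<tau> i))"
    and \<delta>: "0 \<le> \<delta>" "real CARD('d) * \<delta> + 2 * \<epsilon> \<le> \<sigma> - s"
    and s: "s \<le> \<sigma>" "2 * \<epsilon> \<le> real CARD('d) - s"
    and \<epsilon>: "0 \<le> \<epsilon>" and D: "0 \<le> D" "2 * D \<le> real N powr \<epsilon>"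
  shows "D * real N powr \<epsilon> * ((\<Prod>i\<in>UNIV. min 1 (r / \<rho> i)) / real N ^ (CARD('d) + 1) + r ^ CARD('d)) \<le> r powr s"
proof -
  let ?d = "CARD('d)"
  let ?N = "real N"
  have N1: "1 < ?N" using N by simp
  define v where "v = - log ?N r - 1"
  have rv: "r = ?N powr - (1 + v)" unfolding v_def using N1 r by simp
  have v0: "0 \<le> v"
  proof -
    have "log ?N r \<le> log ?N (1 / ?N)" using N1 r by simp
    then show ?thesis unfolding v_def using N1 by (simp add: log_divide)
  qed
  have min0: "0 \<le> min 1 (r / \<rho> i) \<and> min 1 (r / \<rho> i) \<le> 1" for i using r \<rho>0[of i] by simp
  have "(\<Prod>i\<in>UNIV. min 1 (r / \<rho> i)) = (\<Prod>i\<in>L. min 1 (r / \<rho> i)) * (\<Prod>i\<in>UNIV - L. min 1 (r / \<rho> i))"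
    by (subst prod.subset_diff[of L]) (auto simp: mult.commute)
  \<comment> \<open>Outside \<open>L\<close> there is no lower bound on \<open>\<rho> i\<close>, so
    these factors are estimated by 1; this is where infinite orders drop out of the
    exponent.\<close>
  also have "\<dots> \<le> (\<Prod>i\<in>L. min 1 (r / \<rho> i)) * 1"
    using min0 by (intro mult_left_mono prod_le_1 prod_nonneg) auto
  also have "\<dots> \<le> (\<Prod>i\<in>L. ?N powr (\<delta> - max 0 (v - \<tau> i)))"
    unfolding mult_1_right
  proof (intro prod_mono conjI)
    fix i assume i: "i \<in> L"
    show "min 1 (r / \<rho> i) \<le> ?N powr (\<delta> - max 0 (v - \<tau> i))"
    proof (cases "v \<le> \<tau> i")
      case True
      then have "1 \<le> ?N powr (\<delta> - max 0 (v - \<tau> i))" using \<delta>(1) N1 by (intro ge_one_powr_ge_zero) auto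
      then show ?thesis by simp
    next
      case False
      have "r / \<rho> i \<le> r / (?N powr - (1 + \<tau> i + \<delta>))"
        using \<rho>[OF i] r(1) N1 \<rho>0[of i] by (intro divide_left_mono) auto
      also have "\<dots> = ?N powr (\<delta> - (v - \<tau> i))"
        unfolding rv powr_diff[symmetric] by (simp add: algebra_simps)
      finally show ?thesis using False by simp
    qed
  qed (use min0 in auto)
  also have "\<dots> = ?N powr (\<Sum>i\<in>L. \<delta> - max 0 (v - \<tau> i))"
    using N1 by (subst powr_sum) auto
  also have "\<dots> \<le> ?N powr (real ?d + 1 - 2 * \<epsilon> - s * (1 + v))"
  proof (rule powr_mono)
    have "(\<Sum>i\<in>L. \<delta> - max 0 (v - \<tau> i)) = real (card L) * \<delta> - (\<Sum>i\<in>L. max 0 (v - \<tau> i))"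
      by (simp add: sum_subtractf)
    moreover have "real (card L) * \<delta> \<le> real ?d * \<delta>"
      using \<delta>(1) by (intro mult_right_mono) (auto intro: card_mono)
    moreover have "(\<sigma> - s) * 1 \<le> (\<sigma> - s) * (1 + v)" using s(1) v0 by (intro mult_left_mono) auto
    ultimately show "(\<Sum>i\<in>L. \<delta> - max 0 (v - \<tau> i)) \<le> real ?d + 1 - 2 * \<epsilon> - s * (1 + v)"
      using break[of v] \<delta>(2) by (simp add: algebra_simps)
  qed (use N1 in simp)
  also have "\<dots> = ?N powr (- 2 * \<epsilon>) * r powr s * ?N ^ (?d + 1)"
  proof -
    have "?N ^ (?d + 1) = ?N powr (real ?d + 1)" using N1 by (simp add: powr_add powr_realpow)
    moreover have "real ?d + 1 - 2 * \<epsilon> - s * (1 + v) = - 2 * \<epsilon> + - (1 + v) * s + (real ?d + 1)"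
      by (simp add: algebra_simps)
    ultimately show ?thesis unfolding rv powr_powr by (simp only: powr_add)
  qed
  finally have 1: "(\<Prod>i\<in>UNIV. min 1 (r / \<rho> i)) / ?N ^ (?d + 1) \<le> ?N powr (- 2 * \<epsilon>) * r powr s"
    using N1 by (subst pos_divide_le_eq) auto
  have 2: "r ^ ?d \<le> ?N powr (- 2 * \<epsilon>) * r powr s"
  proof -
    have "r powr (real ?d - s) \<le> (1 / ?N) powr (real ?d - s)"
      using r s(2) \<epsilon> by (intro powr_mono2) auto
    also have "\<dots> = ?N powr - (real ?d - s)" using N1 by (subst powr_minus_divide) (simp add: powr_divide)
    also have "\<dots> \<le> ?N powr (- 2 * \<epsilon>)" using N1 s(2) by (intro powr_mono) auto
    finally have "r powr (real ?d - s) * r powr s \<le> ?N powr (- 2 * \<epsilon>) * r powr s"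
      by (rule mult_right_mono) simp
    moreover have "r powr (real ?d - s) * r powr s = r ^ ?d"
      using r(1) by (simp add: powr_add[symmetric] powr_realpow)
    ultimately show ?thesis by simp
  qed
  have "D * ?N powr \<epsilon> * ((\<Prod>i\<in>UNIV. min 1 (r / \<rho> i)) / ?N ^ (?d + 1) + r ^ ?d)
      \<le> D * ?N powr \<epsilon> * (2 * (?N powr (- 2 * \<epsilon>) * r powr s))"
    using 1 2 D(1) by (intro mult_left_mono) auto
  also have "\<dots> = (2 * D) * (?N powr \<epsilon> * ?N powr (- 2 * \<epsilon>)) * r powr s" by (simp add: mult_ac)
  also have "?N powr \<epsilon> * ?N powr (- 2 * \<epsilon>) = ?N powr (- \<epsilon>)" by (simp add: powr_add[symmetric])
  also have "(2 * D) * ?N powr (- \<epsilon>) * r powr s \<le> ?N powr \<epsilon> * ?N powr (- \<epsilon>) * r powr s"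
    using D(2) by (intro mult_right_mono) auto
  also have "\<dots> = r powr s" using N1 by (simp add: powr_add[symmetric])
  finally show ?thesis .
qed

lemma dist_nearest_int_le: "dist_nearest_int x \<le> \<bar>x - real_of_int p\<bar>"
  unfolding dist_nearest_int_def by (metis Ints_of_int dist_real_def infdist_le)

lemma dist_nearest_int_attained: "\<exists>p. dist_nearest_int x = \<bar>x - real_of_int p\<bar>"
proof -
  obtain y where "y \<in> \<int>" "infdist x \<int> = dist x y"
    using infdist_attains_inf[of "\<int>" x] closed_Ints Ints_0 by blast
  then show ?thesis unfolding dist_nearest_int_def by (auto simp: dist_real_def elim!: Ints_cases)
qed

lemma order_accumulation_points_coordinate:
  assumes "t \<in> order_accumulation_points \<psi>"
  obtains r where "strict_mono r" "\<And>i. (\<lambda>k. ereal (- ln (\<psi> i (real (r k))) / ln (real (r k)))) \<longlonglongrightarrow> t $ i"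
proof -
  obtain r where r: "strict_mono r" "(order_seq \<psi> \<circ> r) \<longlonglongrightarrow> t"
    using assms unfolding order_accumulation_points_def by blast
  have "(\<lambda>k. ereal (- ln (\<psi> i (real (r k))) / ln (real (r k)))) \<longlonglongrightarrow> t $ i" for i
    using tendsto_vec_nth[OF r(2), of i] by (simp add: order_seq_def)
  then show thesis using r(1) that by blast
qed

lemma less_finite_coord_eq:
  assumes t0: "\<And>i. 0 \<le> t $ i" and j: "j \<in> finite_coords t"
  shows "{k. t $ k < t $ j} = {k \<in> finite_coords t. real_of_ereal (t $ k) < real_of_ereal (t $ j)}"
proof -
  have fin: "t $ i = ereal (real_of_ereal (t $ i))" if "i \<in> finite_coords t" for i
    using that t0[of i] unfolding finite_coords_def by (cases "t $ i") auto
  show ?thesis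
  proof (intro equalityI subsetI)
    fix k assume k: "k \<in> {k. t $ k < t $ j}"
    then have "k \<in> finite_coords t" using j unfolding finite_coords_def by (auto intro: less_trans)
    then show "k \<in> {k \<in> finite_coords t. real_of_ereal (t $ k) < real_of_ereal (t $ j)}"
      using k fin[OF j] fin[of k] by (metis (mono_tags, lifting) less_ereal.simps(1) mem_Collect_eq)
  next
    fix k assume "k \<in> {k \<in> finite_coords t. real_of_ereal (t $ k) < real_of_ereal (t $ j)}"
    then show "k \<in> {k. t $ k < t $ j}"
      using fin[OF j] fin[of k] by (metis (mono_tags, lifting) less_ereal.simps(1) mem_Collect_eq)
  qed
qed

text \<open>For a given parent cube only finitely many conditions are imposed on \<open>N\<close>,
  each valid eventually along the subsequence realising \<open>t\<close>. Hence \<open>N\<close> may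
  be chosen after \<open>l\<close>, and every constant depending on \<open>l\<close> is absorbed by
  \<open>N powr \<epsilon>\<close>.\<close>

lemma hausdorff_measure_approximable_set_neq_0:
  fixes \<psi> :: "'d::finite \<Rightarrow> real \<Rightarrow> real"
  assumes pos: "\<And>i x. 0 < x \<Longrightarrow> 0 < \<psi> i x"
    and dec: "\<And>i x y. 0 < x \<Longrightarrow> x \<le> y \<Longrightarrow> \<psi> i y \<le> \<psi> i x"
    and t: "t \<in> order_accumulation_points \<psi>" and s: "0 < s" "s < dim_bound t"
  shows "hausdorff_measure s (approximable_set \<psi>) \<noteq> 0"
proof -
  let ?d = "CARD('d)"
  define L where "L = finite_coords t"
  define \<tau> where "\<tau> i = real_of_ereal (t $ i)" for i
  have t0: "0 \<le> t $ i" for i using t unfolding order_accumulation_points_def by blast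
  have Lne: "L \<noteq> {}" using s unfolding dim_bound_def L_def by auto
  have tL: "t $ i = ereal (\<tau> i)" if "i \<in> L" for i
    using that t0[of i] unfolding L_def finite_coords_def \<tau>_def by (cases "t $ i") auto
  have \<tau>0: "0 \<le> \<tau> i" for i unfolding \<tau>_def using t0[of i] by (simp add: real_of_ereal_pos)
  obtain \<sigma> where \<sigma>: "s < \<sigma>" "\<sigma> < dim_bound t" using s(2) dense by blast
  have bound: "\<sigma> < real (card L)" "\<And>j. j \<in> L \<Longrightarrow> \<sigma> < zeta_coord t j"
    using \<sigma>(2) Lne unfolding dim_bound_def L_def by auto
  have "real (card L) \<le> real ?d" by (simp add: card_mono)
  then have sd: "s < real ?d" using bound(1) \<sigma>(1) by linarith
  have lin: "\<sigma> * (1 + v) \<le> real ?d + 1 + (\<Sum>i\<in>L. max 0 (v - \<tau> i))" for v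
  proof (rule linear_le_sum_max_breakpoints)
    fix j assume j: "j \<in> L"
    have eq: "{k. t $ k < t $ j} = {k \<in> L. \<tau> k < \<tau> j}"
      using less_finite_coord_eq[OF t0, of j] j unfolding L_def \<tau>_def by blast
    have "\<sigma> < (real ?d + 1 + (\<Sum>k\<in>{k \<in> L. \<tau> k < \<tau> j}. \<tau> j - \<tau> k)) / (1 + \<tau> j)"
      using bound(2)[OF j] unfolding zeta_coord_def eq \<tau>_def by simp
    then have "\<sigma> * (1 + \<tau> j) < real ?d + 1 + (\<Sum>k\<in>{k \<in> L. \<tau> k < \<tau> j}. \<tau> j - \<tau> k)"
      using \<tau>0[of j] by (subst (asm) pos_less_divide_eq) auto
    then show "\<sigma> * (1 + \<tau> j) \<le> real ?d + 1 + (\<Sum>k\<in>{k \<in> L. \<tau> k < \<tau> j}. \<tau> j - \<tau> k)" by simp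
  qed (use s \<sigma> bound in auto)
  \<comment> \<open>The gap \<open>\<sigma> - s\<close> is halved: \<open>d * \<delta>\<close> pays
    for orders that are only approximated at finite \<open>N\<close>, and
    \<open>2 * \<epsilon>\<close> for logarithms and constants. The second entry of the minimum
    serves the term \<open>r ^ d\<close>.\<close>
  define \<epsilon> where "\<epsilon> = min ((\<sigma> - s) / 4) ((real ?d - s) / 2)"
  define \<delta> where "\<delta> = (\<sigma> - s) / (2 * real ?d)"
  have \<epsilon>: "0 < \<epsilon>" "2 * \<epsilon> \<le> real ?d - s" "4 * \<epsilon> \<le> \<sigma> - s"
    unfolding \<epsilon>_def using \<sigma>(1) sd by (auto simp: min_def)
  have \<delta>: "0 < \<delta>" "real ?d * \<delta> = (\<sigma> - s) / 2" unfolding \<delta>_def using \<sigma>(1) by auto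
  obtain r where r: "strict_mono r" and
    lim: "\<And>i. (\<lambda>k. ereal (- ln (\<psi> i (real (r k))) / ln (real (r k)))) \<longlonglongrightarrow> t $ i"
    using order_accumulation_points_coordinate[OF t] by blast
  have rtop: "filterlim r at_top sequentially" by (rule filterlim_subseq[OF r])
  define good where "good q v \<longleftrightarrow> 1 \<le> q \<and> (\<forall>i. dist_nearest_int (real q * v $ i) \<le> \<psi> i (real q))"
    for q :: nat and v :: "real^'d"
  have "approximable_set \<psi> = {v \<in> corner_cube 0 1. infinite {q. good q v}}"
    unfolding approximable_set_def good_def corner_cube_def by auto
  moreover have "hausdorff_measure s {v \<in> corner_cube 0 1. infinite {q. good q v}} \<noteq> 0"
  proof (rule hausdorff_measure_cantor_scheme[where C = "8 ^ ?d * 4 * 20 ^ ?d"])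
    show "(1::real) \<le> 8 ^ ?d * 4 * 20 ^ ?d"
    proof -
      have "1 * 4 * 1 \<le> (8::real) ^ ?d * 4 * 20 ^ ?d"
        by (intro mult_mono one_le_power) auto
      then show ?thesis by linarith
    qed
    fix A :: nat and l :: real
    assume l: "0 < l" "l \<le> 1"
    define D where "D = 8 ^ ?d * 4 ^ (?d + 1) * 2 ^ ?d * 2 / l ^ ?d"
    have D0: "0 < D" unfolding D_def using l by simp
    define c where "c = l ^ ?d / (4 * 4 ^ ?d * 18 ^ ?d)"
    have c0: "0 < c" unfolding c_def using l by simp
    have "\<forall>\<^sub>F n in sequentially. 8 / l \<le> real n \<and> 2 * D \<le> real n powr \<epsilon> \<and> 2 \<le> n \<and> 2 * A + 2 \<le> n \<and>
        (log 2 (real n) + 2) * (1 + ln (real n)) \<le> c * real n powr \<epsilon>"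
    proof (intro eventually_conj eventually_ge_at_top eventually_log_powers_le \<epsilon> c0)
      show "\<forall>\<^sub>F n in sequentially. 8 / l \<le> real n"
        by (rule eventually_compose_filterlim[OF eventually_ge_at_top filterlim_real_sequentially])
      have "filterlim (\<lambda>n::nat. real n powr \<epsilon>) at_top sequentially" using \<epsilon>(1) by real_asymp
      then show "\<forall>\<^sub>F n in sequentially. 2 * D \<le> real n powr \<epsilon>"
        by (rule eventually_compose_filterlim[OF eventually_ge_at_top])
    qed
    from eventually_compose_filterlim[OF this rtop]
    have ev1: "\<forall>\<^sub>F k in sequentially. 8 / l \<le> real (r k) \<and> 2 * D \<le> real (r k) powr \<epsilon> \<and> 2 \<le> r k \<and> 2 * A + 2 \<le> r k \<and>
        (log 2 (real (r k)) + 2) * (1 + ln (real (r k))) \<le> c * real (r k) powr \<epsilon>" .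
    have "\<forall>\<^sub>F k in sequentially. \<forall>i\<in>L. ereal (- ln (\<psi> i (real (r k))) / ln (real (r k))) < ereal (\<tau> i + \<delta>)"
    proof (intro eventually_ball_finite ballI)
      fix i assume "i \<in> L"
      then have "t $ i < ereal (\<tau> i + \<delta>)" using tL[of i] \<delta>(1) by simp
      then show "\<forall>\<^sub>F k in sequentially. ereal (- ln (\<psi> i (real (r k))) / ln (real (r k))) < ereal (\<tau> i + \<delta>)"
        by (rule order_tendstoD(2)[OF lim])
    qed simp
    from eventually_happens[OF eventually_conj[OF ev1 this]] obtain k where
      k: "8 / l \<le> real (r k)" "2 * D \<le> real (r k) powr \<epsilon>" "2 \<le> r k" "2 * A + 2 \<le> r k"
        "(log 2 (real (r k)) + 2) * (1 + ln (real (r k))) \<le> c * real (r k) powr \<epsilon>"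
      and kL': "\<forall>i\<in>L. ereal (- ln (\<psi> i (real (r k))) / ln (real (r k))) < ereal (\<tau> i + \<delta>)"
      by auto
    have kL: "- ln (\<psi> i (real (r k))) / ln (real (r k)) < \<tau> i + \<delta>" if "i \<in> L" for i
      using bspec[OF kL' that] by (simp only: less_ereal.simps)
    define N where "N = r k"
    note k = k[folded N_def] and kL = kL[folded N_def]
    have N2: "2 \<le> N" and N1: "1 \<le> N" and N0: "0 < real N" using k(3) by auto
    have Nl: "8 \<le> real N * l" using k(1) l(1) by (simp add: field_simps)
    \<comment> \<open>Truncation at 1 keeps the sides within \<open>1 / N\<close>, as the pair
      counts demand, even where \<open>\<psi> i N\<close> exceeds 1. Because the orders are
      nonnegative, the lower bound \<open>\<rho>L\<close> survives it.\<close>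
    define \<rho> where "\<rho> i = min 1 (\<psi> i (real N)) / real N" for i
    have \<rho>: "0 < \<rho> i" "\<rho> i \<le> 1 / real N" for i
      unfolding \<rho>_def using pos[OF N0, of i] N0 by (auto simp: divide_right_mono)
    have \<rho>L: "real N powr - (1 + \<tau> i + \<delta>) \<le> \<rho> i" if i: "i \<in> L" for i
    proof -
      have lnN: "0 < ln (real N)" using N2 by simp
      have "- ln (\<psi> i (real N)) < (\<tau> i + \<delta>) * ln (real N)"
        using kL[OF i] lnN by (simp only: pos_divide_less_eq)
      then have "- (\<tau> i + \<delta>) * ln (real N) < ln (\<psi> i (real N))"
        by (simp only: mult_minus_left)
      then have "exp (- (\<tau> i + \<delta>) * ln (real N)) \<le> \<psi> i (real N)"
        using pos[OF N0, of i] by (metis exp_le_cancel_iff exp_ln less_imp_le)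
      then have "real N powr - (\<tau> i + \<delta>) \<le> \<psi> i (real N)"
        using N0 by (simp add: powr_def)
      moreover have "real N powr - (\<tau> i + \<delta>) \<le> real N powr 0"
        using N1 \<tau>0[of i] \<delta>(1) by (intro powr_mono) auto
      ultimately have "real N powr - (\<tau> i + \<delta>) / real N \<le> \<rho> i"
        unfolding \<rho>_def using N0 by (intro divide_right_mono) auto
      also have "real N powr - (\<tau> i + \<delta>) / real N = real N powr - (1 + \<tau> i + \<delta>)"
      proof -
        have "- (1 + \<tau> i + \<delta>) = - (\<tau> i + \<delta>) - 1" by simp
        then show ?thesis using N0 by (simp only: powr_diff powr_one)
      qed
      finally show ?thesis .
    qed
    have bad: "(log 2 (real N) + 2) * 18 ^ ?d * harm N * real N ^ (?d + 1)
        \<le> real N / 4 * (real N * l / 4) ^ ?d * (real N powr \<epsilon>)"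
    proof -
      have "0 \<le> log 2 (real N)" using N1 by simp
      then have "(log 2 (real N) + 2) * harm N \<le> (log 2 (real N) + 2) * (1 + ln (real N))"
        using harm_le_ln[OF N1] by (intro mult_left_mono) auto
      also have "\<dots> \<le> c * real N powr \<epsilon>" by (rule k(5))
      finally have "(log 2 (real N) + 2) * harm N * (18 ^ ?d * real N ^ (?d + 1))
          \<le> c * real N powr \<epsilon> * (18 ^ ?d * real N ^ (?d + 1))"
        by (rule mult_right_mono) simp
      also have "\<dots> = real N / 4 * (real N * l / 4) ^ ?d * (real N powr \<epsilon>)"
        unfolding c_def by (simp add: power_divide power_mult_distrib)
      finally show ?thesis by (simp add: mult_ac)
    qed
    have fine: "D * real N powr \<epsilon> * ((\<Prod>i\<in>UNIV. min 1 (u / \<rho> i)) / real N ^ (?d + 1) + u ^ ?d) \<le> u powr s"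
      if u: "0 < u" "u \<le> 1 / real N" for u
      using N2 u \<rho>(1) \<rho>L lin
    proof (rule fine_scale_estimate)
      show "real ?d * \<delta> + 2 * \<epsilon> \<le> \<sigma> - s" using \<delta>(2) \<epsilon>(3) by simp
    qed (use \<delta> \<epsilon> \<sigma> k(2) D0 in auto)
    have "\<exists>l' m. 0 < l' \<and> l' \<le> 1 / real N \<and> 0 < m \<and>
      (\<forall>x :: real^'d. corner_cube x l \<subseteq> corner_cube 0 1 \<longrightarrow> (\<exists>ys. length ys = m \<and>
        (\<forall>y\<in>set ys. corner_cube y l' \<subseteq> corner_cube x l \<and> (\<forall>v\<in>corner_cube y l'.
           \<exists>q p. N < 2 * q \<and> q \<le> N \<and> (\<forall>i. \<bar>real q * v$i - real_of_int (p i)\<bar> \<le> real q * \<rho> i))) \<and>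
        (\<forall>z r. l' \<le> r \<longrightarrow> r \<le> l \<longrightarrow> real (meet_count l' ys (sup_ball z r))
           \<le> (8 ^ ?d * 4 * 20 ^ ?d) * real m * (r / l) powr s) \<and>
        (\<forall>z. real (meet_count l' ys (sup_ball z l')) \<le> real m * (l' / l) powr s)))"
      using N1 \<rho> l Nl _ s(1) less_imp_le[OF sd] bad fine[unfolded D_def]
      by (rule cantor_step) (use N0 in simp)
    then obtain l' m where l': "0 < l'" "l' \<le> 1 / real N" and m: "0 < m" and
      ch: "\<And>x :: real^'d. corner_cube x l \<subseteq> corner_cube 0 1 \<Longrightarrow> \<exists>ys. length ys = m \<and>
        (\<forall>y\<in>set ys. corner_cube y l' \<subseteq> corner_cube x l \<and> (\<forall>v\<in>corner_cube y l'.
           \<exists>q p. N < 2 * q \<and> q \<le> N \<and> (\<forall>i. \<bar>real q * v$i - real_of_int (p i)\<bar> \<le> real q * \<rho> i))) \<and>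
        (\<forall>z r. l' \<le> r \<longrightarrow> r \<le> l \<longrightarrow> real (meet_count l' ys (sup_ball z r))
           \<le> (8 ^ ?d * 4 * 20 ^ ?d) * real m * (r / l) powr s) \<and>
        (\<forall>z. real (meet_count l' ys (sup_ball z l')) \<le> real m * (l' / l) powr s)"
      by blast
    have goodI: "\<exists>q\<ge>A. good q v"
      if qp: "\<exists>q p. N < 2 * q \<and> q \<le> N \<and> (\<forall>i. \<bar>real q * v$i - real_of_int (p i)\<bar> \<le> real q * \<rho> i)" for v
    proof -
      obtain q p where q: "N < 2 * q" "q \<le> N" and
        p: "\<And>i. \<bar>real q * v$i - real_of_int (p i)\<bar> \<le> real q * \<rho> i" using qp by blast
      have q0: "0 < real q" using q(1) by simp
      have "dist_nearest_int (real q * v $ i) \<le> \<psi> i (real q)" for i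
      proof -
        have "dist_nearest_int (real q * v $ i) \<le> real q * \<rho> i"
          using dist_nearest_int_le p order_trans by blast
        also have "\<dots> \<le> real N * \<rho> i" using q(2) \<rho>(1)[of i] by (intro mult_right_mono) auto
        also have "\<dots> \<le> \<psi> i (real N)" unfolding \<rho>_def using N0 by simp
        also have "\<dots> \<le> \<psi> i (real q)" using q(2) q0 by (intro dec) auto
        finally show ?thesis .
      qed
      moreover have "A \<le> q" "1 \<le> q" using q k(4) by linarith+
      ultimately show ?thesis unfolding good_def by blast
    qed
    have "1 / real N \<le> l / 2" using Nl N0 by (simp add: field_simps)
    then have l'2: "l' \<le> l / 2" using l'(2) by linarith
    show "\<exists>l' m. 0 < l' \<and> l' \<le> l / 2 \<and> 0 < m \<and>
      (\<forall>x. corner_cube x l \<subseteq> corner_cube 0 1 \<longrightarrow> (\<exists>ys. length ys = m \<and>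
        (\<forall>y\<in>set ys. corner_cube y l' \<subseteq> corner_cube x l \<and> (\<forall>v\<in>corner_cube y l'. \<exists>q\<ge>A. good q v)) \<and>
        (\<forall>z r. l' \<le> r \<longrightarrow> r \<le> l \<longrightarrow>
          real (meet_count l' ys (sup_ball z r)) \<le> 8 ^ ?d * 4 * 20 ^ ?d * real m * (r / l) powr s) \<and>
        (\<forall>z. real (meet_count l' ys (sup_ball z l')) \<le> real m * (l' / l) powr s)))"
    proof (rule exI[of _ l'], rule exI[of _ m], intro conjI allI impI)
      fix x :: "real^'d" assume "corner_cube x l \<subseteq> corner_cube 0 1"
      from ch[OF this] obtain ys where ys: "length ys = m"
        "\<And>y. y \<in> set ys \<Longrightarrow> corner_cube y l' \<subseteq> corner_cube x l"
        "\<And>y v. y \<in> set ys \<Longrightarrow> v \<in> corner_cube y l' \<Longrightarrow>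
           \<exists>q p. N < 2 * q \<and> q \<le> N \<and> (\<forall>i. \<bar>real q * v$i - real_of_int (p i)\<bar> \<le> real q * \<rho> i)"
        "\<And>z r. l' \<le> r \<Longrightarrow> r \<le> l \<Longrightarrow> real (meet_count l' ys (sup_ball z r))
           \<le> (8 ^ ?d * 4 * 20 ^ ?d) * real m * (r / l) powr s"
        "\<And>z. real (meet_count l' ys (sup_ball z l')) \<le> real m * (l' / l) powr s"
        by blast
      then show "\<exists>ys. length ys = m \<and>
        (\<forall>y\<in>set ys. corner_cube y l' \<subseteq> corner_cube x l \<and> (\<forall>v\<in>corner_cube y l'. \<exists>q\<ge>A. good q v)) \<and>
        (\<forall>z r. l' \<le> r \<longrightarrow> r \<le> l \<longrightarrow>
          real (meet_count l' ys (sup_ball z r)) \<le> 8 ^ ?d * 4 * 20 ^ ?d * real m * (r / l) powr s) \<and>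
        (\<forall>z. real (meet_count l' ys (sup_ball z l')) \<le> real m * (l' / l) powr s)"
        using goodI[OF ys(3)] by blast
    qed (fact l'(1) l'2 m)+
  qed (fact s(1))
  ultimately show ?thesis by simp
qed

section \<open>Upper bound\<close>

text \<open>Compactness of the extended reals is applied to one coordinate after another, by
  successive extraction of subsequences.\<close>

lemma subseq_limit_ereal_vec:
  fixes X :: "nat \<Rightarrow> ereal ^ 'd::finite"
  shows "\<exists>t r. strict_mono r \<and> (X \<circ> r) \<longlonglongrightarrow> t"
proof -
  have "\<exists>t r. strict_mono (r :: nat \<Rightarrow> nat) \<and> (\<forall>i\<in>S. (\<lambda>n. X (r n) $ i) \<longlonglongrightarrow> t $ i)"
    if "finite S" for S :: "'d set"
    using that
  proof (induction S)
    case empty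
    then show ?case using strict_mono_id by auto
  next
    case (insert a S)
    then obtain t r where r: "strict_mono (r :: nat \<Rightarrow> nat)"
      "\<And>i. i \<in> S \<Longrightarrow> (\<lambda>n. X (r n) $ i) \<longlonglongrightarrow> t $ i" by blast
    have "compact (UNIV :: ereal set)" by (rule compact_UNIV)
    then have "seq_compact (UNIV :: ereal set)" by (rule compact_imp_seq_compact)
    then obtain l r' where r': "strict_mono (r' :: nat \<Rightarrow> nat)" "((\<lambda>n. X (r n) $ a) \<circ> r') \<longlonglongrightarrow> l"
      unfolding seq_compact_def by (metis UNIV_I)
    define t' where "t' = (\<chi> i. if i = a then l else t $ i)"
    have "(\<lambda>n. X ((r \<circ> r') n) $ i) \<longlonglongrightarrow> t' $ i" if "i \<in> insert a S" for i
    proof (cases "i = a")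
      case True
      then show ?thesis using r'(2) by (simp add: t'_def o_def)
    next
      case False
      then have "(\<lambda>n. X (r n) $ i) \<longlonglongrightarrow> t $ i" using that r(2) by blast
      from LIMSEQ_subseq_LIMSEQ[OF this r'(1)] show ?thesis using False by (simp add: t'_def o_def)
    qed
    moreover have "strict_mono (r \<circ> r')" using r(1) r'(1) by (rule strict_mono_o)
    ultimately show ?case by blast
  qed
  from this[of UNIV] obtain t r where "strict_mono (r :: nat \<Rightarrow> nat)" "\<And>i. (\<lambda>n. X (r n) $ i) \<longlonglongrightarrow> t $ i"
    by auto
  then have "(\<lambda>n. X (r n)) \<longlonglongrightarrow> t" by (intro vec_tendstoI)
  then show ?thesis using \<open>strict_mono r\<close> by (auto simp: o_def)
qed

text \<open>Nonnegativity of the limit is automatic: \<open>\<psi> i n \<le> \<psi> i 1\<close>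
  bounds the order at \<open>n\<close> from below by a constant over \<open>ln n\<close>, which
  tends to zero.\<close>

lemma subseq_limit_in_order_accumulation_points:
  fixes \<psi> :: "'d::finite \<Rightarrow> real \<Rightarrow> real"
  assumes pos: "\<And>i x. 0 < x \<Longrightarrow> 0 < \<psi> i x"
    and dec: "\<And>i x y. 0 < x \<Longrightarrow> x \<le> y \<Longrightarrow> \<psi> i y \<le> \<psi> i x"
    and r: "strict_mono r" and t: "(order_seq \<psi> \<circ> r) \<longlonglongrightarrow> t"
  shows "t \<in> order_accumulation_points \<psi>"
proof -
  have "0 \<le> t $ i" for i
  proof -
    define b where "b = - \<bar>ln (\<psi> i 1)\<bar>"
    have lim: "(\<lambda>n. ereal (- ln (\<psi> i (real (r n))) / ln (real (r n)))) \<longlonglongrightarrow> t $ i"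
      using tendsto_vec_nth[OF t, of i] by (simp add: order_seq_def)
    have "filterlim (\<lambda>n::nat. ln (real n)) at_top sequentially" by real_asymp
    from filterlim_compose[OF this filterlim_subseq[OF r]]
    have "filterlim (\<lambda>n. ln (real (r n))) at_top sequentially" .
    from tendsto_divide_0[OF tendsto_const filterlim_at_top_imp_at_infinity[OF this]]
    have "(\<lambda>n. b / ln (real (r n))) \<longlonglongrightarrow> 0" .
    then have l0: "(\<lambda>n. ereal (b / ln (real (r n)))) \<longlonglongrightarrow> ereal 0" by simp
    have le: "ereal (b / ln (real (r n))) \<le> ereal (- ln (\<psi> i (real (r n))) / ln (real (r n)))" if "1 \<le> n" for n
    proof -
      have n: "1 \<le> r n" using that strict_mono_imp_increasing[OF r, of n] by linarith
      then have "\<psi> i (real (r n)) \<le> \<psi> i 1" by (intro dec) auto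
      then have "ln (\<psi> i (real (r n))) \<le> ln (\<psi> i 1)" using pos[of 1 i] pos[of "real (r n)" i] n by simp
      then have "b \<le> - ln (\<psi> i (real (r n)))" unfolding b_def by linarith
      then show ?thesis unfolding ereal_less_eq(3) by (rule divide_right_mono) (use n in simp)
    qed
    have "ereal 0 \<le> t $ i" using le by (intro LIMSEQ_le[OF l0 lim]) blast
    then show ?thesis by (simp add: zero_ereal_def)
  qed
  then show ?thesis unfolding order_accumulation_points_def using r t by blast
qed

section \<open>Exponents of covers of dyadic blocks\<close>

definition dyadic_order :: "('d \<Rightarrow> real \<Rightarrow> real) \<Rightarrow> nat \<Rightarrow> 'd \<Rightarrow> real" where
  "dyadic_order \<psi> j i = - ln (\<psi> i (2 ^ j)) / ln (2 ^ j)"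

text \<open>To the base \<open>2^j\<close> and up to constants, this is the cost of covering the
  block from \<open>2^j\<close> to \<open>2^(j+1)\<close> by cubes of side
  \<open>\<psi> k (2^j) / 2^j\<close>: \<open>d + 1\<close> counts fractions, the sum counts cubes
  per box, and \<open>s * (1 + a k)\<close> comes from the diameters. If the orders tend to
  \<open>t\<close> with \<open>t k\<close> finite, it tends to
  \<open>(1 + t k) * (zeta_coord t k - s)\<close>.\<close>

definition cover_exponent :: "real \<Rightarrow> ('d::finite \<Rightarrow> real) \<Rightarrow> 'd \<Rightarrow> real" where
  "cover_exponent s a k = real CARD('d) + 1 + (\<Sum>i\<in>UNIV. max 0 (a k - a i)) - s * (1 + a k)"

text \<open>If some \<open>zeta_coord t j\<close> is below \<open>s\<close>, then \<open>j\<close>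
  serves all large \<open>n\<close>, the infinite orders eventually adding nothing to the sum.
  Otherwise \<open>s\<close> exceeds the number \<open>m\<close> of finite orders. The smallest of
  the unbounded orders then leaves at most \<open>m\<close> terms, so the exponent is at most
  \<open>d + 1 - (s - m) * (1 + a n k)\<close>, which tends to minus infinity; here \<open>k\<close>
  may vary with \<open>n\<close>.\<close>

lemma cover_exponent_negative:
  fixes a :: "nat \<Rightarrow> 'd::finite \<Rightarrow> real" and t :: "ereal^'d"
  assumes lim: "\<And>i. (\<lambda>n. ereal (a n i)) \<longlonglongrightarrow> t $ i" and t0: "\<And>i. 0 \<le> t $ i"
    and s: "0 < s" "s \<le> real CARD('d)" "dim_bound t < s"
  shows "\<exists>\<epsilon>>0. \<forall>\<^sub>F n in sequentially. \<exists>k. cover_exponent s (a n) k < - \<epsilon>"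
proof -
  define L where "L = finite_coords t"
  define \<tau> where "\<tau> i = real_of_ereal (t $ i)" for i
  have tL: "t $ i = ereal (\<tau> i)" if "i \<in> L" for i
    using that t0[of i] unfolding L_def finite_coords_def \<tau>_def by (cases "t $ i") auto
  have tnL: "t $ i = \<infinity>" if "i \<notin> L" for i
    using that unfolding L_def finite_coords_def by simp
  have \<tau>0: "0 \<le> \<tau> i" for i unfolding \<tau>_def using t0[of i] by (simp add: real_of_ereal_pos)
  have limL: "(\<lambda>n. a n i) \<longlonglongrightarrow> \<tau> i" if "i \<in> L" for i
    using lim[of i] unfolding tL[OF that] by simp
  have big: "\<forall>\<^sub>F n in sequentially. M < a n i" if "i \<notin> L" for i M
  proof -
    have "ereal M < t $ i" using tnL[OF that] by simp
    from order_tendstoD(1)[OF lim this] show ?thesis by simp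
  qed
  consider (zeta) j where "j \<in> L" "zeta_coord t j < s" | (card) "real (card L) < s"
  proof (cases "L = {}")
    case True
    then show ?thesis using s(1) that(2) by simp
  next
    case False
    then have "min (Min (zeta_coord t ` L)) (real (card L)) < s"
      using s(3) unfolding dim_bound_def L_def by simp
    then consider "Min (zeta_coord t ` L) < s" | "real (card L) < s" by (auto simp: min_less_iff_disj)
    then show ?thesis
    proof cases
      case 1
      have "Min (zeta_coord t ` L) \<in> zeta_coord t ` L" using False by (intro Min_in) auto
      then show ?thesis using 1 that(1) by auto
    qed (rule that(2))
  qed
  then show ?thesis
  proof cases
    case (zeta j)
    have eq: "{k. t $ k < t $ j} = {k \<in> L. \<tau> k < \<tau> j}"
      using less_finite_coord_eq[OF t0, of j] zeta(1) unfolding L_def \<tau>_def by blast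
    define e where "e = real CARD('d) + 1 + (\<Sum>i\<in>UNIV. if i \<in> L then max 0 (\<tau> j - \<tau> i) else 0) - s * (1 + \<tau> j)"
    have "(\<lambda>n. cover_exponent s (a n) j) \<longlonglongrightarrow> e"
      unfolding cover_exponent_def e_def
    proof (intro tendsto_intros tendsto_sum limL zeta(1))
      fix i
      show "(\<lambda>n. max 0 (a n j - a n i)) \<longlonglongrightarrow> (if i \<in> L then max 0 (\<tau> j - \<tau> i) else 0)"
      proof (cases "i \<in> L")
        case True
        then show ?thesis using limL[OF True] limL[OF zeta(1)] by (auto intro!: tendsto_intros)
      next
        case False
        have "\<forall>\<^sub>F n in sequentially. a n j < \<tau> j + 1"
          using limL[OF zeta(1)] by (rule order_tendstoD) simp
        with big[OF False, of "\<tau> j + 1"] have "\<forall>\<^sub>F n in sequentially. max 0 (a n j - a n i) = 0"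
          by eventually_elim simp
        then show ?thesis using False by (simp add: tendsto_eventually)
      qed
    qed
    moreover have "e < 0"
    proof -
      have "(\<Sum>i\<in>UNIV. if i \<in> L then max 0 (\<tau> j - \<tau> i) else 0) = (\<Sum>k\<in>{k \<in> L. \<tau> k < \<tau> j}. \<tau> j - \<tau> k)"
        by (intro sum.mono_neutral_cong_right) auto
      moreover have "(real CARD('d) + 1 + (\<Sum>k\<in>{k \<in> L. \<tau> k < \<tau> j}. \<tau> j - \<tau> k)) / (1 + \<tau> j) < s"
        using zeta(2) unfolding zeta_coord_def eq \<tau>_def by simp
      then have "real CARD('d) + 1 + (\<Sum>k\<in>{k \<in> L. \<tau> k < \<tau> j}. \<tau> j - \<tau> k) < s * (1 + \<tau> j)"
        using \<tau>0[of j] by (subst (asm) pos_divide_less_eq) auto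
      ultimately show ?thesis unfolding e_def by simp
    qed
    ultimately have "\<forall>\<^sub>F n in sequentially. cover_exponent s (a n) j < e / 2"
      by (intro order_tendstoD) auto
    then have "\<forall>\<^sub>F n in sequentially. \<exists>k. cover_exponent s (a n) k < - (- e / 2)"
      by eventually_elim auto
    then show ?thesis using \<open>e < 0\<close> by (intro exI[of _ "- e / 2"]) auto
  next
    case card
    define m where "m = real (card L)"
    have m: "m < s" "0 \<le> m" unfolding m_def using card by auto
    have ne: "- L \<noteq> {}"
    proof
      assume "- L = {}"
      then have "L = UNIV" by auto
      then show False using card s(2) by simp
    qed
    \<comment> \<open>The quotient solves \<open>d + 1 - (s - m) * (1 + M) = - 1\<close>. The
      maximum with 0, together with the bound \<open>- 1 < a n i\<close> on the finite orders, makes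
      \<open>a n k + 1\<close> dominate every term of the sum, including those cut off at 0.\<close>
    define M where "M = max 0 ((real CARD('d) + 2 + m - s) / (s - m))"
    have "\<forall>\<^sub>F n in sequentially. \<forall>i\<in>-L. M < a n i"
      by (intro eventually_ball_finite ballI big) auto
    moreover have "\<forall>\<^sub>F n in sequentially. \<forall>i\<in>L. - 1 < a n i"
    proof (intro eventually_ball_finite ballI)
      fix i assume "i \<in> L"
      show "\<forall>\<^sub>F n in sequentially. - 1 < a n i"
        using limL[OF \<open>i \<in> L\<close>] \<tau>0[of i] by (intro order_tendstoD) auto
    qed simp
    ultimately have "\<forall>\<^sub>F n in sequentially. \<exists>k. cover_exponent s (a n) k < - 1"
    proof eventually_elim
      case (elim n)
      have "Min (a n ` (- L)) \<in> a n ` (- L)" using ne by (intro Min_in) auto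
      then obtain k where k: "k \<in> - L" "a n k = Min (a n ` (- L))" by auto
      have kmin: "a n k \<le> a n i" if "i \<in> - L" for i unfolding k(2) using that by (intro Min_le) auto
      have kM: "M < a n k" using elim(1) k(1) by blast
      have M0: "0 \<le> M" unfolding M_def by simp
      have "(\<Sum>i\<in>UNIV. max 0 (a n k - a n i)) = (\<Sum>i\<in>L. max 0 (a n k - a n i))"
        using kmin by (intro sum.mono_neutral_right) auto
      also have "\<dots> \<le> (\<Sum>i\<in>L. a n k + 1)"
        using elim(2) kM M0 by (intro sum_mono) (auto simp: less_imp_le)
      also have "\<dots> = m * (a n k + 1)" unfolding m_def by simp
      finally have le: "cover_exponent s (a n) k \<le> real CARD('d) + 1 + m * (a n k + 1) - s * (1 + a n k)"
        unfolding cover_exponent_def by simp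
      have "(real CARD('d) + 2 + m - s) / (s - m) < a n k" using kM unfolding M_def by simp
      then have "real CARD('d) + 2 + m - s < a n k * (s - m)"
        using m(1) by (subst (asm) pos_divide_less_eq) auto
      then have "cover_exponent s (a n) k < - 1" using le by (simp add: algebra_simps)
      then show ?case by blast
    qed
    then show ?thesis by (intro exI[of _ 1]) auto
  qed
qed

text \<open>Otherwise there are increasing \<open>j\<close> along which all exponents are at least
  \<open>- 1 / (n + 1)\<close>. The orders at the corresponding powers of 2 have a limit along a
  subsequence; it is an accumulation point, where \<open>cover_exponent_negative\<close> gives a
  fixed gain. Thus the gain is uniform although the best \<open>k\<close> changes with the
  block.\<close>

lemma cover_exponent_uniformly_negative:
  fixes \<psi> :: "'d::finite \<Rightarrow> real \<Rightarrow> real"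
  assumes pos: "\<And>i x. 0 < x \<Longrightarrow> 0 < \<psi> i x"
    and dec: "\<And>i x y. 0 < x \<Longrightarrow> x \<le> y \<Longrightarrow> \<psi> i y \<le> \<psi> i x"
    and s: "0 < s" "s \<le> real CARD('d)"
    and t: "\<And>t. t \<in> order_accumulation_points \<psi> \<Longrightarrow> dim_bound t < s"
  shows "\<exists>\<epsilon>>0. \<forall>\<^sub>F j in sequentially. \<exists>k. cover_exponent s (dyadic_order \<psi> j) k < - \<epsilon>"
proof (rule ccontr)
  assume no: "\<not> ?thesis"
  define P where "P n j \<longleftrightarrow> (\<forall>k. - (1 / real (Suc n)) \<le> cover_exponent s (dyadic_order \<psi> j) k)" for n j
  have ex: "\<exists>j. i < j \<and> P n j" for n i
  proof -
    have "\<not> (\<forall>\<^sub>F j in sequentially. \<exists>k. cover_exponent s (dyadic_order \<psi> j) k < - (1 / real (Suc n)))"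
      using no by (metis divide_pos_pos of_nat_0_less_iff zero_less_Suc zero_less_one)
    then show ?thesis
      unfolding eventually_sequentially P_def not_ex not_all by (metis Suc_le_eq not_less not_le)
  qed
  define f where "f n i = (SOME j. i < j \<and> P n j)" for n i
  have f: "i < f n i \<and> P n (f n i)" for n i
    unfolding f_def by (rule someI_ex[OF ex])
  define R where "R = rec_nat (f 0 0) (\<lambda>n j. f (Suc n) j)"
  have R_Suc: "R (Suc n) = f (Suc n) (R n)" for n unfolding R_def by simp
  have RP: "P n (R n)" for n using f by (cases n) (simp_all add: R_def)
  have Rmono: "strict_mono R" using f R_Suc by (intro strict_mono_Suc_iff[THEN iffD2]) auto
  obtain t r where r: "strict_mono (r :: nat \<Rightarrow> nat)" "((\<lambda>n. order_seq \<psi> (2 ^ R n)) \<circ> r) \<longlonglongrightarrow> t"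
    using subseq_limit_ereal_vec by blast
  have sm: "strict_mono (\<lambda>n. 2 ^ R (r n) :: nat)"
    using Rmono r(1) by (auto simp: strict_mono_def)
  have lim: "(\<lambda>n. ereal (dyadic_order \<psi> (R (r n)) i)) \<longlonglongrightarrow> t $ i" for i
    using tendsto_vec_nth[OF r(2), of i] by (simp add: order_seq_def dyadic_order_def o_def)
  have tU: "t \<in> order_accumulation_points \<psi>"
  proof (rule subseq_limit_in_order_accumulation_points[OF pos dec sm])
    have "order_seq \<psi> \<circ> (\<lambda>n. 2 ^ R (r n)) = (\<lambda>n. order_seq \<psi> (2 ^ R n)) \<circ> r" by (simp add: fun_eq_iff)
    then show "(order_seq \<psi> \<circ> (\<lambda>n. 2 ^ R (r n))) \<longlonglongrightarrow> t" using r(2) by metis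
  qed
  then have t0: "0 \<le> t $ i" for i unfolding order_accumulation_points_def by blast
  from cover_exponent_negative[OF lim t0 s t[OF tU]] obtain \<epsilon> where
    \<epsilon>: "\<epsilon> > 0" "\<forall>\<^sub>F n in sequentially. \<exists>k. cover_exponent s (dyadic_order \<psi> (R (r n))) k < - \<epsilon>"
    by blast
  have "(\<lambda>n. 1 / real (Suc n)) \<longlonglongrightarrow> 0" by (rule LIMSEQ_Suc[OF lim_1_over_n])
  then have "\<forall>\<^sub>F n in sequentially. 1 / real (Suc n) < \<epsilon>" using \<epsilon>(1) by (rule order_tendstoD)
  with \<epsilon>(2) have "\<forall>\<^sub>F n in sequentially. False"
  proof eventually_elim
    case (elim n)
    then obtain k where k: "cover_exponent s (dyadic_order \<psi> (R (r n))) k < - \<epsilon>" by blast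
    have "n \<le> r n" using r(1) by (rule strict_mono_imp_increasing)
    then have "1 / real (Suc (r n)) \<le> 1 / real (Suc n)" by (intro divide_left_mono) auto
    moreover have "- (1 / real (Suc (r n))) \<le> cover_exponent s (dyadic_order \<psi> (R (r n))) k"
      using RP[of "r n"] unfolding P_def by blast
    ultimately show False using k elim by linarith
  qed
  then show False by simp
qed

text \<open>The boxes are centred at \<open>p / q\<close> with half-sides \<open>w i\<close>, which
  combine the largest possible \<open>\<psi> i\<close> with the smallest denominator of the block.
  The constant is \<open>12 = 4 * 3\<close>: there are at most \<open>2^(j+2)\<close> numerators per
  coordinate, and \<open>2 * x + 1 \<le> 3 * y\<close> whenever \<open>x \<le> y\<close> and
  \<open>1 \<le> y\<close>, applied to the ratio \<open>x\<close> of two sides.\<close>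

lemma has_cover_dyadic_block:
  fixes \<psi> :: "'d::finite \<Rightarrow> real \<Rightarrow> real"
  assumes pos: "\<And>i x. 0 < x \<Longrightarrow> 0 < \<psi> i x"
    and dec: "\<And>i x y. 0 < x \<Longrightarrow> x \<le> y \<Longrightarrow> \<psi> i y \<le> \<psi> i x"
    and j: "1 \<le> j" and s: "0 < s"
  shows "has_cover s {x \<in> corner_cube 0 1. \<exists>q\<in>{2 ^ j..<2 ^ Suc j}. \<forall>i. dist_nearest_int (real q * x $ i) \<le> \<psi> i (real q)}
    (real CARD('d) * (\<psi> k (2 ^ j) / 2 ^ j))
    (12 ^ CARD('d) * real CARD('d) powr s * 2 powr (real j * cover_exponent s (dyadic_order \<psi> j) k))"
    (is "has_cover s ?W _ _")
proof -
  let ?d = "CARD('d)"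
  define w where "w i = \<psi> i (2 ^ j) / 2 ^ j" for i
  have w0: "0 < w i" for i unfolding w_def using pos by simp
  define I where "I = (SIGMA q:{2 ^ j..<2 ^ Suc j}. (\<Pi>\<^sub>E i\<in>(UNIV::'d set). {0..int q}))"
  define c where "c = (\<lambda>(q::nat, p::'d \<Rightarrow> int). (\<chi> i. real_of_int (p i) / real q - w i) :: real^'d)"
  have finI: "finite I" unfolding I_def by (intro finite_SigmaI finite_PiE) auto
  have cover: "?W \<subseteq> (\<Union>c\<in>c ` I. {y. \<forall>i. c $ i \<le> y $ i \<and> y $ i \<le> c $ i + 2 * w i})"
  proof
    fix x assume "x \<in> ?W"
    then obtain q where x: "x \<in> corner_cube 0 1" and q: "2 ^ j \<le> q" "q < 2 ^ Suc j"
      and near: "\<And>i. dist_nearest_int (real q * x $ i) \<le> \<psi> i (real q)" by auto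
    have x01: "0 \<le> x $ i" "x $ i \<le> 1" for i using x unfolding corner_cube_def by auto
    have "(2::real) ^ j \<le> real q" using q(1) by (metis of_nat_le_iff of_nat_numeral of_nat_power)
    moreover have "(0::real) < 2 ^ j" by simp
    ultimately have q2: "(2::real) ^ j \<le> real q" "0 < real q" by linarith+
    obtain p where p: "\<And>i. dist_nearest_int (real q * x $ i) = \<bar>real q * x $ i - real_of_int (p i)\<bar>"
      using choice[of "\<lambda>i p. dist_nearest_int (real q * x $ i) = \<bar>real q * x $ i - real_of_int p\<bar>"]
        dist_nearest_int_attained by blast
    \<comment> \<open>A nearest integer to a point of the interval from 0 to \<open>q\<close> is
      within 1/2 of it and so stays in the range; this bounds the number of boxes even when
      \<open>\<psi> i\<close> is large.\<close>
    have "0 \<le> p i \<and> p i \<le> int q" for i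
    proof -
      have "\<bar>real q * x $ i - real_of_int (p i)\<bar> \<le> \<bar>real q * x $ i - real_of_int (round (real q * x $ i))\<bar>"
        using dist_nearest_int_le p by metis
      also have "\<dots> \<le> 1 / 2" using of_int_round_abs_le[of "real q * x $ i"] by (simp add: abs_minus_commute)
      finally have "\<bar>real q * x $ i - real_of_int (p i)\<bar> \<le> 1 / 2" .
      moreover have "0 \<le> real q * x $ i" "real q * x $ i \<le> real q * 1"
        using x01[of i] q2 mult_left_mono[of "x $ i" 1 "real q"] by simp_all
      ultimately have "- 1 < real_of_int (p i)" "real_of_int (p i) < real q + 1" by linarith+
      then show ?thesis by linarith
    qed
    then have "(q, p) \<in> I" unfolding I_def using q by auto
    moreover have "c (q, p) $ i \<le> x $ i \<and> x $ i \<le> c (q, p) $ i + 2 * w i" for i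
    proof -
      have "\<bar>real q * x $ i - real_of_int (p i)\<bar> \<le> \<psi> i (2 ^ j)"
        using near[of i] p[of i] dec[of "2 ^ j" "real q" i] q2 by simp
      moreover have "real q * x $ i - real_of_int (p i) = real q * (x $ i - real_of_int (p i) / real q)"
        using q2 by (simp add: right_diff_distrib)
      ultimately have "real q * \<bar>x $ i - real_of_int (p i) / real q\<bar> \<le> \<psi> i (2 ^ j)"
        using q2 by (simp add: abs_mult)
      moreover have "2 ^ j * \<bar>x $ i - real_of_int (p i) / real q\<bar> \<le> real q * \<bar>x $ i - real_of_int (p i) / real q\<bar>"
        using q2 by (intro mult_right_mono) auto
      ultimately have "\<bar>x $ i - real_of_int (p i) / real q\<bar> * 2 ^ j \<le> \<psi> i (2 ^ j)" by (simp add: mult.commute)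
      then have "\<bar>x $ i - real_of_int (p i) / real q\<bar> \<le> w i"
        unfolding w_def by (subst pos_le_divide_eq) auto
      then show ?thesis unfolding c_def by (simp add: abs_le_iff)
    qed
    ultimately show "x \<in> (\<Union>c\<in>c ` I. {y. \<forall>i. c $ i \<le> y $ i \<and> y $ i \<le> c $ i + 2 * w i})" by blast
  qed
  have hc: "has_cover s ?W (real ?d * w k) (real (card (c ` I)) * (\<Prod>i\<in>UNIV. 2 * w i / w k + 1) * (real ?d * w k) powr s)"
    using finI w0 s cover by (intro has_cover_boxes) (auto intro: less_imp_le)
  define a where "a = dyadic_order \<psi> j"
  have \<psi>a: "\<psi> i (2 ^ j) = 2 powr (- (real j * a i))" for i
    unfolding a_def dyadic_order_def powr_def using j pos[of "2 ^ j" i] by (simp add: ln_realpow)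
  have card: "real (card (c ` I)) \<le> 4 ^ ?d * 2 powr (real j * (real ?d + 1))"
  proof -
    have "card (c ` I) \<le> card I" by (rule card_image_le[OF finI])
    also have "card I = (\<Sum>q\<in>{2 ^ j..<2 ^ Suc j}. (q + 1) ^ ?d)"
      unfolding I_def by (subst card_SigmaI) (auto simp: card_PiE nat_add_distrib intro!: finite_PiE)
    also have "\<dots> \<le> (\<Sum>q\<in>{2 ^ j..<2 ^ Suc j::nat}. (2 ^ (j + 2)) ^ ?d)"
      by (intro sum_mono power_mono) auto
    also have "\<dots> = 2 ^ j * (2 ^ (j + 2)) ^ ?d" by simp
    finally have "real (card (c ` I)) \<le> real (2 ^ j * (2 ^ (j + 2)) ^ ?d)" by (rule of_nat_mono)
    also have "\<dots> = 4 ^ ?d * (2 ^ j) ^ (?d + 1)"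
      by (simp add: power_add power_mult_distrib)
    also have "((2::real) ^ j) ^ (?d + 1) = 2 powr (real j * (real ?d + 1))"
    proof -
      have "((2::real) ^ j) ^ (?d + 1) = 2 ^ (j * (?d + 1))" by (simp only: power_mult)
      also have "\<dots> = 2 powr real (j * (?d + 1))" by (rule powr_realpow[symmetric]) simp
      finally show ?thesis by (simp add: algebra_simps)
    qed
    finally show ?thesis .
  qed
  have prod: "(\<Prod>i\<in>UNIV. 2 * w i / w k + 1) \<le> 3 ^ ?d * 2 powr (real j * (\<Sum>i\<in>UNIV. max 0 (a k - a i)))"
  proof -
    have "(\<Prod>i\<in>UNIV. 2 * w i / w k + 1) \<le> (\<Prod>i\<in>(UNIV::'d set). 3 * 2 powr (real j * max 0 (a k - a i)))"
    proof (intro prod_mono conjI)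
      fix i
      have "w i / w k = 2 powr (real j * (a k - a i))"
        unfolding w_def \<psi>a by (simp add: powr_diff[symmetric] right_diff_distrib)
      also have "\<dots> \<le> 2 powr (real j * max 0 (a k - a i))"
        by (intro powr_mono mult_left_mono) auto
      finally have "w i / w k \<le> 2 powr (real j * max 0 (a k - a i))" .
      moreover have "1 \<le> (2::real) powr (real j * max 0 (a k - a i))"
        by (intro ge_one_powr_ge_zero) auto
      ultimately show "2 * w i / w k + 1 \<le> 3 * 2 powr (real j * max 0 (a k - a i))" by simp
      show "0 \<le> 2 * w i / w k + 1" using w0[of i] w0[of k] by simp
    qed
    also have "\<dots> = 3 ^ ?d * 2 powr (real j * (\<Sum>i\<in>UNIV. max 0 (a k - a i)))"
      by (simp add: prod.distrib powr_sum sum_distrib_left)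
    finally show ?thesis .
  qed
  have prod0: "0 \<le> 2 * w i / w k + 1" for i using w0[of i] w0[of k] by simp
  have side: "(real ?d * w k) powr s = real ?d powr s * 2 powr (- (real j * (s * (1 + a k))))"
  proof -
    have "w k = 2 powr (- (real j * a k)) / 2 powr real j" unfolding w_def \<psi>a by (simp add: powr_realpow)
    also have "\<dots> = 2 powr (- (real j * (1 + a k)))" 
    proof -
      have "- (real j * a k) - real j = - (real j * (1 + a k))" by (simp add: distrib_left)
      then show ?thesis by (simp only: powr_diff[symmetric])
    qed
    finally show ?thesis using w0[of k] by (simp add: powr_mult powr_powr mult_ac)
  qed
  have "real (card (c ` I)) * (\<Prod>i\<in>UNIV. 2 * w i / w k + 1) * (real ?d * w k) powr s
      \<le> (4 ^ ?d * 2 powr (real j * (real ?d + 1))) * (3 ^ ?d * 2 powr (real j * (\<Sum>i\<in>UNIV. max 0 (a k - a i))))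
        * (real ?d powr s * 2 powr (- (real j * (s * (1 + a k)))))"
    unfolding side using prod0 by (intro mult_mono card prod order_refl mult_nonneg_nonneg prod_nonneg) auto
  also have "\<dots> = (4 ^ ?d * 3 ^ ?d) * real ?d powr s * (2 powr (real j * (real ?d + 1))
      * 2 powr (real j * (\<Sum>i\<in>UNIV. max 0 (a k - a i))) * 2 powr (- (real j * (s * (1 + a k)))))"
    by (simp only: mult_ac)
  also have "(4::real) ^ ?d * 3 ^ ?d = 12 ^ ?d" by (simp flip: power_mult_distrib)
  also have "2 powr (real j * (real ?d + 1)) * 2 powr (real j * (\<Sum>i\<in>UNIV. max 0 (a k - a i)))
      * 2 powr (- (real j * (s * (1 + a k)))) = 2 powr (real j * cover_exponent s a k)"
  proof -
    have "real j * cover_exponent s a k = real j * (real ?d + 1) + real j * (\<Sum>i\<in>UNIV. max 0 (a k - a i))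
        + - (real j * (s * (1 + a k)))"
      unfolding cover_exponent_def by (simp add: distrib_left right_diff_distrib)
    then show ?thesis by (simp only: powr_add)
  qed
  finally show ?thesis using has_cover_mono[OF hc order_refl order_refl] unfolding w_def a_def by blast
qed

lemma approximable_set_frequently_dyadic_block:
  assumes "x \<in> approximable_set \<psi>"
  shows "\<exists>\<^sub>\<infinity>j. x \<in> {x \<in> corner_cube 0 1. \<exists>q\<in>{2 ^ j..<2 ^ Suc j}. \<forall>i. dist_nearest_int (real q * x $ i) \<le> \<psi> i (real q)}"
  unfolding INFM_nat_le
proof
  fix n
  have x: "x \<in> corner_cube 0 1" using assms unfolding approximable_set_def corner_cube_def by auto
  from assms obtain q where q: "2 ^ n \<le> q" "1 \<le> q" "\<And>i. dist_nearest_int (real q * x $ i) \<le> \<psi> i (real q)"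
    unfolding approximable_set_def infinite_nat_iff_unbounded_le by blast
  obtain j where j: "2 ^ j \<le> q" "q < 2 ^ Suc j"
    using ex_power_ivl1[of 2 q] q(2) by auto
  have "(2::nat) ^ n < 2 ^ Suc j" using q(1) j(2) by linarith
  then have "n < Suc j" by (rule power_less_imp_less_exp[rotated]) simp
  then have "n \<le> j" by simp
  then show "\<exists>j\<ge>n. x \<in> {x \<in> corner_cube 0 1. \<exists>q\<in>{2 ^ j..<2 ^ Suc j}. \<forall>i. dist_nearest_int (real q * x $ i) \<le> \<psi> i (real q)}"
    using x j q(3) \<open>n \<le> j\<close> by (intro exI[of _ j] conjI CollectI bexI[of _ q]) auto
qed

text \<open>Exponents above \<open>d\<close> are settled by dyadic grids on the whole cube, because
  \<open>cover_exponent_negative\<close> assumes \<open>s \<le> d\<close>. A constant family turns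
  the limsup criterion into a plain covering argument.\<close>

lemma hausdorff_measure_unit_cube_eq_0:
  assumes "real CARD('d::finite) < s"
  shows "hausdorff_measure s (corner_cube 0 1 :: (real^'d) set) = 0"
proof -
  let ?d = "CARD('d)"
  have s: "0 < s" using assms by (smt (verit) of_nat_0_le_iff)
  define c where "c j = 2 ^ ?d * real ?d powr s * ((1/2) powr (s - real ?d)) ^ j" for j :: nat
  have hc: "has_cover s (corner_cube 0 1 :: (real^'d) set) (real ?d * (1/2) ^ j) (c j)" for j :: nat
  proof -
    have "has_cover s (corner_cube 0 1 :: (real^'d) set) (real ?d * (1/2) ^ j)
        (real (card {0 :: real^'d}) * (\<Prod>i\<in>(UNIV::'d set). 1 / (1/2) ^ j + 1) * (real ?d * (1/2) ^ j) powr s)"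
      using s by (intro has_cover_boxes) (auto simp: corner_cube_def)
    moreover have "real (card {0 :: real^'d}) * (\<Prod>i\<in>(UNIV::'d set). 1 / (1/2) ^ j + 1) * (real ?d * (1/2) ^ j) powr s \<le> c j"
    proof -
      have side: "(real ?d * (1/2) ^ j) powr s = real ?d powr s * 2 powr (- (real j * s))"
      proof -
        have "((1::real)/2) ^ j = 2 powr (- real j)" by (simp add: powr_minus powr_realpow power_one_over inverse_eq_divide)
        then show ?thesis by (simp add: powr_mult powr_powr)
      qed
      have geo: "2 powr (real j * real ?d + - (real j * s)) = ((1/2) powr (s - real ?d)) ^ j"
      proof -
        have "((1/2) powr (s - real ?d)) ^ j = (1/2::real) powr ((s - real ?d) * real j)"
          by (simp add: powr_powr flip: powr_realpow)
        also have "\<dots> = 2 powr (- ((s - real ?d) * real j))"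
          by (simp add: powr_minus_divide powr_divide)
        finally show ?thesis by (simp add: algebra_simps)
      qed
      have "real (card {0 :: real^'d}) * (\<Prod>i\<in>(UNIV::'d set). 1 / (1/2) ^ j + 1) * (real ?d * (1/2) ^ j) powr s
          \<le> 1 * (\<Prod>i\<in>(UNIV::'d set). 2 * 2 powr real j) * (real ?d * (1/2) ^ j) powr s"
        by (intro mult_mono prod_mono prod_nonneg mult_nonneg_nonneg) (auto simp: powr_realpow power_one_over)
      also have "(\<Prod>i\<in>(UNIV::'d set). 2 * 2 powr real j) = 2 ^ ?d * 2 powr (real j * real ?d)"
        by (simp add: power_mult_distrib powr_powr flip: powr_realpow)
      also have "1 * (2 ^ ?d * 2 powr (real j * real ?d)) * (real ?d * (1/2) ^ j) powr s = c j"
        unfolding side c_def geo[symmetric] powr_add by (simp only: mult_ac mult_1_left)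
      finally show ?thesis .
    qed
    ultimately show ?thesis using has_cover_mono by blast
  qed
  show ?thesis
  proof (rule hausdorff_measure_limsup_eq_0[where J = 0 and A = "\<lambda>_. corner_cube 0 1" and c = c
        and D = "\<lambda>j. real ?d * (1/2) ^ j"])
    show "(\<lambda>j. real ?d * (1/2) ^ j) \<longlonglongrightarrow> 0"
      by (intro tendsto_mult_right_zero LIMSEQ_power_zero) simp
    have "1 < (2::real) powr (s - real ?d)" using assms by (intro gr_one_powr) auto
    then have "(1/2::real) powr (s - real ?d) < 1" by (simp add: powr_divide)
    then show "summable c" unfolding c_def by (intro summable_mult summable_geometric) simp
    show "0 \<le> c j" for j unfolding c_def by simp
  qed (use hc in simp_all)
qed

lemma hausdorff_measure_mono: "A \<subseteq> B \<Longrightarrow> hausdorff_measure s A \<le> hausdorff_measure s B"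
  unfolding hausdorff_measure_def hausdorff_premeasure_def
  by (intro SUP_mono' INF_superset_mono) (auto simp: delta_covers_def)

lemma hausdorff_measure_approximable_set_eq_0:
  fixes \<psi> :: "'d::finite \<Rightarrow> real \<Rightarrow> real"
  assumes pos: "\<And>i x. 0 < x \<Longrightarrow> 0 < \<psi> i x"
    and dec: "\<And>i x y. 0 < x \<Longrightarrow> x \<le> y \<Longrightarrow> \<psi> i y \<le> \<psi> i x"
    and s: "0 < s" and t: "\<And>t. t \<in> order_accumulation_points \<psi> \<Longrightarrow> dim_bound t < s"
  shows "hausdorff_measure s (approximable_set \<psi>) = 0"
proof (cases "real CARD('d) < s")
  case True
  have "approximable_set \<psi> \<subseteq> corner_cube 0 1" unfolding approximable_set_def corner_cube_def by auto
  then show ?thesis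
    using hausdorff_measure_mono[of "approximable_set \<psi>" "corner_cube 0 1" s]
      hausdorff_measure_unit_cube_eq_0[OF True] by simp
next
  case False
  let ?d = "CARD('d)"
  obtain \<epsilon> where \<epsilon>: "0 < \<epsilon>" "\<forall>\<^sub>F j in sequentially. \<exists>k. cover_exponent s (dyadic_order \<psi> j) k < - \<epsilon>"
    using cover_exponent_uniformly_negative[of \<psi> s, OF pos dec s _ t] False by auto
  obtain J where J: "\<And>j. j \<ge> J \<Longrightarrow> \<exists>k. cover_exponent s (dyadic_order \<psi> j) k < - \<epsilon>"
    using \<epsilon>(2) unfolding eventually_sequentially by blast
  define c where "c j = 12 ^ ?d * real ?d powr s * (2 powr (- \<epsilon>)) ^ j" for j :: nat
  \<comment> \<open>The index \<open>k\<close> depends on \<open>j\<close>; summing over all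
    \<open>k\<close> gives a single bound on the diameters that tends to zero.\<close>
  define D where "D j = real ?d * ((\<Sum>k\<in>UNIV. \<psi> k 1) * (1/2) ^ j)" for j :: nat
  show ?thesis
  proof (rule hausdorff_measure_limsup_eq_0[where J = "max 1 J" and c = c and D = D])
    fix j assume j: "max 1 J \<le> j"
    then obtain k where k: "cover_exponent s (dyadic_order \<psi> j) k < - \<epsilon>" using J[of j] by auto
    have "\<psi> k (2 ^ j) \<le> \<psi> k 1" by (intro dec) auto
    also have "\<dots> \<le> (\<Sum>k\<in>UNIV. \<psi> k 1)"
      using pos by (intro member_le_sum) (auto intro: less_imp_le)
    finally have "real ?d * (\<psi> k (2 ^ j) / 2 ^ j) \<le> D j"
      unfolding D_def by (intro mult_left_mono) (auto simp: power_one_over divide_simps)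
    moreover have "2 powr (real j * cover_exponent s (dyadic_order \<psi> j) k) \<le> (2 powr (- \<epsilon>)) ^ j"
    proof -
      have "real j * cover_exponent s (dyadic_order \<psi> j) k \<le> real j * (- \<epsilon>)"
        using k by (intro mult_left_mono) auto
      then have "2 powr (real j * cover_exponent s (dyadic_order \<psi> j) k) \<le> 2 powr (real j * (- \<epsilon>))"
        by (intro powr_mono) auto
      also have "\<dots> = (2 powr (- \<epsilon>)) ^ j" by (simp add: powr_powr mult.commute flip: powr_realpow)
      finally show ?thesis .
    qed
    then have "12 ^ ?d * real ?d powr s * 2 powr (real j * cover_exponent s (dyadic_order \<psi> j) k) \<le> c j"
      unfolding c_def by (intro mult_left_mono) auto
    ultimately show "has_cover s {x \<in> corner_cube 0 1. \<exists>q\<in>{2 ^ j..<2 ^ Suc j}. \<forall>i. dist_nearest_int (real q * x $ i) \<le> \<psi> i (real q)} (D j) (c j)"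
      using has_cover_mono[OF has_cover_dyadic_block[of \<psi>, OF pos dec _ s] order_refl] j by simp
  next
    show "D \<longlonglongrightarrow> 0" unfolding D_def
      by (intro tendsto_mult_right_zero LIMSEQ_power_zero) simp
    have "1 < (2::real) powr \<epsilon>" using \<epsilon>(1) by (intro gr_one_powr) auto
    then have "(2::real) powr (- \<epsilon>) < 1" by (simp add: powr_minus_divide)
    then show "summable c" unfolding c_def by (intro summable_mult summable_geometric) simp
    show "0 \<le> c j" for j unfolding c_def by simp
  qed (rule approximable_set_frequently_dyadic_block)
qed

section \<open>The dimension formula\<close>

lemma hausdorff_measure_0_neq_0:
  assumes "A \<noteq> {}"
  shows "hausdorff_measure 0 A \<noteq> 0"
proof -
  have "1 \<le> hausdorff_premeasure 0 1 A"
    unfolding hausdorff_premeasure_def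
  proof (rule INF_greatest)
    fix U :: "nat \<Rightarrow> 'a set" assume "U \<in> delta_covers 1 A"
    then obtain n where "U n \<noteq> {}" using assms unfolding delta_covers_def by fastforce
    then have "1 = diam_pow 0 (U n)" by (simp add: diam_pow_def)
    also have "\<dots> = (\<Sum>k\<in>{n}. diam_pow 0 (U k))" by simp
    also have "\<dots> \<le> (\<Sum>k. diam_pow 0 (U k))" by (intro sum_le_suminf) auto
    finally show "1 \<le> (\<Sum>k. diam_pow 0 (U k))" .
  qed
  also have "\<dots> \<le> hausdorff_measure 0 A"
    unfolding hausdorff_measure_def by (rule SUP_upper) simp
  finally show ?thesis by auto
qed

lemma zero_in_approximable_set:
  assumes "\<And>i x. 0 < x \<Longrightarrow> 0 < \<psi> i x"
  shows "0 \<in> approximable_set \<psi>"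
proof -
  have "dist_nearest_int 0 = 0" unfolding dist_nearest_int_def by simp
  then have "{q::nat. 1 \<le> q \<and> (\<forall>i. dist_nearest_int (real q * 0 $ i) \<le> \<psi> i (real q))} = {1..}"
    using assms by (auto intro: less_imp_le)
  then show ?thesis unfolding approximable_set_def by (simp add: infinite_Ici)
qed

lemma dim_bound_nonneg:
  assumes t: "\<And>i. 0 \<le> t $ i"
  shows "0 \<le> dim_bound t"
proof -
  have "0 \<le> zeta_coord t i" if i: "i \<in> finite_coords t" for i
    unfolding zeta_coord_def
  proof (intro divide_nonneg_nonneg add_nonneg_nonneg sum_nonneg)
    fix k assume "k \<in> {k. t $ k < t $ i}"
    then show "0 \<le> real_of_ereal (t $ i) - real_of_ereal (t $ k)"
      using real_of_ereal_positive_mono[of "t $ k" "t $ i"] t i unfolding finite_coords_def by auto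
  qed (use t in \<open>auto intro: real_of_ereal_pos\<close>)
  then show ?thesis unfolding dim_bound_def by auto
qed

theorem theorem1:
  fixes \<psi> :: "'d::finite \<Rightarrow> real \<Rightarrow> real"
  assumes "\<And>i x. 0 < x \<Longrightarrow> 0 < \<psi> i x"
    and "\<And>i. antimono_on {0<..} (\<psi> i)"
  shows "hausdorff_dim (approximable_set \<psi>) =
           (SUP t\<in>order_accumulation_points \<psi>. ereal (dim_bound t))"
proof (rule antisym)
  have dec: "\<psi> i y \<le> \<psi> i x" if "0 < x" "x \<le> y" for i x y
    using monotone_onD[OF assms(2)[of i], of x y] that by simp
  show "hausdorff_dim (approximable_set \<psi>) \<le> (SUP t\<in>order_accumulation_points \<psi>. ereal (dim_bound t))"
  proof (rule dense_ge)
    fix y assume y: "(SUP t\<in>order_accumulation_points \<psi>. ereal (dim_bound t)) < y"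
    \<comment> \<open>Some accumulation point always exists, so the supremum is over a nonempty set
      of nonnegative values. This makes \<open>y\<close> positive, as the covering argument
      requires.\<close>
    obtain t0 r where r: "strict_mono r" "(order_seq \<psi> \<circ> r) \<longlonglongrightarrow> t0"
      using subseq_limit_ereal_vec by blast
    have t0: "t0 \<in> order_accumulation_points \<psi>"
      by (rule subseq_limit_in_order_accumulation_points[of \<psi> r t0]) (fact assms(1) dec r)+
    then have "0 \<le> ereal (dim_bound t0)"
      by (auto simp: order_accumulation_points_def intro: dim_bound_nonneg)
    also have "\<dots> < y" by (rule le_less_trans[OF SUP_upper[OF t0, of "\<lambda>t. ereal (dim_bound t)"] y])
    finally have y0: "0 < y" .
    show "hausdorff_dim (approximable_set \<psi>) \<le> y"
    proof (cases y)
      case (real s)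
      have "dim_bound t < s" if "t \<in> order_accumulation_points \<psi>" for t
        using le_less_trans[OF SUP_upper[OF that, of "\<lambda>t. ereal (dim_bound t)"] y] unfolding real by simp
      then have "hausdorff_measure s (approximable_set \<psi>) = 0"
        using y0 real by (intro hausdorff_measure_approximable_set_eq_0[of \<psi>, OF assms(1) dec]) auto
      then show ?thesis
        unfolding hausdorff_dim_def real using y0 real by (intro INF_lower) auto
    qed (use y0 in auto)
  qed
  show "(SUP t\<in>order_accumulation_points \<psi>. ereal (dim_bound t)) \<le> hausdorff_dim (approximable_set \<psi>)"
    unfolding hausdorff_dim_def
  proof (intro SUP_least INF_greatest)
    fix t s
    assume t: "t \<in> order_accumulation_points \<psi>"
      and "s \<in> {s. 0 \<le> s \<and> hausdorff_measure s (approximable_set \<psi>) = 0}"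
    then have s: "0 \<le> s" "hausdorff_measure s (approximable_set \<psi>) = 0" by auto
    \<comment> \<open>The exponent 0 also competes in the infimum. It is excluded because the set
      contains the origin and the 0-dimensional measure of a nonempty set is positive; positive
      exponents are left to the Cantor construction.\<close>
    have "s \<noteq> 0" using hausdorff_measure_0_neq_0[of "approximable_set \<psi>"] zero_in_approximable_set[of \<psi>] assms(1) s(2) by auto
    then have "\<not> s < dim_bound t"
      using hausdorff_measure_approximable_set_neq_0[of \<psi>, OF assms(1) dec t] s by force
    then show "ereal (dim_bound t) \<le> ereal s" by simp
  qed
qed

end
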